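(* Let $(G^n)_{n\ge 1}$ be a sequence of finite connected weighted graphs with at least two vertices each, with distinguished vertices $\rho^n\in V(G^n)$, let $(K,d_K)$ be a compact metric space with distinguished point $\rho$, $\pi$ a Borel measure of full support on $K$, and $X$ a $\pi$-symmetric Hunt process on $K$ with local times $L$ (all as in the context). Suppose there are sequences of positive real numbers $(\alpha(n))_{n\ge1}$, $(\beta(n))_{n\ge 1}$ with $\alpha(n)\beta(n)=m^{G^n}$ for every $n\ge1$ such that, for every $T>0$, with $X^n$ started from $\rho^n$ and $X$ started from $\rho$, $$\Big(\big(V(G^n),\alpha(n)d_{G^n},\rho^n\big),\pi^n,\big(X^n_{\beta(n)t}\big)_{t\in[0,T]},\big(\alpha(n)L^n_{\beta(n)t}(x)\big)_{x\in V(G^n),t\in[0,T]}\Big)\longrightarrow\Big((K,d_K,\rho),\pi,X,(L_t(x))_{x\in K,t\in[0,T]}\Big)$$ in distribution with respect to the extended pointed Gromov–Hausdorff metric $d_{\tilde{\mathbb K}}$. Let $\varepsilon\in(0,1)$. If, $\mathbf P_\rho$-almost surely, the map $\varepsilon'\mapsto\tau_{\mathrm{bl}}(\varepsilon')$ is continuous at $\varepsilon$, then $\beta(n)^{-1}\tau^n_{\mathrm{bl}}(\varepsilon)$ (under $\mathbf P^n_{\rho^n}$) converges in distribution to $\tau_{\mathrm{bl}}(\varepsilon)$ (under $\mathbf P_\rho$) as $n\to\infty$.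
   Context: **Graphs.** A finite connected graph $G$ carries a symmetric weight $\mu^G:V(G)^2\to\mathbb R_+$ with $\mu^G_{xy}>0$ iff $\{x,y\}\in E(G)$; $\mu^G_x=\sum_y\mu^G_{xy}$, $m^G=\sum_x\mu^G_x$. The weighted random walk $X^G$ is the discrete-time Markov chain with transition probabilities $\mu^G_{xy}/\mu^G_x$; its stationary probability is $\pi^G(A)=\sum_{x\in A}\mu^G_x/m^G$. Its local times are $L^G_0(x)=0$ and $L^G_t(x)=\frac1{\mu^G_x}\sum_{i=0}^{t-1}\mathbf 1_{\{X^G_i=x\}}$ for integers $t\ge1$, extended to real $t\ge0$ by linear interpolation when they appear in the convergence hypothesis. $d_G$ is a metric on $V(G)$ (e.g. shortest path or effective resistance metric). The $\varepsilon$-blanket time variable is $\tau^G_{\mathrm{bl}}(\varepsilon)=\inf\{t\ge 1\text{ integer}: m^GL^G_t(x)\ge\varepsilon t\ \forall x\in V(G)\}$. A superscript $n$ denotes the corresponding object for $G^n$; $X^n_{\beta(n)t}$ means $X^n_{\lfloor\beta(n)t\rfloor}$; $\mathbf P^n_{\rho^n}$ is the law of $X^n$ started from $\rho^n$. **Limit.** $X=((X_t)_{t\ge0},\mathbf P_x,x\in K)$ is a $\pi$-symmetric Hunt process admitting local times $(L_t(x))_{x\in K,t\ge0}$ (occupation densities: $\int_0^tf(X_s)ds=\int_K f(x)L_t(x)\pi(dx)$) which are continuous in $x$, uniformly over compact intervals of $t$, $\mathbf P_x$-a.s. for every $x\in K$. $\tau_{\mathrm{bl}}(\varepsilon)=\inf\{t>0:L_t(x)\ge\varepsilon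 t\ \forall x\in K\}$. **Topology.** $\tilde{\mathbb K}$ is the space of (equivalence classes of) quadruples $(K,\pi^K,X^K,L^K)$ where $K$ is a non-empty compact metric space with a distinguished point $\rho$, $\pi^K$ a finite Borel measure on $K$, $X^K$ a càdlàg path $[0,T]\to K$, and $L^K=(L^K_t(x))_{x\in K,t\in[0,T]}$ a jointly continuous nonnegative function; two quadruples are equivalent if a root-preserving (bijective) isometry carries one to the other. The metric $d_{\tilde{\mathbb K}}$ between two quadruples is the infimum, over metric spaces $(Z,d_Z)$, isometric embeddings $\phi:K\to Z$, $\phi':K'\to Z$ and correspondences $\mathcal C\subseteq K\times K'$ containing $(\rho,\rho')$, of $$d^Z_P(\pi^K\circ\phi^{-1},\pi^{K'}\circ\phi'^{-1})+d^Z_{J_1}(\phi(X^K),\phi'(X^{K'}))+\sup_{(x,x')\in\mathcal C}\Big(d_Z(\phi(x),\phi'(x'))+\sup_{t\in[0,T]}|L^K_t(x)-L^{K'}_t(x')|\Big),$$ where $d_P^Z$ is the Prokhorov metric and $d^Z_{J_1}(x,y)=\inf_\lambda\{\sup_t|\lambda(t)-t|+\sup_td_Z(x(\lambda(t)),y(t))\}$, the infimum being over increasing homeomorphisms $\lambda$ of $[0,T]$. A correspondence is a subset of $K\times K'$ projecting onto both factors. *)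

theory Defs
  imports "HOL-Probability.Probability"
begin

section \<open>Convergence in distribution in a topological space\<close>

text \<open>Random elements are required to take values in the space, and to be Borel measurable, only up
  to null sets: the local times of the limit process are jointly continuous only almost surely.
  For this reason laws are computed with the completed measure.\<close>

definition random_element :: "'w measure \<Rightarrow> 's topology \<Rightarrow> ('w \<Rightarrow> 's) \<Rightarrow> bool" where
  "random_element M S Y \<longleftrightarrow>
     (AE \<omega> in M. Y \<omega> \<in> topspace S) \<and>
     (\<forall>U. openin S U \<longrightarrow> Y -` U \<inter> space M \<in> sets (completion M))"

definition converges_in_distribution ::
  "'s topology \<Rightarrow> (nat \<Rightarrow> 'v measure) \<Rightarrow> (nat \<Rightarrow> 'v \<Rightarrow> 's) \<Rightarrow> 'w measure \<Rightarrow> ('w \<Rightarrow> 's) \<Rightarrow> bool"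
where
  "converges_in_distribution S Mn Yn M Y \<longleftrightarrow>
     (\<forall>n. random_element (Mn n) S (Yn n)) \<and> random_element M S Y \<and>
     (\<forall>F. continuous_map S euclideanreal F \<and> bounded (F ` topspace S) \<longrightarrow>
        (\<lambda>n. \<integral>\<omega>. F (Yn n \<omega>) \<partial>completion (Mn n)) \<longlonglongrightarrow> (\<integral>\<omega>. F (Y \<omega>) \<partial>completion M))"


section \<open>Metric spaces, the Prokhorov metric and the Skorokhod metric\<close>

definition mborel :: "'a metric \<Rightarrow> 'a measure" where
  "mborel m = sigma (mspace m) {U. openin (mtopology_of m) U}"

definition scale_metric :: "real \<Rightarrow> 'a metric \<Rightarrow> 'a metric" where
  "scale_metric c m = metric (mspace m, \<lambda>x y. c * mdist m x y)"

lemma mspace_mdist_scale_metric: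
  assumes "0 < c"
  shows "mspace (scale_metric c m) = mspace m" "mdist (scale_metric c m) = (\<lambda>x y. c * mdist m x y)"
proof -
  interpret A: Metric_space "mspace m" "mdist m" by simp
  have "Metric_space (mspace m) (\<lambda>x y. c * mdist m x y)"
  proof
    fix x y z assume "x \<in> mspace m" "y \<in> mspace m" "z \<in> mspace m"
    then show "c * mdist m x z \<le> c * mdist m x y + c * mdist m y z"
      using A.triangle assms by (simp flip: distrib_left)
  qed (use assms A.commute in auto)
  then show "mspace (scale_metric c m) = mspace m" "mdist (scale_metric c m) = (\<lambda>x y. c * mdist m x y)"
    by (simp_all add: scale_metric_def Metric_space.mspace_metric Metric_space.mdist_metric)
qed

definition isometric_embedding :: "'a metric \<Rightarrow> 'b metric \<Rightarrow> ('a \<Rightarrow> 'b) \<Rightarrow> bool" where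
  "isometric_embedding m m' f \<longleftrightarrow>
     f ` mspace m \<subseteq> mspace m' \<and>
     (\<forall>x\<in>mspace m. \<forall>y\<in>mspace m. mdist m' (f x) (f y) = mdist m x y)"

definition prokhorov :: "'a metric \<Rightarrow> 'a measure \<Rightarrow> 'a measure \<Rightarrow> real" where
  "prokhorov Z \<mu> \<nu> = Inf {e. 0 < e \<and>
     (\<forall>A. closedin (mtopology_of Z) A \<longrightarrow>
        measure \<mu> A \<le> measure \<nu> {z\<in>mspace Z. \<exists>a\<in>A. mdist Z a z < e} + e \<and>
        measure \<nu> A \<le> measure \<mu> {z\<in>mspace Z. \<exists>a\<in>A. mdist Z a z < e} + e)}"

definition cadlag_on :: "'a metric \<Rightarrow> real \<Rightarrow> (real \<Rightarrow> 'a) \<Rightarrow> bool" where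
  "cadlag_on m T x \<longleftrightarrow>
     x ` {0..T} \<subseteq> mspace m \<and>
     (\<forall>t\<in>{0..<T}. limitin (mtopology_of m) x (x t) (at_right t)) \<and>
     (\<forall>t\<in>{0<..T}. \<exists>l. limitin (mtopology_of m) x l (at_left t))"

definition increasing_homeo :: "real \<Rightarrow> (real \<Rightarrow> real) \<Rightarrow> bool" where
  "increasing_homeo T \<kappa> \<longleftrightarrow>
     strict_mono_on {0..T} \<kappa> \<and> (\<exists>\<kappa>'. homeomorphism {0..T} {0..T} \<kappa> \<kappa>')"

definition skorokhod_J1 :: "'a metric \<Rightarrow> real \<Rightarrow> (real \<Rightarrow> 'a) \<Rightarrow> (real \<Rightarrow> 'a) \<Rightarrow> real" where
  "skorokhod_J1 Z T x y = Inf {(SUP t\<in>{0..T}. \<bar>\<kappa> t - t\<bar>) + (SUP t\<in>{0..T}. mdist Z (x (\<kappa> t)) (y t)) | \<kappa>.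
     increasing_homeo T \<kappa>}"


section \<open>The extended pointed Gromov-Hausdorff space\<close>

text \<open>The functions \<open>qpath\<close> and \<open>qloc\<close> (time first, then space) only matter for times in \<open>[0,T]\<close>
  and points of the space; values elsewhere are disregarded by \<open>quad_eq\<close> and \<open>quad_dist\<close>.\<close>

record 'a quad =
  qspace :: "'a metric"
  qroot :: 'a
  qmeas :: "'a measure"
  qpath :: "real \<Rightarrow> 'a"
  qloc :: "real \<Rightarrow> 'a \<Rightarrow> real"

definition quads :: "real \<Rightarrow> 'a quad set" where
  "quads T = {q.
     compact_space (mtopology_of (qspace q)) \<and>
     qroot q \<in> mspace (qspace q) \<and>
     sets (qmeas q) = sets (mborel (qspace q)) \<and> finite_measure (qmeas q) \<and>
     cadlag_on (qspace q) T (qpath q) \<and>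
     continuous_map (prod_topology (top_of_set {0..T}) (mtopology_of (qspace q))) euclideanreal
       (\<lambda>(t, x). qloc q t x) \<and>
     (\<forall>t\<in>{0..T}. \<forall>x\<in>mspace (qspace q). 0 \<le> qloc q t x)}"

definition quad_iso :: "real \<Rightarrow> ('a \<Rightarrow> 'a) \<Rightarrow> 'a quad \<Rightarrow> 'a quad \<Rightarrow> bool" where
  "quad_iso T f q q' \<longleftrightarrow>
     isometric_embedding (qspace q) (qspace q') f \<and>
     f ` mspace (qspace q) = mspace (qspace q') \<and>
     f (qroot q) = qroot q' \<and>
     distr (qmeas q) (mborel (qspace q')) f = qmeas q' \<and>
     (\<forall>t\<in>{0..T}. f (qpath q t) = qpath q' t) \<and>
     (\<forall>t\<in>{0..T}. \<forall>x\<in>mspace (qspace q). qloc q t x = qloc q' t (f x))"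

definition quad_eq :: "real \<Rightarrow> ('a quad \<times> 'a quad) set" where
  "quad_eq T = {(q, q'). q \<in> quads T \<and> q' \<in> quads T \<and> (\<exists>f. quad_iso T f q q')}"

definition correspondence :: "'a set \<Rightarrow> 'b set \<Rightarrow> ('a \<times> 'b) set \<Rightarrow> bool" where
  "correspondence A B C \<longleftrightarrow> C \<subseteq> A \<times> B \<and> fst ` C = A \<and> snd ` C = B"

text \<open>Replacing an ambient space \<open>Z\<close> by the union of the two embedded (compact) spaces changes none
  of the three terms below. That union injects into the type \<open>'a + 'a\<close>, so it is enough to let \<open>Z\<close>
  range over the metric spaces carried by subsets of this type.\<close>

definition quad_cost ::
  "real \<Rightarrow> 'a quad \<Rightarrow> 'a quad \<Rightarrow> 'z metric \<Rightarrow> ('a \<Rightarrow> 'z) \<Rightarrow> ('a \<Rightarrow> 'z) \<Rightarrow> ('a \<times> 'a) set \<Rightarrow> real"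
where
  "quad_cost T q q' Z \<phi> \<phi>' C =
     prokhorov Z (distr (qmeas q) (mborel Z) \<phi>) (distr (qmeas q') (mborel Z) \<phi>') +
     skorokhod_J1 Z T (\<lambda>t. \<phi> (qpath q t)) (\<lambda>t. \<phi>' (qpath q' t)) +
     (SUP (x, x')\<in>C. mdist Z (\<phi> x) (\<phi>' x') + (SUP t\<in>{0..T}. \<bar>qloc q t x - qloc q' t x'\<bar>))"

definition quad_dist :: "real \<Rightarrow> 'a quad \<Rightarrow> 'a quad \<Rightarrow> real" where
  "quad_dist T q q' = Inf {quad_cost T q q' Z \<phi> \<phi>' C | (Z :: ('a + 'a) metric) \<phi> \<phi>' C.
     isometric_embedding (qspace q) Z \<phi> \<and> isometric_embedding (qspace q') Z \<phi>' \<and>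
     correspondence (mspace (qspace q)) (mspace (qspace q')) C \<and> (qroot q, qroot q') \<in> C}"

lemma isometric_embedding_comp:
  "isometric_embedding m1 m2 f \<Longrightarrow> isometric_embedding m2 m3 g \<Longrightarrow> isometric_embedding m1 m3 (\<lambda>x. g (f x))"
  unfolding isometric_embedding_def by (auto simp: image_subset_iff)

lemma space_mborel [simp]: "space (mborel m) = mspace m"
  unfolding mborel_def
  by (intro space_measure_of) (auto dest!: openin_subset)

lemma isometric_embedding_measurable:
  assumes f: "isometric_embedding m m' f"
  shows "f \<in> mborel m \<rightarrow>\<^sub>M mborel m'"
proof -
  interpret A: Metric_space "mspace m" "mdist m" by simp
  interpret B: Metric_space "mspace m'" "mdist m'" by simp
  have "continuous_map (mtopology_of m) (mtopology_of m') f"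
    unfolding mtopology_of_def
    by (subst A.metric_continuous_map[OF B.Metric_space_axioms])
      (use f in \<open>auto simp: isometric_embedding_def\<close>)
  then have op: "openin (mtopology_of m) {x \<in> mspace m. f x \<in> U}" if "openin (mtopology_of m') U" for U
    using that by (auto simp: continuous_map_def)
  have sets: "sets (mborel m) = sigma_sets (mspace m) {U. openin (mtopology_of m) U}"
    unfolding mborel_def by (intro sets_measure_of) (auto dest!: openin_subset)
  show ?thesis
    unfolding mborel_def[of m']
  proof (rule measurable_measure_of)
    show "{U. openin (mtopology_of m') U} \<subseteq> Pow (mspace m')"
      by (auto dest!: openin_subset)
    show "f \<in> space (mborel m) \<rightarrow> mspace m'"
      using f by (auto simp: isometric_embedding_def)
    fix U assume "U \<in> {U. openin (mtopology_of m') U}"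
    then have "{x \<in> mspace m. f x \<in> U} \<in> sets (mborel m)"
      using op unfolding sets by blast
    moreover have "f -` U \<inter> space (mborel m) = {x \<in> mspace m. f x \<in> U}" by auto
    ultimately show "f -` U \<inter> space (mborel m) \<in> sets (mborel m)" by simp
  qed
qed

lemma quad_iso_sym:
  assumes q: "q \<in> quads T" and q': "q' \<in> quads T" and f: "quad_iso T f q q'"
  shows "\<exists>g. quad_iso T g q' q \<and> (\<forall>x\<in>mspace (qspace q). g (f x) = x)"
proof -
  let ?K = "mspace (qspace q)" and ?K' = "mspace (qspace q')"
  define g where "g = inv_into ?K f"
  have iso: "isometric_embedding (qspace q) (qspace q') f" and im: "f ` ?K = ?K'"
    using f by (auto simp: quad_iso_def)
  interpret A: Metric_space ?K "mdist (qspace q)" by simp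
  have inj: "inj_on f ?K"
    using iso unfolding isometric_embedding_def inj_on_def
    by (metis A.zero Metric_space.zero Metric_space_mspace_mdist image_subset_iff)
  have gf: "g (f x) = x" if "x \<in> ?K" for x using inj that by (simp add: g_def)
  have fg: "f (g y) = y" "g y \<in> ?K" if "y \<in> ?K'" for y
    using that im by (auto simp: g_def f_inv_into_f inv_into_into)
  have isog: "isometric_embedding (qspace q') (qspace q) g"
    unfolding isometric_embedding_def
  proof (intro conjI ballI)
    show "g ` ?K' \<subseteq> ?K" using fg by auto
    fix x y assume "x \<in> ?K'" "y \<in> ?K'"
    then show "mdist (qspace q) (g x) (g y) = mdist (qspace q') x y"
      using iso fg unfolding isometric_embedding_def by metis
  qed
  have s: "sets (qmeas q) = sets (mborel (qspace q))" "sets (qmeas q') = sets (mborel (qspace q'))"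
    using q q' by (auto simp: quads_def)
  have sp: "space (qmeas q) = ?K" using sets_eq_imp_space_eq[OF s(1)] by simp
  have mf: "f \<in> qmeas q \<rightarrow>\<^sub>M mborel (qspace q')"
    using isometric_embedding_measurable[OF iso] measurable_cong_sets[OF s(1) refl] by blast
  have "distr (qmeas q') (mborel (qspace q)) g
      = distr (distr (qmeas q) (mborel (qspace q')) f) (mborel (qspace q)) g"
    using f by (simp add: quad_iso_def)
  also have "\<dots> = distr (qmeas q) (mborel (qspace q)) (g \<circ> f)"
    by (rule distr_distr[OF isometric_embedding_measurable[OF isog] mf])
  also have "\<dots> = distr (qmeas q) (qmeas q) (\<lambda>x. x)"
    by (rule distr_cong) (auto simp: s sp gf)
  finally have dg: "distr (qmeas q') (mborel (qspace q)) g = qmeas q" by (simp add: distr_id2)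
  have X: "qpath q t \<in> ?K" if "t \<in> {0..T}" for t
    using q that by (auto simp: quads_def cadlag_on_def)
  have r: "qroot q \<in> ?K" using q by (auto simp: quads_def)
  have "quad_iso T g q' q"
    unfolding quad_iso_def
  proof (intro conjI ballI)
    show "g ` ?K' = ?K" using gf fg im by force
    show "g (qroot q') = qroot q" using f gf[OF r] by (auto simp: quad_iso_def)
    show "g (qpath q' t) = qpath q t" if "t \<in> {0..T}" for t
      using f gf[OF X[OF that]] that by (metis quad_iso_def)
    show "qloc q' t x = qloc q t (g x)" if "t \<in> {0..T}" "x \<in> ?K'" for t x
      using f fg[OF that(2)] that(1) by (metis quad_iso_def)
  qed (use isog dg in auto)
  then show ?thesis using gf by blast
qed

lemma quad_iso_comp:
  assumes "q1 \<in> quads T" "q2 \<in> quads T" "q3 \<in> quads T" "quad_iso T f q1 q2" "quad_iso T g q2 q3"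
  shows "quad_iso T (\<lambda>x. g (f x)) q1 q3"
proof -
  have s: "sets (qmeas q1) = sets (mborel (qspace q1))" using assms by (auto simp: quads_def)
  have i: "isometric_embedding (qspace q1) (qspace q2) f" "isometric_embedding (qspace q2) (qspace q3) g"
    using assms by (auto simp: quad_iso_def)
  have mf: "f \<in> qmeas q1 \<rightarrow>\<^sub>M mborel (qspace q2)"
    using isometric_embedding_measurable[OF i(1)] measurable_cong_sets[OF s refl] by blast
  have "distr (qmeas q1) (mborel (qspace q3)) (g \<circ> f)
      = distr (distr (qmeas q1) (mborel (qspace q2)) f) (mborel (qspace q3)) g"
    by (rule distr_distr[OF isometric_embedding_measurable[OF i(2)] mf, symmetric])
  also have "\<dots> = qmeas q3" using assms(4,5) by (simp add: quad_iso_def)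
  finally have d: "distr (qmeas q1) (mborel (qspace q3)) (\<lambda>x. g (f x)) = qmeas q3"
    by (simp add: comp_def)
  have im: "f ` mspace (qspace q1) = mspace (qspace q2)" "g ` mspace (qspace q2) = mspace (qspace q3)"
    using assms by (auto simp: quad_iso_def)
  have "(\<lambda>x. g (f x)) ` mspace (qspace q1) = mspace (qspace q3)"
    by (metis im image_image)
  moreover have "f x \<in> mspace (qspace q2)" if "x \<in> mspace (qspace q1)" for x using im that by blast
  ultimately show ?thesis
    using assms(4,5) isometric_embedding_comp[OF i] d by (auto simp: quad_iso_def)
qed

lemma equiv_quad_eq: "equiv (quads T :: 'a quad set) (quad_eq T)"
proof (rule equivI)
  show "quad_eq T \<subseteq> quads T \<times> (quads T :: 'a quad set)" by (auto simp: quad_eq_def)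
  show "refl_on (quads T :: 'a quad set) (quad_eq T)"
  proof (rule refl_onI)
    fix q :: "'a quad" assume q: "q \<in> quads T"
    have "distr (qmeas q) (mborel (qspace q)) (\<lambda>x. x) = qmeas q"
      using q by (intro distr_id2) (auto simp: quads_def)
    then have "quad_iso T (\<lambda>x. x) q q" by (auto simp: quad_iso_def isometric_embedding_def)
    then show "(q, q) \<in> quad_eq T" using q by (auto simp: quad_eq_def)
  qed
  show "sym (quad_eq T :: ('a quad \<times> 'a quad) set)" using quad_iso_sym by (fastforce simp: sym_def quad_eq_def)
  show "trans (quad_eq T :: ('a quad \<times> 'a quad) set)" using quad_iso_comp unfolding trans_def quad_eq_def by blast
qed

lemma quad_cost_transport:
  assumes q: "q1 \<in> quads T" "q2 \<in> quads T" "q1' \<in> quads T" "q2' \<in> quads T"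
    and f: "quad_iso T f q1 q1'" and g: "quad_iso T g q2 q2'"
    and e: "isometric_embedding (qspace q1') Z \<phi>" "isometric_embedding (qspace q2') Z \<phi>'"
    and C: "correspondence (mspace (qspace q1')) (mspace (qspace q2')) C" "(qroot q1', qroot q2') \<in> C"
  shows "\<exists>\<psi> \<psi>' D. isometric_embedding (qspace q1) Z \<psi> \<and> isometric_embedding (qspace q2) Z \<psi>' \<and>
    correspondence (mspace (qspace q1)) (mspace (qspace q2)) D \<and> (qroot q1, qroot q2) \<in> D \<and>
    quad_cost T q1' q2' Z \<phi> \<phi>' C = quad_cost T q1 q2 Z \<psi> \<psi>' D"
proof -
  let ?K1 = "mspace (qspace q1)" and ?K2 = "mspace (qspace q2)"
  define D where "D = {(x, y). x \<in> ?K1 \<and> y \<in> ?K2 \<and> (f x, g y) \<in> C}"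
  have im: "f ` ?K1 = mspace (qspace q1')" "g ` ?K2 = mspace (qspace q2')"
    using f g by (auto simp: quad_iso_def)
  have i: "isometric_embedding (qspace q1) (qspace q1') f" "isometric_embedding (qspace q2) (qspace q2') g"
    using f g by (auto simp: quad_iso_def)
  have Csub: "C \<subseteq> f ` ?K1 \<times> g ` ?K2" using C im by (auto simp: correspondence_def)
  have CD: "C = (\<lambda>(x, y). (f x, g y)) ` D"
  proof
    show "C \<subseteq> (\<lambda>(x, y). (f x, g y)) ` D"
    proof
      fix c assume c: "c \<in> C"
      with Csub obtain x y where xy: "x \<in> ?K1" "y \<in> ?K2" "c = (f x, g y)" by blast
      then have "(x, y) \<in> D" using c by (simp add: D_def)
      then show "c \<in> (\<lambda>(x, y). (f x, g y)) ` D" by (intro image_eqI[of _ _ "(x, y)"]) (simp_all add: xy(3))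
    qed
    show "(\<lambda>(x, y). (f x, g y)) ` D \<subseteq> C" by (auto simp: D_def)
  qed
  have "fst ` D = ?K1"
  proof
    show "fst ` D \<subseteq> ?K1" by (auto simp: D_def)
    show "?K1 \<subseteq> fst ` D"
    proof
      fix x assume x: "x \<in> ?K1"
      then have "f x \<in> fst ` C" using C im by (auto simp: correspondence_def)
      then obtain y where "(f x, y) \<in> C" by auto
      with Csub obtain z where "z \<in> ?K2" "(f x, g z) \<in> C" by auto
      with x have "(x, z) \<in> D" by (simp add: D_def)
      then show "x \<in> fst ` D" by force
    qed
  qed
  moreover have "snd ` D = ?K2"
  proof
    show "snd ` D \<subseteq> ?K2" by (auto simp: D_def)
    show "?K2 \<subseteq> snd ` D"
    proof
      fix x assume x: "x \<in> ?K2"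
      then have "g x \<in> snd ` C" using C im by (auto simp: correspondence_def)
      then obtain y where "(y, g x) \<in> C" by auto
      with Csub obtain z where "z \<in> ?K1" "(f z, g x) \<in> C" by auto
      with x have "(z, x) \<in> D" by (simp add: D_def)
      then show "x \<in> snd ` D" by force
    qed
  qed
  ultimately have cD: "correspondence ?K1 ?K2 D" by (auto simp: correspondence_def D_def)
  have rD: "(qroot q1, qroot q2) \<in> D"
    using q C f g by (auto simp: D_def quads_def quad_iso_def)
  have pr: "distr (qmeas p') (mborel Z) u = distr (qmeas p) (mborel Z) (\<lambda>x. u (h x))"
    if "p \<in> quads T" "quad_iso T h p p'" "isometric_embedding (qspace p') Z u" for p p' h u
  proof -
    have h: "isometric_embedding (qspace p) (qspace p') h"
      and d: "distr (qmeas p) (mborel (qspace p')) h = qmeas p'"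
      using that(2) by (auto simp: quad_iso_def)
    have "sets (qmeas p) = sets (mborel (qspace p))" using that(1) by (auto simp: quads_def)
    then have "h \<in> qmeas p \<rightarrow>\<^sub>M mborel (qspace p')"
      using isometric_embedding_measurable[OF h] measurable_cong_sets[OF _ refl] by blast
    from distr_distr[OF isometric_embedding_measurable[OF that(3)] this]
    show ?thesis unfolding d by (simp add: comp_def)
  qed
  have J: "skorokhod_J1 Z T (\<lambda>t. \<phi> (qpath q1' t)) (\<lambda>t. \<phi>' (qpath q2' t))
      = skorokhod_J1 Z T (\<lambda>t. \<phi> (f (qpath q1 t))) (\<lambda>t. \<phi>' (g (qpath q2 t)))"
  proof -
    have S: "(SUP t\<in>{0..T}. mdist Z (\<phi> (qpath q1' (\<kappa> t))) (\<phi>' (qpath q2' t)))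
        = (SUP t\<in>{0..T}. mdist Z (\<phi> (f (qpath q1 (\<kappa> t)))) (\<phi>' (g (qpath q2 t))))"
      if "increasing_homeo T \<kappa>" for \<kappa>
    proof (rule SUP_cong[OF refl])
      fix t assume t: "t \<in> {0..T}"
      then have "\<kappa> t \<in> {0..T}" using that unfolding increasing_homeo_def homeomorphism_def by blast
      with t show "mdist Z (\<phi> (qpath q1' (\<kappa> t))) (\<phi>' (qpath q2' t)) =
          mdist Z (\<phi> (f (qpath q1 (\<kappa> t)))) (\<phi>' (g (qpath q2 t)))"
        using f g unfolding quad_iso_def by metis
    qed
    then show ?thesis unfolding skorokhod_J1_def
      by (intro arg_cong[where f = Inf] Collect_cong ex_cong1) (auto simp: S)
  qed
  have L: "(SUP (x, x')\<in>C. mdist Z (\<phi> x) (\<phi>' x') + (SUP t\<in>{0..T}. \<bar>qloc q1' t x - qloc q2' t x'\<bar>))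
      = (SUP (x, x')\<in>D. mdist Z (\<phi> (f x)) (\<phi>' (g x')) + (SUP t\<in>{0..T}. \<bar>qloc q1 t x - qloc q2 t x'\<bar>))"
    unfolding CD image_image
  proof (rule SUP_cong[OF refl], clarsimp)
    fix x y assume "(x, y) \<in> D"
    then have xy: "x \<in> ?K1" "y \<in> ?K2" by (auto simp: D_def)
    show "(SUP t\<in>{0..T}. \<bar>qloc q1' t (f x) - qloc q2' t (g y)\<bar>) = (SUP t\<in>{0..T}. \<bar>qloc q1 t x - qloc q2 t y\<bar>)"
      using f g xy by (intro SUP_cong) (auto simp: quad_iso_def)
  qed
  have "quad_cost T q1' q2' Z \<phi> \<phi>' C = quad_cost T q1 q2 Z (\<lambda>x. \<phi> (f x)) (\<lambda>x. \<phi>' (g x)) D"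
    unfolding quad_cost_def J L pr[OF q(1) f e(1)] pr[OF q(2) g e(2)] ..
  then show ?thesis
    using isometric_embedding_comp[OF i(1) e(1)] isometric_embedding_comp[OF i(2) e(2)] cD rD by blast
qed

text \<open>Hence the choice of representatives in \<open>KK_dist\<close> below is immaterial.\<close>

lemma quad_dist_cong:
  assumes "(q1, q1') \<in> quad_eq T" "(q2, q2') \<in> quad_eq T"
  shows "quad_dist T q1 q2 = quad_dist T q1' q2'"
proof -
  obtain f g where q: "q1 \<in> quads T" "q2 \<in> quads T" "q1' \<in> quads T" "q2' \<in> quads T"
    and fg: "quad_iso T f q1 q1'" "quad_iso T g q2 q2'"
    using assms by (auto simp: quad_eq_def)
  obtain f' g' where fg': "quad_iso T f' q1' q1" "quad_iso T g' q2' q2"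
    using quad_iso_sym[OF q(1,3) fg(1)] quad_iso_sym[OF q(2,4) fg(2)] by auto
  note 1 = quad_cost_transport[OF q fg] and 2 = quad_cost_transport[OF q(3,4,1,2) fg']
  show ?thesis
    unfolding quad_dist_def
    by (intro arg_cong[where f = Inf] Collect_cong iffI; elim exE conjE; hypsubst)
      (metis 2, metis 1)
qed

text \<open>The metric spaces of the quadruples are carried by subsets of \<open>'a\<close>, so \<open>KK T\<close> is a subspace of
  the space of all equivalence classes. Random elements of a subspace converge in distribution in the
  subspace if and only if they do so in the whole space.\<close>

definition KK :: "real \<Rightarrow> 'a quad set set" where
  "KK T = quads T // quad_eq T"

definition KK_class :: "real \<Rightarrow> 'a quad \<Rightarrow> 'a quad set" where
  "KK_class T q = quad_eq T `` {q}"

definition KK_dist :: "real \<Rightarrow> 'a quad set \<Rightarrow> 'a quad set \<Rightarrow> real" where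
  "KK_dist T c c' = quad_dist T (SOME q. q \<in> c) (SOME q. q \<in> c')"

definition KK_open :: "real \<Rightarrow> 'a quad set set \<Rightarrow> bool" where
  "KK_open T U \<longleftrightarrow> U \<subseteq> KK T \<and> (\<forall>c\<in>U. \<exists>r>0. \<forall>c'\<in>KK T. KK_dist T c c' < r \<longrightarrow> c' \<in> U)"

definition KK_topology :: "real \<Rightarrow> 'a quad set topology" where
  "KK_topology T = topology (KK_open T)"

lemma openin_KK_topology: "openin (KK_topology T) = KK_open T"
proof -
  have "istopology (KK_open T :: 'a quad set set \<Rightarrow> bool)"
    unfolding istopology_def
  proof (intro conjI allI impI)
    fix S S' :: "'a quad set set"
    assume S: "KK_open T S" and S': "KK_open T S'"
    show "KK_open T (S \<inter> S')"
      unfolding KK_open_def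
    proof (intro conjI ballI)
      show "S \<inter> S' \<subseteq> KK T" using S unfolding KK_open_def by blast
      fix c assume "c \<in> S \<inter> S'"
      with S S' obtain r r' where "r > 0" "r' > 0"
        "\<forall>c'\<in>KK T. KK_dist T c c' < r \<longrightarrow> c' \<in> S" "\<forall>c'\<in>KK T. KK_dist T c c' < r' \<longrightarrow> c' \<in> S'"
        unfolding KK_open_def by blast
      then show "\<exists>r>0. \<forall>c'\<in>KK T. KK_dist T c c' < r \<longrightarrow> c' \<in> S \<inter> S'"
        by (intro exI[of _ "min r r'"]) auto
    qed
  next
    fix \<U> :: "'a quad set set set"
    assume "\<forall>S\<in>\<U>. KK_open T S"
    then show "KK_open T (\<Union>\<U>)" unfolding KK_open_def by (meson Union_iff Sup_least)
  qed
  then show ?thesis by (simp add: KK_topology_def topology_inverse')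
qed


section \<open>Random walks on weighted graphs\<close>

record 'a wgraph =
  verts :: "'a set"
  edges :: "'a set set"
  wt :: "'a \<Rightarrow> 'a \<Rightarrow> real"

definition weighted_graph :: "'a wgraph \<Rightarrow> bool" where
  "weighted_graph G \<longleftrightarrow>
     finite (verts G) \<and> verts G \<noteq> {} \<and>
     edges G \<subseteq> {{x, y} | x y. x \<in> verts G \<and> y \<in> verts G} \<and>
     (\<forall>x\<in>verts G. \<forall>y\<in>verts G. 0 \<le> wt G x y \<and> wt G x y = wt G y x \<and> (0 < wt G x y \<longleftrightarrow> {x, y} \<in> edges G)) \<and>
     (\<forall>x\<in>verts G. \<forall>y\<in>verts G. (x, y) \<in> {(u, v). {u, v} \<in> edges G}\<^sup>*)"

definition vwt :: "'a wgraph \<Rightarrow> 'a \<Rightarrow> real" where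
  "vwt G x = (\<Sum>y\<in>verts G. wt G x y)"

definition mass :: "'a wgraph \<Rightarrow> real" where
  "mass G = (\<Sum>x\<in>verts G. vwt G x)"

definition stationary :: "'a wgraph \<Rightarrow> 'a measure" where
  "stationary G = point_measure (verts G) (\<lambda>x. ennreal (vwt G x / mass G))"

definition random_walk :: "'a wgraph \<Rightarrow> 'a \<Rightarrow> 'v measure \<Rightarrow> (nat \<Rightarrow> 'v \<Rightarrow> 'a) \<Rightarrow> bool" where
  "random_walk G r M Y \<longleftrightarrow>
     prob_space M \<and>
     (\<forall>i. Y i \<in> M \<rightarrow>\<^sub>M count_space (verts G)) \<and>
     (AE \<omega> in M. Y 0 \<omega> = r) \<and>
     (\<forall>k. \<forall>xs. xs ` {..Suc k} \<subseteq> verts G \<longrightarrow>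
        measure M {\<omega>\<in>space M. \<forall>i\<le>Suc k. Y i \<omega> = xs i} =
        measure M {\<omega>\<in>space M. \<forall>i\<le>k. Y i \<omega> = xs i} * (wt G (xs k) (xs (Suc k)) / vwt G (xs k)))"

definition walk_local_time :: "'a wgraph \<Rightarrow> (nat \<Rightarrow> 'v \<Rightarrow> 'a) \<Rightarrow> nat \<Rightarrow> 'a \<Rightarrow> 'v \<Rightarrow> real" where
  "walk_local_time G Y t x \<omega> = (\<Sum>i<t. indicator {x} (Y i \<omega>)) / vwt G x"

definition walk_local_time_lin :: "'a wgraph \<Rightarrow> (nat \<Rightarrow> 'v \<Rightarrow> 'a) \<Rightarrow> real \<Rightarrow> 'a \<Rightarrow> 'v \<Rightarrow> real" where
  "walk_local_time_lin G Y t x \<omega> =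
     (let k = nat \<lfloor>t\<rfloor> in
      walk_local_time G Y k x \<omega> +
      (t - real k) * (walk_local_time G Y (Suc k) x \<omega> - walk_local_time G Y k x \<omega>))"

text \<open>Blanket times take values in the extended reals; they are infinite if the covering condition
  is never met.\<close>

definition walk_blanket_time :: "'a wgraph \<Rightarrow> (nat \<Rightarrow> 'v \<Rightarrow> 'a) \<Rightarrow> real \<Rightarrow> 'v \<Rightarrow> ereal" where
  "walk_blanket_time G Y \<epsilon> \<omega> =
     Inf {ereal (real t) | t. 1 \<le> t \<and> (\<forall>x\<in>verts G. mass G * walk_local_time G Y t x \<omega> \<ge> \<epsilon> * real t)}"

definition walk_quad ::
  "'a wgraph \<Rightarrow> 'a metric \<Rightarrow> 'a \<Rightarrow> (nat \<Rightarrow> 'v \<Rightarrow> 'a) \<Rightarrow> real \<Rightarrow> real \<Rightarrow> 'v \<Rightarrow> 'a quad"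
where
  "walk_quad G d r Y \<alpha> \<beta> \<omega> =
     \<lparr>qspace = scale_metric \<alpha> d, qroot = r, qmeas = stationary G,
      qpath = (\<lambda>t. Y (nat \<lfloor>\<beta> * t\<rfloor>) \<omega>),
      qloc = (\<lambda>t x. \<alpha> * walk_local_time_lin G Y (\<beta> * t) x \<omega>)\<rparr>"


section \<open>Symmetric Hunt processes and their local times\<close>

text \<open>A filtration is indexed by \<open>[0,\<infinity>]\<close>, so that stopping times may be infinite.\<close>

definition strong_markov ::
  "'a metric \<Rightarrow> (ennreal \<Rightarrow> 'w measure) \<Rightarrow> (real \<Rightarrow> 'w \<Rightarrow> 'a) \<Rightarrow> ('a \<Rightarrow> 'w measure) \<Rightarrow> bool"
where
  "strong_markov K \<F> X P \<longleftrightarrow>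
     (\<forall>\<sigma>. stopping_time \<F> \<sigma> \<longrightarrow>
       (\<forall>x\<in>mspace K. \<forall>s\<ge>0. \<forall>E\<in>sets (mborel K). \<forall>A\<in>sets (filtration.pre_sigma (space (\<F> 0)) \<F> \<sigma>).
          emeasure (P x) {\<omega>\<in>A. \<sigma> \<omega> < \<infinity> \<and> X (enn2real (\<sigma> \<omega>) + s) \<omega> \<in> E} =
          (\<integral>\<^sup>+\<omega>. indicator {\<omega>\<in>A. \<sigma> \<omega> < \<infinity>} \<omega> *
             (let y = X (enn2real (\<sigma> \<omega>)) \<omega> in emeasure (P y) {\<omega>'\<in>space (P y). X s \<omega>' \<in> E}) \<partial>P x)))"

definition quasi_left_continuous ::
  "'a metric \<Rightarrow> (ennreal \<Rightarrow> 'w measure) \<Rightarrow> (real \<Rightarrow> 'w \<Rightarrow> 'a) \<Rightarrow> ('a \<Rightarrow> 'w measure) \<Rightarrow> bool"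
where
  "quasi_left_continuous K \<F> X P \<longleftrightarrow>
     (\<forall>\<sigma> :: nat \<Rightarrow> 'w \<Rightarrow> ennreal.
        (\<forall>k. stopping_time \<F> (\<sigma> k)) \<and> (\<forall>\<omega>. incseq (\<lambda>k. \<sigma> k \<omega>)) \<longrightarrow>
        (\<forall>x\<in>mspace K. AE \<omega> in P x. (SUP k. \<sigma> k \<omega>) < \<infinity> \<longrightarrow>
           limitin (mtopology_of K) (\<lambda>k. X (enn2real (\<sigma> k \<omega>)) \<omega>)
             (X (enn2real (SUP k. \<sigma> k \<omega>)) \<omega>) sequentially))"

text \<open>Hunt processes without killing, since the paths considered here have values in \<open>K\<close> at all
  times. As \<open>P\<close> is a probability kernel on the whole \<open>\<sigma>\<close>-algebra of the sample space \<open>\<Omega>\<close>, properties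
  under an arbitrary initial law follow from those under all \<open>P x\<close> by integration; the usual
  augmentation of filtrations is not needed.\<close>

definition hunt_process ::
  "'a metric \<Rightarrow> 'w measure \<Rightarrow> (real \<Rightarrow> 'w \<Rightarrow> 'a) \<Rightarrow> ('a \<Rightarrow> 'w measure) \<Rightarrow> bool"
where
  "hunt_process K \<Omega> X P \<longleftrightarrow>
     P \<in> mborel K \<rightarrow>\<^sub>M prob_algebra \<Omega> \<and>
     (\<forall>t\<ge>0. X t \<in> \<Omega> \<rightarrow>\<^sub>M mborel K) \<and>
     (\<forall>\<omega>\<in>space \<Omega>. \<forall>T>0. cadlag_on K T (\<lambda>t. X t \<omega>)) \<and>
     (\<exists>\<theta> :: real \<Rightarrow> 'w \<Rightarrow> 'w. \<forall>t\<ge>0. \<forall>\<omega>\<in>space \<Omega>. \<theta> t \<omega> \<in> space \<Omega> \<and> (\<forall>s\<ge>0. X s (\<theta> t \<omega>) = X (s + t) \<omega>)) \<and>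
     (\<forall>x\<in>mspace K. AE \<omega> in P x. X 0 \<omega> = x) \<and>
     (\<exists>\<F> :: ennreal \<Rightarrow> 'w measure.
        filtration (space \<Omega>) \<F> \<and> (\<forall>t. sets (\<F> t) \<subseteq> sets \<Omega>) \<and>
        (\<forall>t<\<infinity>. sets (\<F> t) = (\<Inter>s\<in>{t<..}. sets (\<F> s))) \<and>
        (\<forall>t\<ge>0. X t \<in> \<F> (ennreal t) \<rightarrow>\<^sub>M mborel K) \<and>
        strong_markov K \<F> X P \<and> quasi_left_continuous K \<F> X P)"

definition symmetric_process ::
  "'a metric \<Rightarrow> 'a measure \<Rightarrow> (real \<Rightarrow> 'w \<Rightarrow> 'a) \<Rightarrow> ('a \<Rightarrow> 'w measure) \<Rightarrow> bool"
where
  "symmetric_process K \<pi> X P \<longleftrightarrow>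
     (\<forall>t\<ge>0. \<forall>f\<in>borel_measurable (mborel K). \<forall>g\<in>borel_measurable (mborel K).
        (\<integral>\<^sup>+x. f x * (\<integral>\<^sup>+\<omega>. g (X t \<omega>) \<partial>P x) \<partial>\<pi>) =
        (\<integral>\<^sup>+x. g x * (\<integral>\<^sup>+\<omega>. f (X t \<omega>) \<partial>P x) \<partial>\<pi>))"

definition local_times ::
  "'a metric \<Rightarrow> 'a measure \<Rightarrow> (real \<Rightarrow> 'w \<Rightarrow> 'a) \<Rightarrow> ('a \<Rightarrow> 'w measure) \<Rightarrow> (real \<Rightarrow> 'a \<Rightarrow> 'w \<Rightarrow> real) \<Rightarrow> bool"
where
  "local_times K \<pi> X P L \<longleftrightarrow>
     (\<forall>x\<in>mspace K.
       (\<forall>t\<ge>0. \<forall>y\<in>mspace K. L t y \<in> borel_measurable (completion (P x))) \<and>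
       (AE \<omega> in P x.
         (\<forall>t\<ge>0. \<forall>y\<in>mspace K. 0 \<le> L t y \<omega>) \<and>
         (\<forall>t\<ge>0. \<forall>f :: 'a \<Rightarrow> ennreal. f \<in> borel_measurable (mborel K) \<longrightarrow>
            (\<integral>\<^sup>+s\<in>{0..t}. f (X s \<omega>) \<partial>lborel) = (\<integral>\<^sup>+y. f y * ennreal (L t y \<omega>) \<partial>\<pi>)) \<and>
         (\<forall>T>0. \<forall>y\<in>mspace K. \<forall>e>0. \<exists>\<delta>>0. \<forall>z\<in>mspace K. mdist K y z < \<delta> \<longrightarrow>
            (\<forall>t\<in>{0..T}. \<bar>L t z \<omega> - L t y \<omega>\<bar> < e))))"

definition blanket_time :: "'a metric \<Rightarrow> (real \<Rightarrow> 'a \<Rightarrow> 'w \<Rightarrow> real) \<Rightarrow> real \<Rightarrow> 'w \<Rightarrow> ereal" where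
  "blanket_time K L \<epsilon> \<omega> = Inf {ereal t | t. 0 < t \<and> (\<forall>x\<in>mspace K. L t x \<omega> \<ge> \<epsilon> * t)}"

definition process_quad ::
  "'a metric \<Rightarrow> 'a \<Rightarrow> 'a measure \<Rightarrow> (real \<Rightarrow> 'w \<Rightarrow> 'a) \<Rightarrow> (real \<Rightarrow> 'a \<Rightarrow> 'w \<Rightarrow> real) \<Rightarrow> 'w \<Rightarrow> 'a quad"
where
  "process_quad K r \<pi> X L \<omega> =
     \<lparr>qspace = K, qroot = r, qmeas = \<pi>, qpath = (\<lambda>t. X t \<omega>), qloc = (\<lambda>t x. L t x \<omega>)\<rparr>"

end

theory Submission
  imports Defs
begin

text \<open>
  Write \<open>I q s\<close> for the infimum over space of the local times of a quadruple \<open>q\<close> at time \<open>s\<close>. As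
  \<open>\<alpha> n * \<beta> n\<close> is the mass of the graph, the rescaled blanket time of the walk is the first
  \<open>s = k / \<beta> n\<close>, \<open>k \<ge> 1\<close>, with \<open>\<epsilon> * s \<le> I qn s\<close>, where \<open>qn\<close> is the rescaled quadruple of the walk;
  the blanket time of the limit is the infimum of the real \<open>s > 0\<close> with \<open>\<epsilon> * s \<le> I q s\<close>. Functionals such
  as \<open>SUP s\<in>{a..b}. I q s - \<epsilon> * s\<close> are Lipschitz for the Gromov-Hausdorff distance
  (\<open>quad_lipschitz_excess\<close>), so the portmanteau theorem transfers bounds on their laws to the limit
  (\<open>portmanteau_quad\<close>). It is enough to compare the distribution functions of the two blanket times at
  every \<open>t > 0\<close> (\<open>converges_in_distribution_times\<close>).

  Upper bound, \<open>limsup P(\<tau>n \<le> t) \<le> P(\<tau> \<le> t)\<close>: if the blanket time of the walk lies in \<open>{\<delta>..t}\<close>, then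
  \<open>SUP s\<in>{\<delta>..t}. I qn s - \<epsilon> * s\<close> is nonnegative, a closed condition. If it is below \<open>\<delta>\<close>, then the walk has
  visited all vertices before time \<open>\<delta>\<close> and so has reached a vertex at maximal distance from the root. The
  limit path starts from \<open>\<rho>\<close> and is right-continuous, so if \<open>K\<close> has a second point this has small
  probability for small \<open>\<delta>\<close>. The functional
  \<open>SUP s. d(\<rho>, X s) - c * s\<close> expresses this in a manner that is stable under the time changes of the
  Skorokhod metric (\<open>blanket_early_or_excess\<close>, \<open>wander_eventually_small\<close>). If \<open>K\<close> is a single point,
  then \<open>L t \<rho> \<ge> t\<close>, because the local times of the walks at time \<open>t\<close> have mean \<open>t\<close>
  (\<open>walk_max_local_time\<close>); hence \<open>\<tau> = 0\<close>.

  Lower bound, \<open>liminf P(\<tau>n < t) \<ge> P(\<tau> < t)\<close>: if \<open>\<tau> < t\<close>, continuity in \<open>\<epsilon>\<close> yields some \<open>s < t\<close> with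
  \<open>I q s > \<epsilon> * s\<close>, an open condition, and \<open>s\<close> can be rounded up to a multiple of \<open>1 / \<beta> n\<close> provided that
  \<open>\<beta> n\<close> tends to infinity (\<open>blanket_time_less_strict_excess\<close>, \<open>blanket_of_excess\<close>). If \<open>\<beta> n\<close> does not
  tend to infinity, then for some \<open>u > 0\<close> the walks have, for infinitely many \<open>n\<close>, not made a
  step before the rescaled time \<open>u\<close>, so that \<open>L u x = 0\<close> for all \<open>x \<noteq> \<rho>\<close> in the limit. This excludes a
  one-point space \<open>K\<close>, because each graph has a second vertex, still unvisited at time \<open>u\<close>; otherwise the limit process stays at \<open>\<rho>\<close>
  up to time \<open>u\<close>, hence forever by the Markov property, and \<open>\<tau> = \<infinity>\<close> almost surely
  (\<open>hunt_process_trapped\<close>, \<open>local_times_zero\<close>).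
\<close>


section \<open>Portmanteau bounds and laws of random times\<close>

lemma (in prob_space) prob_eventually_null:
  assumes [measurable]: "\<And>j. E j \<in> sets M"
    and ae: "AE \<omega> in M. \<forall>\<^sub>F j in sequentially. \<omega> \<notin> E j"
  shows "(\<lambda>j. prob (E j)) \<longlonglongrightarrow> 0"
proof -
  have "(\<lambda>j. \<integral>\<omega>. indicator (E j) \<omega> \<partial>M) \<longlonglongrightarrow> (\<integral>\<omega>. (0::real) \<partial>M)"
  proof (rule integral_dominated_convergence[where w = "\<lambda>_. 1"])
    show "AE \<omega> in M. (\<lambda>j. indicator (E j) \<omega> :: real) \<longlonglongrightarrow> 0"
      using ae
    proof eventually_elim
      case (elim \<omega>)
      then have "\<forall>\<^sub>F j in sequentially. (indicator (E j) \<omega> :: real) = 0"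
        by eventually_elim simp
      then show ?case by (rule tendsto_eventually)
    qed
  qed auto
  then show ?thesis by simp
qed

lemma (in prob_space) prob_eventually_covers:
  assumes [measurable]: "\<And>j. E j \<in> sets M" "A \<in> sets M"
    and ae: "AE \<omega> in M. \<omega> \<in> A \<longrightarrow> (\<forall>\<^sub>F j in sequentially. \<omega> \<in> E j)" and e: "0 < e"
  shows "\<forall>\<^sub>F j in sequentially. prob A - e < prob (E j)"
proof -
  have "(\<lambda>j. prob (A - E j)) \<longlonglongrightarrow> 0"
  proof (rule prob_eventually_null)
    show "AE \<omega> in M. \<forall>\<^sub>F j in sequentially. \<omega> \<notin> A - E j"
      using ae
    proof eventually_elim
      case (elim \<omega>)
      show ?case
      proof (cases "\<omega> \<in> A")
        case True
        with elim have "\<forall>\<^sub>F j in sequentially. \<omega> \<in> E j" by simp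
        then show ?thesis by eventually_elim simp
      qed simp
    qed
  qed auto
  then have "\<forall>\<^sub>F j in sequentially. prob (A - E j) < e"
    using e by (rule order_tendstoD)
  then show ?thesis
  proof eventually_elim
    case (elim j)
    have "prob A \<le> prob ((A - E j) \<union> E j)" by (intro finite_measure_mono) auto
    also have "\<dots> \<le> prob (A - E j) + prob (E j)" by (intro measure_Un_le) auto
    finally show ?case using elim by simp
  qed
qed

text \<open>Closed half of the portmanteau theorem, for the half line.\<close>

lemma portmanteau_closed_half_line:
  assumes N: "\<And>n. prob_space (N n)" and M: "prob_space M"
    and Zn [measurable]: "\<And>n. Zn n \<in> borel_measurable (N n)" and Z [measurable]: "Z \<in> borel_measurable M"
    and lim: "\<And>h :: real \<Rightarrow> real. continuous_on UNIV h \<Longrightarrow> bounded (range h) \<Longrightarrow>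
       (\<lambda>n. \<integral>\<omega>. h (Zn n \<omega>) \<partial>N n) \<longlonglongrightarrow> (\<integral>\<omega>. h (Z \<omega>) \<partial>M)"
    and e: "0 < e"
  shows "\<forall>\<^sub>F n in sequentially. measure (N n) {\<omega>\<in>space (N n). 0 \<le> Zn n \<omega>}
    < measure M {\<omega>\<in>space M. 0 \<le> Z \<omega>} + e"
proof -
  interpret M: prob_space M by (rule M)
  \<comment> \<open>The error made by replacing \<open>0 \<le> Z\<close> with \<open>- 1 / Suc j < Z\<close>.\<close>
  define E where "E j = {\<omega>\<in>space M. - 1 / real (Suc j) < Z \<omega> \<and> Z \<omega> < 0}" for j
  have [measurable]: "E j \<in> sets M" for j unfolding E_def by measurable
  have "(\<lambda>j. M.prob (E j)) \<longlonglongrightarrow> 0"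
  proof (rule M.prob_eventually_null)
    show "AE \<omega> in M. \<forall>\<^sub>F j in sequentially. \<omega> \<notin> E j"
    proof (rule AE_I2)
      fix \<omega>
      show "\<forall>\<^sub>F j in sequentially. \<omega> \<notin> E j"
      proof (cases "Z \<omega> < 0")
        case True
        have "(\<lambda>j. - 1 / real (Suc j)) \<longlonglongrightarrow> 0"
          using tendsto_minus[OF LIMSEQ_inverse_real_of_nat] by (simp add: field_simps)
        then have "\<forall>\<^sub>F j in sequentially. Z \<omega> < - 1 / real (Suc j)"
          using True by (rule order_tendstoD)
        then show ?thesis by eventually_elim (auto simp: E_def)
      qed (auto simp: E_def)
    qed
  qed auto
  then have "\<forall>\<^sub>F j in sequentially. M.prob (E j) < e / 2" using e by (intro order_tendstoD) auto
  then obtain j where j: "M.prob (E j) < e / 2" by (auto simp: eventually_sequentially)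
  \<comment> \<open>A continuous function between the indicators of \<open>{0..}\<close> and of \<open>{- 1 / Suc j..}\<close>.\<close>
  define h where "h x = max 0 (min 1 (1 + real (Suc j) * x))" for x :: real
  have h01: "0 \<le> h x" "h x \<le> 1" for x by (auto simp: h_def)
  have hc: "continuous_on UNIV h" unfolding h_def by (intro continuous_intros)
  have [measurable]: "h \<in> borel_measurable borel" by (rule borel_measurable_continuous_onI[OF hc])
  have hb: "bounded (range h)" unfolding bounded_iff using h01 by (intro exI[of _ 1]) auto
  have h1: "h x = 1" if "0 \<le> x" for x using that by (simp add: h_def)
  have h0: "h x = 0" if "x \<le> - 1 / real (Suc j)" for x
    using that by (simp add: h_def field_simps)
  have "(\<integral>\<omega>. h (Z \<omega>) \<partial>M) \<le> (\<integral>\<omega>. indicator ({\<omega>\<in>space M. 0 \<le> Z \<omega>} \<union> E j) \<omega> \<partial>M)"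
  proof (rule integral_mono)
    show "integrable M (\<lambda>\<omega>. h (Z \<omega>))"
      by (rule M.integrable_const_bound[of _ 1]) (use h01 in auto)
    show "integrable M (\<lambda>\<omega>. indicator ({\<omega>\<in>space M. 0 \<le> Z \<omega>} \<union> E j) \<omega> :: real)"
      by (rule M.integrable_const_bound[of _ 1]) auto
    fix \<omega> assume "\<omega> \<in> space M"
    then show "h (Z \<omega>) \<le> indicator ({\<omega>\<in>space M. 0 \<le> Z \<omega>} \<union> E j) \<omega>"
      using h01(2)[of "Z \<omega>"] h0[of "Z \<omega>"] by (auto simp: E_def indicator_def not_le not_less)
  qed
  also have "\<dots> = M.prob ({\<omega>\<in>space M. 0 \<le> Z \<omega>} \<union> E j)" by simp
  also have "\<dots> \<le> M.prob {\<omega>\<in>space M. 0 \<le> Z \<omega>} + M.prob (E j)"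
    by (intro measure_Un_le) auto
  finally have up: "(\<integral>\<omega>. h (Z \<omega>) \<partial>M) < M.prob {\<omega>\<in>space M. 0 \<le> Z \<omega>} + e" using j e by simp
  have "\<forall>\<^sub>F n in sequentially. (\<integral>\<omega>. h (Zn n \<omega>) \<partial>N n) < M.prob {\<omega>\<in>space M. 0 \<le> Z \<omega>} + e"
    using order_tendstoD(2)[OF lim[OF hc hb] up] .
  then show ?thesis
  proof eventually_elim
    case (elim n)
    interpret N: prob_space "N n" by (rule N)
    have "N.prob {\<omega>\<in>space (N n). 0 \<le> Zn n \<omega>} = (\<integral>\<omega>. indicator {\<omega>\<in>space (N n). 0 \<le> Zn n \<omega>} \<omega> \<partial>N n)"
      by simp
    also have "\<dots> \<le> (\<integral>\<omega>. h (Zn n \<omega>) \<partial>N n)"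
    proof (rule integral_mono)
      show "integrable (N n) (\<lambda>\<omega>. h (Zn n \<omega>))"
        by (rule N.integrable_const_bound[of _ 1]) (use h01 in auto)
      show "integrable (N n) (\<lambda>\<omega>. indicator {\<omega>\<in>space (N n). 0 \<le> Zn n \<omega>} \<omega> :: real)"
        by (rule N.integrable_const_bound[of _ 1]) auto
      fix \<omega>
      show "indicator {\<omega>\<in>space (N n). 0 \<le> Zn n \<omega>} \<omega> \<le> h (Zn n \<omega>)"
        using h01 h1 by (auto simp: indicator_def)
    qed
    finally show ?case using elim by simp
  qed
qed

lemma real_distribution_distr:
  assumes "prob_space M" "Z \<in> borel_measurable M"
  shows "real_distribution (distr M borel Z)"
  using assms by (auto intro!: real_distribution.intro prob_space.prob_space_distr simp: real_distribution_axioms_def)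

lemma cdf_distr:
  assumes "Z \<in> borel_measurable M"
  shows "cdf (distr M borel Z) x = measure M {\<omega>\<in>space M. Z \<omega> \<le> x}"
  using assms unfolding cdf_def
  by (subst measure_distr) (auto intro!: arg_cong[where f = "measure M"])

text \<open>The map \<open>y \<mapsto> exp (-y)\<close> from \<open>[0,\<infinity>]\<close> onto \<open>[0,1]\<close>, with value \<open>0\<close> at \<open>\<infinity>\<close>. It transports laws of
  random times to laws on the real line, where weak convergence is tested by distribution functions.\<close>

definition exp_neg :: "ereal \<Rightarrow> real" where
  "exp_neg y = (if y = \<infinity> then 0 else exp (- real_of_ereal y))"

text \<open>The inverse of \<open>exp_neg\<close> on \<open>[0,1]\<close>, extended by constants to a continuous function on the reals.\<close>

definition neg_ln :: "real \<Rightarrow> ereal" where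
  "neg_ln z = (if z \<le> 0 then \<infinity> else ereal (- ln (min 1 z)))"

lemma neg_ln_exp_neg: "0 \<le> y \<Longrightarrow> neg_ln (exp_neg y) = y"
  by (cases y) (auto simp: exp_neg_def neg_ln_def not_le)

lemma exp_neg_bounds: "0 \<le> y \<Longrightarrow> 0 \<le> exp_neg y \<and> exp_neg y \<le> 1"
  by (cases y) (auto simp: exp_neg_def)

lemma exp_neg_le_iff:
  assumes "0 \<le> y" "0 < z"
  shows "exp_neg y \<le> z \<longleftrightarrow> ereal (- ln z) \<le> y" "exp_neg y < z \<longleftrightarrow> ereal (- ln z) < y"
proof -
  have "exp (- r) \<le> z \<longleftrightarrow> - ln z \<le> r" for r
    using ln_le_cancel_iff[of "exp (- r)" z] assms(2) by auto
  moreover have "exp (- r) < z \<longleftrightarrow> - ln z < r" for r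
    using ln_less_cancel_iff[of "exp (- r)" z] assms(2) by auto
  ultimately show "exp_neg y \<le> z \<longleftrightarrow> ereal (- ln z) \<le> y" "exp_neg y < z \<longleftrightarrow> ereal (- ln z) < y"
    using assms by (cases y; simp add: exp_neg_def)+
qed

lemma isCont_neg_ln: "isCont neg_ln z"
proof -
  consider "z < 0" | "z = 0" | "z > 0" by linarith
  then show ?thesis
  proof cases
    case 1
    then have "\<forall>\<^sub>F x in nhds z. neg_ln x = \<infinity>"
      using eventually_nhds_in_open[of "{..<0}" z]
      by (auto elim!: eventually_mono simp: neg_ln_def)
    then show ?thesis by (subst isCont_cong[where g = "\<lambda>_. \<infinity>"]) auto
  next
    case 3
    then have "\<forall>\<^sub>F x in nhds z. neg_ln x = ereal (- ln (min 1 x))"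
      using eventually_nhds_in_open[of "{0<..}" z]
      by (auto elim!: eventually_mono simp: neg_ln_def)
    then have "isCont neg_ln z \<longleftrightarrow> isCont (\<lambda>x. ereal (- ln (min 1 x))) z"
      by (rule isCont_cong)
    moreover have "isCont (\<lambda>x. ereal (- ln (min 1 x))) z"
      unfolding continuous_at using 3
      by (intro tendsto_intros) auto
    ultimately show ?thesis by simp
  next
    case 2
    have "(neg_ln \<longlongrightarrow> \<infinity>) (at 0)"
      unfolding tendsto_PInfty
    proof
      fix r :: real
      show "\<forall>\<^sub>F x in at 0. ereal r < neg_ln x"
        unfolding eventually_at
      proof (intro exI[of _ "min 1 (exp (- r))"] conjI ballI impI)
        fix x :: real assume x: "x \<noteq> 0 \<and> dist x 0 < min 1 (exp (- r))"
        show "ereal r < neg_ln x"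
        proof (cases "x > 0")
          case True
          with x have "ln x < ln (exp (- r))" by (subst ln_less_cancel_iff) auto
          with True x show ?thesis by (auto simp: neg_ln_def)
        qed (auto simp: neg_ln_def)
      qed auto
    qed
    then show ?thesis using 2 by (simp add: continuous_at neg_ln_def)
  qed
qed

text \<open>Convergence in distribution of random times in \<open>[0,\<infinity>]\<close> can be read off from their distribution
  functions at positive finite times. No separate hypothesis is needed at the two ends: after
  the transport by \<open>exp_neg\<close>, time \<open>0\<close> corresponds to \<open>1\<close>, where all distribution functions are \<open>1\<close>, and
  time \<open>\<infinity>\<close> to \<open>0\<close>, which is a continuity point only if the limit is almost surely finite, in which case
  the bounds for large \<open>t\<close> suffice.\<close>

lemma converges_in_distribution_times:
  fixes Y :: "'w \<Rightarrow> ereal" and Yn :: "nat \<Rightarrow> 'v \<Rightarrow> ereal"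
  assumes Mn: "\<And>n. prob_space (Mn n)" and M: "prob_space M"
    and Ynm: "\<And>n. Yn n \<in> borel_measurable (completion (Mn n))"
    and Ym: "Y \<in> borel_measurable (completion M)"
    and Yn0: "\<And>n \<omega>. 0 \<le> Yn n \<omega>" and Y0: "\<And>\<omega>. 0 \<le> Y \<omega>"
    and up: "\<And>t e. 0 < t \<Longrightarrow> 0 < e \<Longrightarrow> \<forall>\<^sub>F n in sequentially.
      measure (completion (Mn n)) {\<omega>\<in>space (Mn n). Yn n \<omega> \<le> ereal t}
        < measure (completion M) {\<omega>\<in>space M. Y \<omega> \<le> ereal t} + e"
    and low: "\<And>t e. 0 < t \<Longrightarrow> 0 < e \<Longrightarrow> \<forall>\<^sub>F n in sequentially.
      measure (completion M) {\<omega>\<in>space M. Y \<omega> < ereal t} - e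
        < measure (completion (Mn n)) {\<omega>\<in>space (Mn n). Yn n \<omega> < ereal t}"
  shows "converges_in_distribution euclidean Mn Yn M Y"
proof -
  define N where "N n = completion (Mn n)" for n
  define N' where "N' = completion M"
  interpret N: prob_space "N n" for n unfolding N_def by (rule prob_space.prob_space_completion[OF Mn])
  interpret N': prob_space N' unfolding N'_def by (rule prob_space.prob_space_completion[OF M])
  have [measurable]: "Yn n \<in> borel_measurable (N n)" for n using Ynm by (simp add: N_def)
  have [measurable]: "Y \<in> borel_measurable N'" using Ym by (simp add: N'_def)
  have [measurable]: "exp_neg \<in> borel_measurable borel" unfolding exp_neg_def by measurable
  let ?Zn = "\<lambda>n \<omega>. exp_neg (Yn n \<omega>)" and ?Z = "\<lambda>\<omega>. exp_neg (Y \<omega>)"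
  define D where "D n = distr (N n) borel (?Zn n)" for n
  define D' where "D' = distr N' borel ?Z"
  have rd: "real_distribution (D n)" "real_distribution D'" for n
    unfolding D_def D'_def by (intro real_distribution_distr N.prob_space_axioms N'.prob_space_axioms; measurable)+
  interpret D': real_distribution D' by (rule rd)
  have cdfn: "cdf (D n) z = N.prob n {\<omega>\<in>space (N n). ?Zn n \<omega> \<le> z}" for n z
    unfolding D_def by (rule cdf_distr) measurable
  have cdf: "cdf D' z = N'.prob {\<omega>\<in>space N'. ?Z \<omega> \<le> z}" for z
    unfolding D'_def by (rule cdf_distr) measurable
  have Up: "\<forall>\<^sub>F n in sequentially. N.prob n {\<omega>\<in>space (N n). ereal t \<le> Yn n \<omega>}
      < N'.prob {\<omega>\<in>space N'. ereal t \<le> Y \<omega>} + e" if "0 < t" "0 < e" for t e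
    using low[OF that]
  proof eventually_elim
    case (elim n)
    have "N.prob n {\<omega>\<in>space (N n). ereal t \<le> Yn n \<omega>} = 1 - N.prob n {\<omega>\<in>space (N n). Yn n \<omega> < ereal t}"
      by (subst N.prob_compl[symmetric], measurable) (auto intro!: arg_cong[where f = "N.prob n"])
    moreover have "N'.prob {\<omega>\<in>space N'. ereal t \<le> Y \<omega>} = 1 - N'.prob {\<omega>\<in>space N'. Y \<omega> < ereal t}"
      by (subst N'.prob_compl[symmetric], measurable) (auto intro!: arg_cong[where f = "N'.prob"])
    ultimately show ?case using elim by (simp add: N_def N'_def)
  qed
  have Low: "\<forall>\<^sub>F n in sequentially. N'.prob {\<omega>\<in>space N'. ereal t < Y \<omega>} - e
      < N.prob n {\<omega>\<in>space (N n). ereal t < Yn n \<omega>}" if "0 < t" "0 < e" for t e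
    using up[OF that]
  proof eventually_elim
    case (elim n)
    have "N.prob n {\<omega>\<in>space (N n). ereal t < Yn n \<omega>} = 1 - N.prob n {\<omega>\<in>space (N n). Yn n \<omega> \<le> ereal t}"
      by (subst N.prob_compl[symmetric], measurable) (auto intro!: arg_cong[where f = "N.prob n"])
    moreover have "N'.prob {\<omega>\<in>space N'. ereal t < Y \<omega>} = 1 - N'.prob {\<omega>\<in>space N'. Y \<omega> \<le> ereal t}"
      by (subst N'.prob_compl[symmetric], measurable) (auto intro!: arg_cong[where f = "N'.prob"])
    ultimately show ?case using elim by (simp add: N_def N'_def)
  qed
  have cdf_lt1: "cdf D' z = N'.prob {\<omega>\<in>space N'. ereal (- ln z) \<le> Y \<omega>}"
    "cdf (D n) z = N.prob n {\<omega>\<in>space (N n). ereal (- ln z) \<le> Yn n \<omega>}" if "0 < z" for z n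
    using that by (simp_all add: cdf cdfn exp_neg_le_iff Y0 Yn0)
  have "weak_conv_m D D'"
    unfolding weak_conv_m_def weak_conv_def
  proof (intro allI impI)
    \<comment> \<open>For \<open>z = exp (-t)\<close> with \<open>0 < t\<close>, the value of the distribution function at \<open>z\<close> is the probability
      of a time of at least \<open>t\<close>. As \<open>z\<close> is not an atom, it does not matter for the lower bound
      whether the inequality is strict.\<close>
    fix z assume cont: "isCont (cdf D') z"
    then have atom: "D'.prob {z} = 0" by (simp add: D'.isCont_cdf)
    have atom': "N'.prob {\<omega>\<in>space N'. ?Z \<omega> = z} = 0"
    proof -
      have "D'.prob {z} = N'.prob (?Z -` {z} \<inter> space N')" unfolding D'_def by (subst measure_distr) auto
      also have "?Z -` {z} \<inter> space N' = {\<omega>\<in>space N'. ?Z \<omega> = z}" by auto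
      finally show ?thesis using atom by simp
    qed
    consider "z < 0" | "z = 0" | "0 < z" "z < 1" | "1 \<le> z" by linarith
    then show "(\<lambda>n. cdf (D n) z) \<longlonglongrightarrow> cdf D' z"
    proof cases
      case 1
      then have "\<not> exp_neg y \<le> z" if "0 \<le> y" for y
        using exp_neg_bounds[OF that] by linarith
      then show ?thesis by (simp add: cdf cdfn Yn0 Y0)
    next
      case 4
      then have "exp_neg y \<le> z" if "0 \<le> y" for y
        using exp_neg_bounds[OF that] by linarith
      then show ?thesis by (simp add: cdf cdfn Yn0 Y0 N.prob_space N'.prob_space)
    next
      case 3
      define t where "t = - ln z"
      have t: "0 < t" using 3 by (simp add: t_def)
      show ?thesis
      proof (rule order_tendstoI)
        fix a assume "cdf D' z < a"
        then show "\<forall>\<^sub>F n in sequentially. cdf (D n) z < a"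
          using Up[OF t, of "a - cdf D' z"] 3 by (simp add: cdf_lt1 t_def)
      next
        fix a assume a: "a < cdf D' z"
        have "cdf D' z \<le> N'.prob ({\<omega>\<in>space N'. ereal t < Y \<omega>} \<union> {\<omega>\<in>space N'. ?Z \<omega> = z})"
          unfolding cdf using 3
          by (intro N'.finite_measure_mono) (auto simp: t_def exp_neg_le_iff(2)[OF Y0, symmetric])
        also have "\<dots> \<le> N'.prob {\<omega>\<in>space N'. ereal t < Y \<omega>} + N'.prob {\<omega>\<in>space N'. ?Z \<omega> = z}"
          by (intro measure_Un_le) auto
        finally have "a < N'.prob {\<omega>\<in>space N'. ereal t < Y \<omega>}" using atom' a by simp
        then have "\<forall>\<^sub>F n in sequentially. a < N.prob n {\<omega>\<in>space (N n). ereal t < Yn n \<omega>}"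
          using Low[OF t, of "N'.prob {\<omega>\<in>space N'. ereal t < Y \<omega>} - a"] by simp
        then show "\<forall>\<^sub>F n in sequentially. a < cdf (D n) z"
        proof eventually_elim
          case (elim n)
          also have "N.prob n {\<omega>\<in>space (N n). ereal t < Yn n \<omega>} \<le> cdf (D n) z"
            unfolding cdf_lt1[OF 3(1)] by (intro N.finite_measure_mono) (auto simp: t_def)
          finally show ?case .
        qed
      qed
    next
      case 2
      have Zinf: "exp_neg y \<le> z \<longleftrightarrow> y = \<infinity>" for y
        using 2 by (auto simp: exp_neg_def not_le)
      have z0: "cdf D' z = 0"
      proof -
        have "{\<omega>\<in>space N'. ?Z \<omega> \<le> z} = {\<omega>\<in>space N'. ?Z \<omega> = z}"
          using exp_neg_bounds[OF Y0] 2 by (auto intro: antisym)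
        then show ?thesis using atom' by (simp add: cdf)
      qed
      have "(\<lambda>j. N'.prob {\<omega>\<in>space N'. ereal (real (Suc j)) \<le> Y \<omega>}) \<longlonglongrightarrow> 0"
      proof (rule N'.prob_eventually_null)
        have ae: "AE \<omega> in N'. \<not> (Y \<omega> = \<infinity>)"
          using z0 unfolding cdf Zinf
          by (subst (asm) N'.prob_eq_0) auto
        then show "AE \<omega> in N'. \<forall>\<^sub>F j in sequentially. \<omega> \<notin> {\<omega>\<in>space N'. ereal (real (Suc j)) \<le> Y \<omega>}"
        proof eventually_elim
          case (elim \<omega>)
          then obtain r where r: "Y \<omega> = ereal r" using Y0[of \<omega>] by (cases "Y \<omega>") auto
          have "\<forall>\<^sub>F j in sequentially. r < real (Suc j)" by real_asymp
          then show ?case by eventually_elim (simp add: r)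
        qed
      qed measurable
      show ?thesis
        unfolding z0
      proof (rule order_tendstoI)
        fix a :: real assume "a < 0"
        then show "\<forall>\<^sub>F n in sequentially. a < cdf (D n) z"
          by (intro always_eventually allI) (auto simp: cdf_def intro: less_le_trans)
      next
        fix a :: real assume a: "0 < a"
        have "\<forall>\<^sub>F j in sequentially. N'.prob {\<omega>\<in>space N'. ereal (real (Suc j)) \<le> Y \<omega>} < a / 2"
          by (rule order_tendstoD(2)[OF \<open>(\<lambda>j. _ j) \<longlonglongrightarrow> 0\<close>]) (use a in simp)
        then obtain j where j: "N'.prob {\<omega>\<in>space N'. ereal (real (Suc j)) \<le> Y \<omega>} < a / 2"
          by (auto simp: eventually_sequentially)
        have "\<forall>\<^sub>F n in sequentially. N.prob n {\<omega>\<in>space (N n). ereal (real (Suc j)) \<le> Yn n \<omega>}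
            < N'.prob {\<omega>\<in>space N'. ereal (real (Suc j)) \<le> Y \<omega>} + a / 2"
          by (rule Up) (use a in auto)
        then show "\<forall>\<^sub>F n in sequentially. cdf (D n) z < a"
        proof eventually_elim
          case (elim n)
          have "cdf (D n) z \<le> N.prob n {\<omega>\<in>space (N n). ereal (real (Suc j)) \<le> Yn n \<omega>}"
            unfolding cdfn Zinf by (intro N.finite_measure_mono) auto
          then show ?case using elim j by simp
        qed
      qed
    qed
  qed
  note wc = weak_conv_imp_integral_bdd_continuous_conv[OF rd this]
  show ?thesis
    unfolding converges_in_distribution_def
  proof (intro conjI allI impI)
    have "Yn n -` U \<inter> space (Mn n) \<in> sets (completion (Mn n))" if "open U" for n U
      using measurable_sets[OF Ynm borel_open[OF that]] by simp
    then show "random_element (Mn n) euclidean (Yn n)" for n by (simp add: random_element_def)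
    have "Y -` U \<inter> space M \<in> sets (completion M)" if "open U" for U
      using measurable_sets[OF Ym borel_open[OF that]] by simp
    then show "random_element M euclidean Y" by (simp add: random_element_def)
  next
    fix F :: "ereal \<Rightarrow> real"
    assume "continuous_map euclidean euclideanreal F \<and> bounded (F ` topspace euclidean)"
    then have F: "continuous_on UNIV F" "bounded (range F)" by auto
    then obtain B where B: "\<And>x. norm (F x) \<le> B" by (auto simp: bounded_iff)
    define H where "H z = F (neg_ln z)" for z
    have H: "isCont H z" for z
    proof -
      have "isCont F (neg_ln z)" using F(1) by (simp add: continuous_on_eq_continuous_at)
      then show ?thesis unfolding H_def by (rule isCont_o2[OF isCont_neg_ln])
    qed
    have [measurable]: "H \<in> borel_measurable borel"
      by (rule borel_measurable_continuous_onI) (simp add: continuous_at_imp_continuous_on H)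
    have "(\<lambda>n. integral\<^sup>L (D n) H) \<longlonglongrightarrow> integral\<^sup>L D' H"
      by (rule wc[OF H, of B]) (use B in \<open>simp add: H_def\<close>)
    moreover have "integral\<^sup>L (D n) H = (\<integral>\<omega>. F (Yn n \<omega>) \<partial>N n)" for n
      unfolding D_def by (subst integral_distr) (auto simp: H_def neg_ln_exp_neg Yn0)
    moreover have "integral\<^sup>L D' H = (\<integral>\<omega>. F (Y \<omega>) \<partial>N')"
      unfolding D'_def by (subst integral_distr) (auto simp: H_def neg_ln_exp_neg Y0)
    ultimately show "(\<lambda>n. \<integral>\<omega>. F (Yn n \<omega>) \<partial>completion (Mn n)) \<longlonglongrightarrow> (\<integral>\<omega>. F (Y \<omega>) \<partial>completion M)"
      by (simp add: N_def N'_def)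
  qed
qed


section \<open>Consequences of a small Gromov-Hausdorff distance\<close>

lemma abs_SUP_diff_le:
  fixes f :: "'i \<Rightarrow> real" and g :: "'j \<Rightarrow> real"
  assumes A: "A \<noteq> {}" and B: "B \<noteq> {}"
    and bf: "bdd_above (f ` A)" and bg: "bdd_above (g ` B)"
    and AB: "\<And>x. x \<in> A \<Longrightarrow> \<exists>y\<in>B. \<bar>f x - g y\<bar> \<le> r"
    and BA: "\<And>y. y \<in> B \<Longrightarrow> \<exists>x\<in>A. \<bar>f x - g y\<bar> \<le> r"
  shows "\<bar>(SUP x\<in>A. f x) - (SUP y\<in>B. g y)\<bar> \<le> r"
proof -
  have "(SUP x\<in>A. f x) \<le> (SUP y\<in>B. g y) + r"
  proof (rule cSUP_least[OF A])
    fix x assume "x \<in> A"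
    then obtain y where y: "y \<in> B" "\<bar>f x - g y\<bar> \<le> r" using AB by blast
    have "g y \<le> (SUP y\<in>B. g y)" by (rule cSUP_upper[OF y(1) bg])
    then show "f x \<le> (SUP y\<in>B. g y) + r" using y(2) by linarith
  qed
  moreover have "(SUP y\<in>B. g y) \<le> (SUP x\<in>A. f x) + r"
  proof (rule cSUP_least[OF B])
    fix y assume "y \<in> B"
    then obtain x where x: "x \<in> A" "\<bar>f x - g y\<bar> \<le> r" using BA by blast
    have "f x \<le> (SUP x\<in>A. f x)" by (rule cSUP_upper[OF x(1) bf])
    then show "g y \<le> (SUP x\<in>A. f x) + r" using x(2) by linarith
  qed
  ultimately show ?thesis by linarith
qed

lemma abs_INF_diff_le:
  fixes f :: "'i \<Rightarrow> real" and g :: "'j \<Rightarrow> real"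
  assumes "A \<noteq> {}" "B \<noteq> {}" "bdd_below (f ` A)" "bdd_below (g ` B)"
    and "\<And>x. x \<in> A \<Longrightarrow> \<exists>y\<in>B. \<bar>f x - g y\<bar> \<le> r"
    and "\<And>y. y \<in> B \<Longrightarrow> \<exists>x\<in>A. \<bar>f x - g y\<bar> \<le> r"
  shows "\<bar>(INF x\<in>A. f x) - (INF y\<in>B. g y)\<bar> \<le> r"
proof -
  have bdd: "bdd_above ((\<lambda>x. - h x) ` S)" if "bdd_below (h ` S)" for h :: "'k \<Rightarrow> real" and S
  proof -
    obtain m where "\<And>x. x \<in> S \<Longrightarrow> m \<le> h x" using \<open>bdd_below (h ` S)\<close> unfolding bdd_below_def by blast
    then show ?thesis by (intro bdd_aboveI2[of _ _ "- m"]) auto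
  qed
  have "\<bar>(SUP x\<in>A. - f x) - (SUP y\<in>B. - g y)\<bar> \<le> r"
  proof (intro abs_SUP_diff_le assms(1,2) bdd assms(3,4))
    fix x assume "x \<in> A"
    then obtain y where "y \<in> B" "\<bar>f x - g y\<bar> \<le> r" using assms(5) by blast
    then show "\<exists>y\<in>B. \<bar>- f x - - g y\<bar> \<le> r" by (intro bexI[of _ y]) auto
  next
    fix y assume "y \<in> B"
    then obtain x where "x \<in> A" "\<bar>f x - g y\<bar> \<le> r" using assms(6) by blast
    then show "\<exists>x\<in>A. \<bar>- f x - - g y\<bar> \<le> r" by (intro bexI[of _ x]) auto
  qed
  then show ?thesis
    by (simp add: Inf_real_def image_image)
qed

lemma quads_nonempty: "q \<in> quads T \<Longrightarrow> mspace (qspace q) \<noteq> {}"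
  by (auto simp: quads_def)

lemma quads_qloc_bound:
  assumes "q \<in> quads T"
  obtains B where "\<And>t x. t \<in> {0..T} \<Longrightarrow> x \<in> mspace (qspace q) \<Longrightarrow> 0 \<le> qloc q t x \<and> qloc q t x \<le> B"
proof -
  let ?X = "prod_topology (top_of_set {0..T}) (mtopology_of (qspace q))"
  have c: "compact_space (top_of_set {0..T})" by (simp add: compact_space_subtopology)
  have "compact_space ?X"
    using assms c by (auto simp: quads_def compact_space_prod_topology)
  moreover have "continuous_map ?X euclideanreal (\<lambda>(t, x). qloc q t x)"
    using assms by (auto simp: quads_def)
  ultimately have "compactin euclideanreal ((\<lambda>(t, x). qloc q t x) ` topspace ?X)"
    by (meson compact_space_def image_compactin)
  then have "bounded ((\<lambda>(t, x). qloc q t x) ` topspace ?X)"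
    by (simp add: compact_imp_bounded)
  then obtain B where B: "\<forall>z\<in>(\<lambda>(t, x). qloc q t x) ` topspace ?X. norm z \<le> B"
    by (auto simp: bounded_iff)
  show thesis
  proof
    fix t x assume tx: "t \<in> {0..T}" "x \<in> mspace (qspace q)"
    then have "qloc q t x \<in> (\<lambda>(t, x). qloc q t x) ` topspace ?X"
      by (intro image_eqI[of _ _ "(t, x)"]) auto
    with B have "norm (qloc q t x) \<le> B" by blast
    then have "qloc q t x \<le> B" by simp
    then show "0 \<le> qloc q t x \<and> qloc q t x \<le> B" using assms tx by (auto simp: quads_def)
  qed
qed

lemma quads_diameter_bound:
  assumes "q \<in> quads T"
  obtains D where "\<And>x y. x \<in> mspace (qspace q) \<Longrightarrow> y \<in> mspace (qspace q) \<Longrightarrow> mdist (qspace q) x y \<le> D"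
proof -
  interpret Metric_space "mspace (qspace q)" "mdist (qspace q)" by simp
  have "compact_space mtopology" using assms by (simp add: quads_def mtopology_of_def)
  then have "mbounded (mspace (qspace q))"
    using compactin_imp_mbounded by (metis compact_space_def topspace_mtopology)
  then show thesis using that by (auto simp: mbounded_alt)
qed

text \<open>A consequence of a distance below \<open>r\<close> that no longer mentions an ambient space: a correspondence
  and a time change that almost preserve the local times and the distances to the root. Only distances
  to the root are recorded, which is why a factor \<open>2\<close> appears; the measures play no role.\<close>

definition quad_near :: "real \<Rightarrow> real \<Rightarrow> 'a quad \<Rightarrow> 'a quad \<Rightarrow> bool" where
  "quad_near T r q q' \<longleftrightarrow>
     (\<exists>C. correspondence (mspace (qspace q)) (mspace (qspace q')) C \<and>
        (\<forall>(x, x')\<in>C. \<bar>mdist (qspace q) (qroot q) x - mdist (qspace q') (qroot q') x'\<bar> \<le> 2 * r \<and>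
           (\<forall>t\<in>{0..T}. \<bar>qloc q t x - qloc q' t x'\<bar> \<le> r))) \<and>
     (\<exists>\<kappa>. increasing_homeo T \<kappa> \<and>
        (\<forall>t\<in>{0..T}. \<bar>\<kappa> t - t\<bar> \<le> r \<and>
           \<bar>mdist (qspace q) (qroot q) (qpath q (\<kappa> t)) - mdist (qspace q') (qroot q') (qpath q' t)\<bar> \<le> 2 * r))"

lemma increasing_homeo_id: "increasing_homeo T (\<lambda>t. t)"
  unfolding increasing_homeo_def
  by (auto simp: strict_mono_on_def intro!: exI[of _ "\<lambda>t. t"] homeomorphism_ident)

lemma increasing_homeo_bij:
  assumes "increasing_homeo T \<kappa>"
  shows "\<kappa> ` {0..T} = {0..T}"
  using assms by (auto simp: increasing_homeo_def homeomorphism_def)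

lemma quad_near_of_iso:
  assumes q: "q \<in> quads T" and f: "quad_iso T f q q'"
  shows "quad_near T 0 q q'"
proof -
  let ?C = "(\<lambda>x. (x, f x)) ` mspace (qspace q)"
  have im: "f ` mspace (qspace q) = mspace (qspace q')" and
    iso: "\<And>x y. x \<in> mspace (qspace q) \<Longrightarrow> y \<in> mspace (qspace q) \<Longrightarrow>
      mdist (qspace q') (f x) (f y) = mdist (qspace q) x y" and
    root: "f (qroot q) = qroot q'" and
    path: "\<And>t. t \<in> {0..T} \<Longrightarrow> f (qpath q t) = qpath q' t" and
    loc: "\<And>t x. t \<in> {0..T} \<Longrightarrow> x \<in> mspace (qspace q) \<Longrightarrow> qloc q t x = qloc q' t (f x)"
    using f by (auto simp: quad_iso_def isometric_embedding_def)
  have "correspondence (mspace (qspace q)) (mspace (qspace q')) ?C"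
    unfolding correspondence_def using im by (auto simp: image_image)
  moreover have r: "qroot q \<in> mspace (qspace q)" and p: "\<And>t. t \<in> {0..T} \<Longrightarrow> qpath q t \<in> mspace (qspace q)"
    using q by (auto simp: quads_def cadlag_on_def)
  have "mdist (qspace q') (qroot q') (f x) = mdist (qspace q) (qroot q) x" if "x \<in> mspace (qspace q)" for x
    using iso[OF r that] root by simp
  moreover have "mdist (qspace q') (qroot q') (qpath q' t) = mdist (qspace q) (qroot q) (qpath q t)"
    if "t \<in> {0..T}" for t
    using iso[OF r p[OF that]] root path[OF that] by simp
  ultimately show ?thesis
    unfolding quad_near_def
    by (intro conjI exI[of _ ?C] exI[of _ "\<lambda>t. t"]) (auto simp: increasing_homeo_id loc)
qed

text \<open>Finiteness makes the set of admissible \<open>e\<close> nonempty; the infimum of the empty set of reals would be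
  an unspecified number.\<close>

lemma prokhorov_nonneg:
  assumes "finite_measure \<mu>" "finite_measure \<nu>"
  shows "0 \<le> prokhorov Z \<mu> \<nu>"
  unfolding prokhorov_def
proof (rule cInf_greatest)
  interpret m: finite_measure \<mu> by fact
  interpret n: finite_measure \<nu> by fact
  have "measure \<mu> A \<le> b + (measure \<mu> (space \<mu>) + measure \<nu> (space \<nu>) + 1)"
    "measure \<nu> A \<le> b + (measure \<mu> (space \<mu>) + measure \<nu> (space \<nu>) + 1)" if "0 \<le> b" for A b
    using m.bounded_measure[of A] n.bounded_measure[of A] that
      measure_nonneg[of \<mu> "space \<mu>"] measure_nonneg[of \<nu> "space \<nu>"] by linarith+
  then show "{e. 0 < e \<and> (\<forall>A. closedin (mtopology_of Z) A \<longrightarrow>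
      measure \<mu> A \<le> measure \<nu> {z\<in>mspace Z. \<exists>a\<in>A. mdist Z a z < e} + e \<and>
      measure \<nu> A \<le> measure \<mu> {z\<in>mspace Z. \<exists>a\<in>A. mdist Z a z < e} + e)} \<noteq> {}"
    by (intro ex_in_conv[THEN iffD1] exI[of _ "measure \<mu> (space \<mu>) + measure \<nu> (space \<nu>) + 1"])
      (auto intro: add_nonneg_pos)
qed auto

text \<open>Two metric spaces can be placed in a common one: join the two roots by a bridge of length one.\<close>

lemma exists_common_embedding:
  fixes m m' :: "'a metric"
  assumes r: "r \<in> mspace m" and r': "r' \<in> mspace m'"
  shows "\<exists>(Z :: ('a + 'a) metric) \<phi> \<phi>'. isometric_embedding m Z \<phi> \<and> isometric_embedding m' Z \<phi>'"
proof -
  interpret A: Metric_space "mspace m" "mdist m" by simp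
  interpret B: Metric_space "mspace m'" "mdist m'" by simp
  define S where "S = Inl ` mspace m \<union> Inr ` mspace m'"
  define d :: "'a + 'a \<Rightarrow> 'a + 'a \<Rightarrow> real" where
    "d u v = (case u of Inl x \<Rightarrow> (case v of Inl y \<Rightarrow> mdist m x y | Inr y \<Rightarrow> mdist m x r + 1 + mdist m' r' y)
       | Inr x \<Rightarrow> (case v of Inl y \<Rightarrow> mdist m y r + 1 + mdist m' r' x | Inr y \<Rightarrow> mdist m' x y))" for u v
  have "Metric_space S d"
  proof
    show "0 \<le> d u v" for u v by (auto simp: d_def split: sum.splits)
    show "d u v = d v u" for u v by (auto simp: d_def A.commute B.commute split: sum.splits)
    have pos: "0 < mdist m x r + 1 + mdist m' r' y" for x y
      using A.nonneg[of x r] B.nonneg[of r' y] by linarith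
    show "(d u v = 0) = (u = v)" if "u \<in> S" "v \<in> S" for u v
      using that pos[THEN less_imp_neq] by (auto simp: d_def S_def dest!: sym[of 0])
    have tri1: "mdist m x r \<le> mdist m x y + mdist m y r" if "x \<in> mspace m" "y \<in> mspace m" for x y
      using A.triangle[OF that r] .
    have tri2: "mdist m' r' y \<le> mdist m' r' x + mdist m' x y" if "x \<in> mspace m'" "y \<in> mspace m'" for x y
      using B.triangle[OF r' that] .
    have tri3: "mdist m x y \<le> mdist m x r + mdist m y r" if "x \<in> mspace m" "y \<in> mspace m" for x y
      using A.triangle[OF that(1) r that(2)] A.commute[of r y] by simp
    have tri4: "mdist m' x y \<le> mdist m' r' x + mdist m' r' y" if "x \<in> mspace m'" "y \<in> mspace m'" for x y
      using B.triangle[OF that(1) r' that(2)] B.commute[of x r'] by simp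
    fix u v w assume u: "u \<in> S" and v: "v \<in> S" and w: "w \<in> S"
    consider x y z where "u = Inl x" "v = Inl y" "w = Inl z" "x \<in> mspace m" "y \<in> mspace m" "z \<in> mspace m"
      | x y z where "u = Inl x" "v = Inl y" "w = Inr z" "x \<in> mspace m" "y \<in> mspace m" "z \<in> mspace m'"
      | x y z where "u = Inl x" "v = Inr y" "w = Inl z" "x \<in> mspace m" "y \<in> mspace m'" "z \<in> mspace m"
      | x y z where "u = Inl x" "v = Inr y" "w = Inr z" "x \<in> mspace m" "y \<in> mspace m'" "z \<in> mspace m'"
      | x y z where "u = Inr x" "v = Inl y" "w = Inl z" "x \<in> mspace m'" "y \<in> mspace m" "z \<in> mspace m"
      | x y z where "u = Inr x" "v = Inl y" "w = Inr z" "x \<in> mspace m'" "y \<in> mspace m" "z \<in> mspace m'"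
      | x y z where "u = Inr x" "v = Inr y" "w = Inl z" "x \<in> mspace m'" "y \<in> mspace m'" "z \<in> mspace m"
      | x y z where "u = Inr x" "v = Inr y" "w = Inr z" "x \<in> mspace m'" "y \<in> mspace m'" "z \<in> mspace m'"
      using u v w unfolding S_def by (elim UnE imageE) blast+
    then show "d u w \<le> d u v + d v w"
    proof cases
      case (1 x y z) then show ?thesis using A.triangle[of x y z] by (simp add: d_def)
    next
      case (2 x y z) then show ?thesis using tri1[of x y] by (simp add: d_def)
    next
      case (3 x y z)
      show ?thesis
        using tri3[OF 3(4,6)] B.nonneg[of r' y] unfolding 3(1-3) d_def sum.case by linarith
    next
      case (4 x y z) then show ?thesis using tri2[of y z] by (simp add: d_def)
    next
      case (5 x y z) then show ?thesis using tri1[of z y] A.commute[of y z] by (simp add: d_def)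
    next
      case (6 x y z)
      show ?thesis
        using tri4[OF 6(4,6)] A.nonneg[of y r] unfolding 6(1-3) d_def sum.case by linarith
    next
      case (7 x y z) then show ?thesis using tri2[of y x] B.commute[of y x] by (simp add: d_def)
    next
      case (8 x y z) then show ?thesis using B.triangle[of x y z] by (simp add: d_def)
    qed
  qed
  then have Z: "mspace (metric (S, d)) = S" "mdist (metric (S, d)) = d"
    by (simp_all add: Metric_space.mspace_metric Metric_space.mdist_metric)
  have "isometric_embedding m (metric (S, d)) Inl" "isometric_embedding m' (metric (S, d)) Inr"
    unfolding isometric_embedding_def Z by (simp_all add: S_def d_def)
  then show ?thesis by blast
qed

text \<open>Each of the three summands of the cost is nonnegative, hence each is below \<open>r\<close>. As infima and suprema
  of reals are only meaningful for bounded nonempty sets, the proof establishes these properties for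
  all that occur, from compactness of the spaces and continuity of the local times.\<close>

lemma quad_near_of_dist:
  fixes q q' :: "'a quad"
  assumes q: "q \<in> quads T" and q': "q' \<in> quads T" and T: "0 < T" and r: "quad_dist T q q' < r"
  shows "quad_near T r q q'"
proof -
  let ?K = "mspace (qspace q)" and ?K' = "mspace (qspace q')"
  let ?A = "{quad_cost T q q' Z \<phi> \<phi>' C | (Z :: ('a + 'a) metric) \<phi> \<phi>' C.
     isometric_embedding (qspace q) Z \<phi> \<and> isometric_embedding (qspace q') Z \<phi>' \<and>
     correspondence ?K ?K' C \<and> (qroot q, qroot q') \<in> C}"
  have root: "qroot q \<in> ?K" "qroot q' \<in> ?K'"
    and path: "\<And>t. t \<in> {0..T} \<Longrightarrow> qpath q t \<in> ?K" "\<And>t. t \<in> {0..T} \<Longrightarrow> qpath q' t \<in> ?K'"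
    using q q' by (auto simp: quads_def cadlag_on_def)
  have "correspondence ?K ?K' (?K \<times> ?K')" "(qroot q, qroot q') \<in> ?K \<times> ?K'"
    using root by (auto simp: correspondence_def fst_image_times snd_image_times)
  then have "?A \<noteq> {}" using exists_common_embedding[OF root] by blast
  then obtain c where "c \<in> ?A" "c < r" using r unfolding quad_dist_def by (rule cInf_lessD[THEN bexE]) auto
  then obtain Z :: "('a + 'a) metric" and \<phi> \<phi>' C where
    e: "isometric_embedding (qspace q) Z \<phi>" "isometric_embedding (qspace q') Z \<phi>'" and
    C: "correspondence ?K ?K' C" and rC: "(qroot q, qroot q') \<in> C" and
    cost: "quad_cost T q q' Z \<phi> \<phi>' C < r" by auto
  interpret Z: Metric_space "mspace Z" "mdist Z" by simp
  have eK: "\<And>x. x \<in> ?K \<Longrightarrow> \<phi> x \<in> mspace Z" "\<And>x. x \<in> ?K' \<Longrightarrow> \<phi>' x \<in> mspace Z"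
    and ed: "\<And>x y. x \<in> ?K \<Longrightarrow> y \<in> ?K \<Longrightarrow> mdist Z (\<phi> x) (\<phi> y) = mdist (qspace q) x y"
     "\<And>x y. x \<in> ?K' \<Longrightarrow> y \<in> ?K' \<Longrightarrow> mdist Z (\<phi>' x) (\<phi>' y) = mdist (qspace q') x y"
    using e by (auto simp: isometric_embedding_def)
  have CK: "x \<in> ?K" "x' \<in> ?K'" if "(x, x') \<in> C" for x x' using C that by (auto simp: correspondence_def)
  obtain D where D: "\<And>x y. x \<in> ?K \<Longrightarrow> y \<in> ?K \<Longrightarrow> mdist (qspace q) x y \<le> D"
    using quads_diameter_bound[OF q] by metis
  obtain D' where D': "\<And>x y. x \<in> ?K' \<Longrightarrow> y \<in> ?K' \<Longrightarrow> mdist (qspace q') x y \<le> D'"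
    using quads_diameter_bound[OF q'] by metis
  obtain B where B: "\<And>t x. t \<in> {0..T} \<Longrightarrow> x \<in> ?K \<Longrightarrow> 0 \<le> qloc q t x \<and> qloc q t x \<le> B"
    using quads_qloc_bound[OF q] by metis
  obtain B' where B': "\<And>t x. t \<in> {0..T} \<Longrightarrow> x \<in> ?K' \<Longrightarrow> 0 \<le> qloc q' t x \<and> qloc q' t x \<le> B'"
    using quads_qloc_bound[OF q'] by metis
  define E where "E = D + mdist Z (\<phi> (qroot q)) (\<phi>' (qroot q')) + D'"
  \<comment> \<open>Distances between the two embedded spaces are bounded: pass through the roots.\<close>
  have cross: "mdist Z (\<phi> x) (\<phi>' x') \<le> E" if "x \<in> ?K" "x' \<in> ?K'" for x x'
  proof -
    have "mdist Z (\<phi> x) (\<phi>' x') \<le> mdist Z (\<phi> x) (\<phi> (qroot q)) + mdist Z (\<phi> (qroot q)) (\<phi>' x')"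
      using that root eK by (intro Z.triangle) auto
    moreover have "mdist Z (\<phi> (qroot q)) (\<phi>' x') \<le>
        mdist Z (\<phi> (qroot q)) (\<phi>' (qroot q')) + mdist Z (\<phi>' (qroot q')) (\<phi>' x')"
      using that root eK by (intro Z.triangle) auto
    ultimately show ?thesis
      using ed(1)[OF that(1) root(1)] ed(2)[OF root(2) that(2)] D[OF that(1) root(1)] D'[OF root(2) that(2)]
      unfolding E_def by linarith
  qed
  let ?d = "\<lambda>\<kappa>. SUP t\<in>{0..T}. mdist Z (\<phi> (qpath q (\<kappa> t))) (\<phi>' (qpath q' t))"
  let ?k = "\<lambda>\<kappa>. SUP t\<in>{0..T}. \<bar>\<kappa> t - t\<bar>"
  let ?l = "\<lambda>x x'. SUP t\<in>{0..T}. \<bar>qloc q t x - qloc q' t x'\<bar>"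
  let ?J = "{?k \<kappa> + ?d \<kappa> | \<kappa>. increasing_homeo T \<kappa>}"
  have \<kappa>: "\<bar>\<kappa> t - t\<bar> \<le> ?k \<kappa>" "mdist Z (\<phi> (qpath q (\<kappa> t))) (\<phi>' (qpath q' t)) \<le> ?d \<kappa>"
    if "increasing_homeo T \<kappa>" "t \<in> {0..T}" for \<kappa> t
  proof -
    have k: "\<kappa> s \<in> {0..T}" if "s \<in> {0..T}" for s
      using increasing_homeo_bij[OF \<open>increasing_homeo T \<kappa>\<close>] that by blast
    have "\<bar>\<kappa> s - s\<bar> \<le> T" if "s \<in> {0..T}" for s using k[OF that] that by auto
    then show "\<bar>\<kappa> t - t\<bar> \<le> ?k \<kappa>" using that(2) by (intro cSUP_upper bdd_aboveI2) auto
    have "mdist Z (\<phi> (qpath q (\<kappa> s))) (\<phi>' (qpath q' s)) \<le> E" if "s \<in> {0..T}" for s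
      using cross[OF path(1)[OF k[OF that]] path(2)[OF that]] .
    then show "mdist Z (\<phi> (qpath q (\<kappa> t))) (\<phi>' (qpath q' t)) \<le> ?d \<kappa>"
      using that(2) by (intro cSUP_upper bdd_aboveI2) auto
  qed
  have \<kappa>0: "0 \<le> ?k \<kappa>" "0 \<le> ?d \<kappa>" if "increasing_homeo T \<kappa>" for \<kappa>
    using order_trans[OF abs_ge_zero \<kappa>(1)[OF that, of 0]] order_trans[OF Z.nonneg \<kappa>(2)[OF that, of 0]] T
    by simp_all
  have J: "skorokhod_J1 Z T (\<lambda>t. \<phi> (qpath q t)) (\<lambda>t. \<phi>' (qpath q' t)) = Inf ?J"
    by (simp add: skorokhod_J1_def)
  have Jne: "?J \<noteq> {}" using increasing_homeo_id by blast
  have J0: "0 \<le> Inf ?J" using \<kappa>0 by (intro cInf_greatest Jne) force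
  have l: "\<bar>qloc q t x - qloc q' t x'\<bar> \<le> ?l x x'" "?l x x' \<le> B + B'"
    if "x \<in> ?K" "x' \<in> ?K'" "t \<in> {0..T}" for t x x'
  proof -
    have bd: "\<bar>qloc q s x - qloc q' s x'\<bar> \<le> B + B'" if "s \<in> {0..T}" for s
      using B[OF that \<open>x \<in> ?K\<close>] B'[OF that \<open>x' \<in> ?K'\<close>] by linarith
    show "\<bar>qloc q t x - qloc q' t x'\<bar> \<le> ?l x x'"
      by (rule cSUP_upper[OF that(3) bdd_aboveI2]) (rule bd)
    show "?l x x' \<le> B + B'"
      by (rule cSUP_least[OF _ bd]) (use T in auto)
  qed
  let ?S = "SUP (x, x')\<in>C. mdist Z (\<phi> x) (\<phi>' x') + ?l x x'"
  have S: "mdist Z (\<phi> x) (\<phi>' x') + ?l x x' \<le> ?S" if "(x, x') \<in> C" for x x'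
  proof -
    have "bdd_above ((\<lambda>(x, x'). mdist Z (\<phi> x) (\<phi>' x') + ?l x x') ` C)"
    proof (rule bdd_aboveI2, clarify)
      fix x x' assume "(x, x') \<in> C"
      from CK[OF this] show "mdist Z (\<phi> x) (\<phi>' x') + ?l x x' \<le> E + (B + B')"
        using cross l(2)[of x x' 0] T by (intro add_mono) auto
    qed
    from cSUP_upper[OF that this] show ?thesis by simp
  qed
  have l0: "0 \<le> ?l x x'" if "(x, x') \<in> C" for x x'
    by (rule order_trans[OF abs_ge_zero l(1)[OF CK[OF that], of 0]]) (use T in simp)
  have S0: "0 \<le> ?S" using S[OF rC] l0[OF rC] Z.nonneg[of "\<phi> (qroot q)" "\<phi>' (qroot q')"] by linarith
  have fin: "finite_measure (distr (qmeas p) (mborel Z) u)"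
    if "p \<in> quads T" "isometric_embedding (qspace p) Z u" for p :: "'a quad" and u
  proof (rule finite_measure.finite_measure_distr)
    show "finite_measure (qmeas p)" using that by (simp add: quads_def)
    have s: "sets (qmeas p) = sets (mborel (qspace p))" using that by (simp add: quads_def)
    show "u \<in> measurable (qmeas p) (mborel Z)"
      using isometric_embedding_measurable[OF that(2)] measurable_cong_sets[OF s refl] by blast
  qed
  have "0 \<le> prokhorov Z (distr (qmeas q) (mborel Z) \<phi>) (distr (qmeas q') (mborel Z) \<phi>')"
    by (intro prokhorov_nonneg fin q q' e)
  with cost J0 S0 have Jr: "Inf ?J < r" and Sr: "?S < r" unfolding quad_cost_def J by linarith+
  obtain \<kappa> where hk: "increasing_homeo T \<kappa>" and kr: "?k \<kappa> + ?d \<kappa> < r"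
    using cInf_lessD[OF Jne Jr] by auto
  have rr: "mdist Z (\<phi> (qroot q)) (\<phi>' (qroot q')) \<le> r" using S[OF rC] l0[OF rC] Sr by linarith
  have quad: "\<bar>mdist (qspace q) (qroot q) x - mdist (qspace q') (qroot q') x'\<bar> \<le> 2 * r"
    if x: "x \<in> ?K" "x' \<in> ?K'" and d: "mdist Z (\<phi> x) (\<phi>' x') \<le> r" for x x'
  proof -
    note t = Z.triangle[OF eK(1)[OF root(1)] eK(1)[OF x(1)] eK(2)[OF x(2)]]
      Z.triangle[OF eK(1)[OF root(1)] eK(2)[OF x(2)] eK(1)[OF x(1)]]
      Z.triangle[OF eK(1)[OF root(1)] eK(2)[OF root(2)] eK(2)[OF x(2)]]
      Z.triangle[OF eK(2)[OF root(2)] eK(1)[OF root(1)] eK(2)[OF x(2)]]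
    show ?thesis
      using t d rr Z.commute[of "\<phi> x" "\<phi>' x'"] Z.commute[of "\<phi> (qroot q)" "\<phi>' (qroot q')"]
        ed(1)[OF root(1) x(1)] ed(2)[OF root(2) x(2)] by linarith
  qed
  show ?thesis
    unfolding quad_near_def
  proof (intro conjI exI[of _ C] exI[of _ \<kappa>] ballI C hk; clarify?)
    fix x x' assume c: "(x, x') \<in> C"
    show "\<bar>mdist (qspace q) (qroot q) x - mdist (qspace q') (qroot q') x'\<bar> \<le> 2 * r \<and>
        (\<forall>t\<in>{0..T}. \<bar>qloc q t x - qloc q' t x'\<bar> \<le> r)"
    proof (intro conjI ballI)
      have "mdist Z (\<phi> x) (\<phi>' x') \<le> r" using S[OF c] l0[OF c] Sr by linarith
      then show "\<bar>mdist (qspace q) (qroot q) x - mdist (qspace q') (qroot q') x'\<bar> \<le> 2 * r"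
        by (rule quad[OF CK[OF c]])
      show "\<bar>qloc q t x - qloc q' t x'\<bar> \<le> r" if "t \<in> {0..T}" for t
        using l(1)[OF CK[OF c] that] S[OF c] Sr Z.nonneg[of "\<phi> x" "\<phi>' x'"] by linarith
    qed
  next
    fix t assume t: "t \<in> {0..T}"
    show "\<bar>\<kappa> t - t\<bar> \<le> r" using \<kappa>(1)[OF hk t] \<kappa>0(2)[OF hk] kr by linarith
    have kt: "\<kappa> t \<in> {0..T}" using increasing_homeo_bij[OF hk] t by blast
    have "mdist Z (\<phi> (qpath q (\<kappa> t))) (\<phi>' (qpath q' t)) \<le> r"
      using \<kappa>(2)[OF hk t] \<kappa>0(1)[OF hk] kr by linarith
    then show "\<bar>mdist (qspace q) (qroot q) (qpath q (\<kappa> t)) - mdist (qspace q') (qroot q') (qpath q' t)\<bar> \<le> 2 * r"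
      by (rule quad[OF path(1)[OF kt] path(2)[OF t]])
  qed
qed


section \<open>Lipschitz functionals and convergence in distribution\<close>

text \<open>Real functionals of quadruples whose oscillation is controlled linearly by closeness. They are invariant
  under isometries of quadruples (case \<open>r = 0\<close>) and continuous on the space of classes.\<close>

definition quad_lipschitz :: "real \<Rightarrow> ('a quad \<Rightarrow> real) \<Rightarrow> bool" where
  "quad_lipschitz T f \<longleftrightarrow>
     (\<exists>c. \<forall>q\<in>quads T. \<forall>q'\<in>quads T. \<forall>r\<ge>0. quad_near T r q q' \<longrightarrow> \<bar>f q - f q'\<bar> \<le> c * r)"

lemma quad_lipschitzI:
  assumes "\<And>q q' r. q \<in> quads T \<Longrightarrow> q' \<in> quads T \<Longrightarrow> 0 \<le> r \<Longrightarrow> quad_near T r q q' \<Longrightarrow> \<bar>f q - f q'\<bar> \<le> c * r"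
  shows "quad_lipschitz T f"
  using assms unfolding quad_lipschitz_def by blast

lemma quad_lipschitz_const: "quad_lipschitz T (\<lambda>_. a)"
  by (rule quad_lipschitzI[where c = 0]) simp

lemma quad_lipschitz_diff:
  assumes "quad_lipschitz T f" "quad_lipschitz T g"
  shows "quad_lipschitz T (\<lambda>q. f q - g q)"
proof -
  obtain c where c: "\<And>q q' r. q \<in> quads T \<Longrightarrow> q' \<in> quads T \<Longrightarrow> 0 \<le> r \<Longrightarrow> quad_near T r q q' \<Longrightarrow> \<bar>f q - f q'\<bar> \<le> c * r"
    using assms(1) unfolding quad_lipschitz_def by blast
  obtain d where d: "\<And>q q' r. q \<in> quads T \<Longrightarrow> q' \<in> quads T \<Longrightarrow> 0 \<le> r \<Longrightarrow> quad_near T r q q' \<Longrightarrow> \<bar>g q - g q'\<bar> \<le> d * r"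
    using assms(2) unfolding quad_lipschitz_def by blast
  show ?thesis
  proof (rule quad_lipschitzI[where c = "c + d"])
    fix q q' :: "'a quad" and r :: real
    assume "q \<in> quads T" "q' \<in> quads T" "0 \<le> r" "quad_near T r q q'"
    from c[OF this] d[OF this] show "\<bar>f q - g q - (f q' - g q')\<bar> \<le> (c + d) * r"
      by (simp add: distrib_right)
  qed
qed

lemma quad_lipschitz_minus: "quad_lipschitz T f \<Longrightarrow> quad_lipschitz T (\<lambda>q. - f q)"
  using quad_lipschitz_diff[OF quad_lipschitz_const[of T 0]] by simp

lemma topspace_KK_topology: "topspace (KK_topology T) = KK T"
proof
  show "topspace (KK_topology T) \<subseteq> KK T"
    unfolding topspace_def openin_KK_topology by (auto simp: KK_open_def)
  have "KK_open T (KK T)" unfolding KK_open_def by (auto intro: exI[of _ 1])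
  then show "KK T \<subseteq> topspace (KK_topology T)"
    by (metis openin_KK_topology openin_subset)
qed

lemma KK_representative:
  assumes "c \<in> KK T"
  shows "(SOME q. q \<in> c) \<in> c" "(SOME q. q \<in> c) \<in> quads T"
proof -
  have "c \<noteq> {}" "c \<subseteq> quads T"
    using assms equiv_quad_eq in_quotient_imp_non_empty in_quotient_imp_subset unfolding KK_def by metis+
  then show "(SOME q. q \<in> c) \<in> c" "(SOME q. q \<in> c) \<in> quads T"
    by (meson someI_ex ex_in_conv subsetD)+
qed

lemma KK_class_in_KK_iff: "KK_class T q \<in> KK T \<longleftrightarrow> q \<in> quads T"
proof
  assume "KK_class T q \<in> KK T"
  from KK_representative(1)[OF this] show "q \<in> quads T" by (auto simp: KK_class_def quad_eq_def)
qed (auto simp: KK_class_def KK_def intro: quotientI)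

lemma quad_lipschitz_representative:
  assumes f: "quad_lipschitz T f" and q: "q \<in> quads T"
  shows "f (SOME p. p \<in> KK_class T q) = f q"
proof -
  let ?p = "SOME p. p \<in> KK_class T q"
  have "?p \<in> KK_class T q" by (rule KK_representative(1)[where T = T]) (simp add: KK_class_in_KK_iff q)
  then have p: "?p \<in> quads T" "\<exists>g. quad_iso T g q ?p" by (auto simp: KK_class_def quad_eq_def)
  then have "quad_near T 0 q ?p" using quad_near_of_iso[OF q] by blast
  then show ?thesis using f q p(1) unfolding quad_lipschitz_def by force
qed

lemma continuous_map_KK:
  assumes f: "quad_lipschitz T f" and T: "0 < T"
  shows "continuous_map (KK_topology T) euclideanreal (\<lambda>c. f (SOME q. q \<in> c))"
  unfolding continuous_map_def topspace_KK_topology openin_KK_topology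
proof (intro conjI allI impI)
  fix U :: "real set" assume "openin euclideanreal U"
  then have U: "open U" by simp
  obtain k where k: "\<And>q q' r. q \<in> quads T \<Longrightarrow> q' \<in> quads T \<Longrightarrow> 0 \<le> r \<Longrightarrow> quad_near T r q q' \<Longrightarrow> \<bar>f q - f q'\<bar> \<le> k * r"
    using f unfolding quad_lipschitz_def by blast
  show "KK_open T {c \<in> KK T. f (SOME q. q \<in> c) \<in> U}"
    unfolding KK_open_def
  proof (intro conjI ballI)
    fix c assume c: "c \<in> {c \<in> KK T. f (SOME q. q \<in> c) \<in> U}"
    then obtain e where e: "0 < e" "ball (f (SOME q. q \<in> c)) e \<subseteq> U"
      using U open_contains_ball by blast
    define r where "r = e / (\<bar>k\<bar> + 1)"
    have r: "0 < r" using e by (simp add: r_def)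
    have kr: "k * r < e"
    proof -
      have "k * r \<le> \<bar>k\<bar> * r" using r by (intro mult_right_mono) auto
      also have "\<dots> < (\<bar>k\<bar> + 1) * r" using r by simp
      also have "\<dots> = e" by (simp add: r_def)
      finally show ?thesis .
    qed
    show "\<exists>r>0. \<forall>c'\<in>KK T. KK_dist T c c' < r \<longrightarrow> c' \<in> {c \<in> KK T. f (SOME q. q \<in> c) \<in> U}"
    proof (intro exI[of _ r] conjI ballI impI r)
      fix c' assume c': "c' \<in> KK T" "KK_dist T c c' < r"
      have q: "(SOME q. q \<in> c) \<in> quads T" "(SOME q. q \<in> c') \<in> quads T"
        using c c' by (auto intro: KK_representative)
      have "quad_near T r (SOME q. q \<in> c) (SOME q. q \<in> c')"
        using c'(2) by (intro quad_near_of_dist q T) (simp add: KK_dist_def)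
      from k[OF q _ this] r kr have "f (SOME q. q \<in> c') \<in> ball (f (SOME q. q \<in> c)) e"
        by (simp add: dist_real_def)
      then show "c' \<in> {c \<in> KK T. f (SOME q. q \<in> c) \<in> U}" using c' e by blast
    qed
  qed auto
qed simp

lemma measurable_completion_cong_AE:
  fixes g h :: "'w \<Rightarrow> real"
  assumes h: "h \<in> borel_measurable (completion M)" and ae: "AE \<omega> in M. g \<omega> = h \<omega>"
  shows "g \<in> borel_measurable (completion M)"
proof (rule borel_measurableI_less)
  fix a
  have ae': "AE \<omega> in completion M. g \<omega> = h \<omega>" by (rule AE_completion[OF ae])
  show "{\<omega> \<in> space (completion M). g \<omega> < a} \<in> sets (completion M)"
  proof (rule completion.in_sets_AE)
    show "{\<omega> \<in> space (completion M). h \<omega> < a} \<in> sets (completion M)"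
      using h by measurable
    show "AE \<omega> in completion M. (\<omega> \<in> {\<omega> \<in> space (completion M). h \<omega> < a}) =
        (\<omega> \<in> {\<omega> \<in> space (completion M). g \<omega> < a})"
      using ae' by eventually_elim auto
  qed auto
qed

text \<open>The value of \<open>F\<close> outside the topological space is arbitrary, but it only matters on a null set.\<close>

lemma random_element_borel:
  assumes Y: "random_element M S Y" and F: "continuous_map S euclideanreal F"
  shows "(\<lambda>\<omega>. F (Y \<omega>)) \<in> borel_measurable (completion M)"
proof (rule borel_measurableI_less)
  fix a :: real
  define U where "U = {s \<in> topspace S. F s \<in> {..<a}}"
  have ae: "AE \<omega> in completion M. Y \<omega> \<in> topspace S"
    using Y by (intro AE_completion) (simp add: random_element_def)
  show "{\<omega> \<in> space (completion M). F (Y \<omega>) < a} \<in> sets (completion M)"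
  proof (rule completion.in_sets_AE)
    have "openin S U"
      unfolding U_def by (rule openin_continuous_map_preimage[OF F]) simp
    then show "Y -` U \<inter> space M \<in> sets (completion M)" using Y by (simp add: random_element_def)
    show "AE \<omega> in completion M. (\<omega> \<in> Y -` U \<inter> space M) =
        (\<omega> \<in> {\<omega> \<in> space (completion M). F (Y \<omega>) < a})"
      using ae by eventually_elim (auto simp: U_def)
  qed auto
qed

lemma random_quad_AE:
  assumes "random_element M (KK_topology T) (\<lambda>\<omega>. KK_class T (Q \<omega>))"
  shows "AE \<omega> in M. Q \<omega> \<in> quads T"
  using assms by (simp add: random_element_def topspace_KK_topology KK_class_in_KK_iff)

lemma random_quad_representative_AE:
  assumes "random_element M (KK_topology T) (\<lambda>\<omega>. KK_class T (Q \<omega>))" "quad_lipschitz T f"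
  shows "AE \<omega> in M. f (Q \<omega>) = f (SOME q. q \<in> KK_class T (Q \<omega>))"
  using random_quad_AE[OF assms(1)]
  by eventually_elim (simp add: quad_lipschitz_representative[OF assms(2)])

lemma random_quad_borel:
  assumes "random_element M (KK_topology T) (\<lambda>\<omega>. KK_class T (Q \<omega>))" "quad_lipschitz T f" "0 < T"
  shows "(\<lambda>\<omega>. f (Q \<omega>)) \<in> borel_measurable (completion M)"
  by (rule measurable_completion_cong_AE[OF random_element_borel[OF assms(1) continuous_map_KK[OF assms(2,3)]]
        random_quad_representative_AE[OF assms(1,2)]])

lemma portmanteau_quad:
  assumes conv: "converges_in_distribution (KK_topology T) Mn (\<lambda>n \<omega>. KK_class T (Qn n \<omega>)) M (\<lambda>\<omega>. KK_class T (Q \<omega>))"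
    and Mn: "\<And>n. prob_space (Mn n)" and M: "prob_space M"
    and f: "quad_lipschitz T f" and T: "0 < T" and e: "0 < e"
  shows "\<forall>\<^sub>F n in sequentially. measure (completion (Mn n)) {\<omega>\<in>space (Mn n). 0 \<le> f (Qn n \<omega>)}
    < measure (completion M) {\<omega>\<in>space M. 0 \<le> f (Q \<omega>)} + e"
proof -
  have re: "random_element (Mn n) (KK_topology T) (\<lambda>\<omega>. KK_class T (Qn n \<omega>))"
    "random_element M (KK_topology T) (\<lambda>\<omega>. KK_class T (Q \<omega>))" for n
    using conv by (simp_all add: converges_in_distribution_def)
  let ?F = "\<lambda>c. f (SOME q. q \<in> c)"
  note F = continuous_map_KK[OF f T]
  have eq: "(\<integral>\<omega>. h (f (P \<omega>)) \<partial>completion N) = (\<integral>\<omega>. h (?F (KK_class T (P \<omega>))) \<partial>completion N)"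
    if "random_element N (KK_topology T) (\<lambda>\<omega>. KK_class T (P \<omega>))" "continuous_on UNIV h"
    for N :: "'x measure" and P and h :: "real \<Rightarrow> real"
  proof (rule integral_cong_AE)
    have [measurable]: "h \<in> borel_measurable borel" by (rule borel_measurable_continuous_onI[OF that(2)])
    note random_quad_borel[OF that(1) f T, measurable] random_element_borel[OF that(1) F, measurable]
    show "(\<lambda>\<omega>. h (f (P \<omega>))) \<in> borel_measurable (completion N)"
      "(\<lambda>\<omega>. h (?F (KK_class T (P \<omega>)))) \<in> borel_measurable (completion N)" by measurable
    show "AE \<omega> in completion N. h (f (P \<omega>)) = h (?F (KK_class T (P \<omega>)))"
      using AE_completion[OF random_quad_representative_AE[OF that(1) f]] by eventually_elim simp
  qed
  have "\<forall>\<^sub>F n in sequentially. measure (completion (Mn n)) {\<omega>\<in>space (completion (Mn n)). 0 \<le> f (Qn n \<omega>)}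
    < measure (completion M) {\<omega>\<in>space (completion M). 0 \<le> f (Q \<omega>)} + e"
  proof (rule portmanteau_closed_half_line)
    fix h :: "real \<Rightarrow> real" assume h: "continuous_on UNIV h" "bounded (range h)"
    have c: "continuous_map (KK_topology T) euclideanreal (\<lambda>c. h (?F c))"
      using continuous_map_compose[OF F, of euclideanreal h] h by (simp add: comp_def)
    moreover have "bounded ((\<lambda>c. h (?F c)) ` topspace (KK_topology T))"
      by (rule bounded_subset[OF h(2)]) auto
    ultimately have "(\<lambda>n. \<integral>\<omega>. h (?F (KK_class T (Qn n \<omega>))) \<partial>completion (Mn n))
        \<longlonglongrightarrow> (\<integral>\<omega>. h (?F (KK_class T (Q \<omega>))) \<partial>completion M)"
      using conv unfolding converges_in_distribution_def by blast
    then show "(\<lambda>n. \<integral>\<omega>. h (f (Qn n \<omega>)) \<partial>completion (Mn n)) \<longlonglongrightarrow> (\<integral>\<omega>. h (f (Q \<omega>)) \<partial>completion M)"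
      by (simp add: eq[OF re(1) h(1)] eq[OF re(2) h(1)])
  qed (auto intro: e prob_space.prob_space_completion Mn M random_quad_borel[OF re(1) f T] random_quad_borel[OF re(2) f T])
  then show ?thesis by simp
qed

text \<open>A closed condition that holds almost surely along a subsequence passes to the limit.\<close>

lemma frequently_AE_limit:
  assumes conv: "converges_in_distribution (KK_topology T) Mn (\<lambda>n \<omega>. KK_class T (Qn n \<omega>)) M (\<lambda>\<omega>. KK_class T (Q \<omega>))"
    and Mn: "\<And>n. prob_space (Mn n)" and M: "prob_space M"
    and f: "quad_lipschitz T f" and T: "0 < T"
    and fr: "\<exists>\<^sub>F n in sequentially. AE \<omega> in Mn n. Qn n \<omega> \<in> quads T \<longrightarrow> 0 \<le> f (Qn n \<omega>)"
  shows "AE \<omega> in M. 0 \<le> f (Q \<omega>)"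
proof -
  interpret M': prob_space "completion M" by (rule prob_space.prob_space_completion[OF M])
  have re: "random_element (Mn n) (KK_topology T) (\<lambda>\<omega>. KK_class T (Qn n \<omega>))"
    "random_element M (KK_topology T) (\<lambda>\<omega>. KK_class T (Q \<omega>))" for n
    using conv by (simp_all add: converges_in_distribution_def)
  note random_quad_borel[OF re(2) f T, measurable]
  have ge: "1 - e \<le> M'.prob {\<omega>\<in>space M. 0 \<le> f (Q \<omega>)}" if "0 < e" for e
  proof -
    from frequently_eventually_frequently[OF fr portmanteau_quad[OF conv Mn M f T that]]
    obtain n where ae: "AE \<omega> in Mn n. Qn n \<omega> \<in> quads T \<longrightarrow> 0 \<le> f (Qn n \<omega>)"
      and lt: "measure (completion (Mn n)) {\<omega>\<in>space (Mn n). 0 \<le> f (Qn n \<omega>)}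
        < M'.prob {\<omega>\<in>space M. 0 \<le> f (Q \<omega>)} + e"
      by (auto dest: frequently_ex)
    interpret N: prob_space "completion (Mn n)" by (rule prob_space.prob_space_completion[OF Mn])
    note random_quad_borel[OF re(1) f T, measurable]
    have "AE \<omega> in completion (Mn n). 0 \<le> f (Qn n \<omega>)"
      using AE_completion[OF ae] AE_completion[OF random_quad_AE[OF re(1)]] by eventually_elim simp
    moreover have "{\<omega>\<in>space (completion (Mn n)). 0 \<le> f (Qn n \<omega>)} \<in> N.events" by measurable
    ultimately have "N.prob {\<omega>\<in>space (completion (Mn n)). 0 \<le> f (Qn n \<omega>)} = 1"
      by (subst N.prob_Collect_eq_1)
    then show ?thesis using lt by simp
  qed
  have "1 \<le> M'.prob {\<omega>\<in>space (completion M). 0 \<le> f (Q \<omega>)}"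
    by (rule field_le_epsilon) (use ge in \<open>force simp: algebra_simps\<close>)
  then have "M'.prob {\<omega>\<in>space (completion M). 0 \<le> f (Q \<omega>)} = 1" using M'.prob_le_1 antisym by blast
  moreover have "{\<omega>\<in>space (completion M). 0 \<le> f (Q \<omega>)} \<in> M'.events" by measurable
  ultimately have "AE \<omega> in completion M. 0 \<le> f (Q \<omega>)" by (simp only: M'.prob_Collect_eq_1)
  then show ?thesis by (simp add: AE_completion_iff)
qed


section \<open>The functionals of local times and paths\<close>

text \<open>The largest amount by which the infimum of the local times exceeds \<open>\<epsilon> * s\<close> at a time \<open>s\<close> in
  \<open>{a..b}\<close>. For \<open>0 < a\<close> it is nonnegative if and only if the blanket condition holds at some such \<open>s\<close>.\<close>

definition excess :: "real \<Rightarrow> real \<Rightarrow> real \<Rightarrow> 'a quad \<Rightarrow> real" where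
  "excess a b \<epsilon> q = (SUP s\<in>{a..b}. (INF x\<in>mspace (qspace q). qloc q s x) - \<epsilon> * s)"

text \<open>The supremum over space of a function of the distance to the root and of the local time at time \<open>u\<close>.
  Three instances occur: the radius around the root, the maximal local time, and the supremum of the
  minimum of the two, which vanishes if and only if the local time at \<open>u\<close> vanishes off the root.\<close>

definition root_local :: "(real \<Rightarrow> real \<Rightarrow> real) \<Rightarrow> real \<Rightarrow> 'a quad \<Rightarrow> real" where
  "root_local h u q = (SUP x\<in>mspace (qspace q). h (mdist (qspace q) (qroot q) x) (qloc q u x))"

text \<open>How far the path gets from the root, penalised by elapsed time. The penalty, rather than a
  supremum over a short time interval, makes the functional continuous for the Skorokhod metric.\<close>

definition wander :: "real \<Rightarrow> real \<Rightarrow> 'a quad \<Rightarrow> real" where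
  "wander T c q = (SUP s\<in>{0..T}. mdist (qspace q) (qroot q) (qpath q s) - c * s)"

lemma qloc_bdd_below:
  assumes "q \<in> quads T" "s \<in> {0..T}"
  shows "bdd_below (qloc q s ` mspace (qspace q))"
  using assms by (intro bdd_belowI2[of _ 0]) (auto simp: quads_def)

lemma excess_bdd_above:
  assumes q: "q \<in> quads T" and "0 \<le> a" "b \<le> T"
  shows "bdd_above ((\<lambda>s. (INF x\<in>mspace (qspace q). qloc q s x) - \<epsilon> * s) ` {a..b})"
proof -
  obtain B where B: "\<And>t x. t \<in> {0..T} \<Longrightarrow> x \<in> mspace (qspace q) \<Longrightarrow> 0 \<le> qloc q t x \<and> qloc q t x \<le> B"
    using quads_qloc_bound[OF q] by metis
  obtain x0 where x0: "x0 \<in> mspace (qspace q)" using quads_nonempty[OF q] by blast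
  have "(INF x\<in>mspace (qspace q). qloc q s x) - \<epsilon> * s \<le> B + \<bar>\<epsilon>\<bar> * T" if s: "s \<in> {a..b}" for s
  proof -
    have s': "s \<in> {0..T}" using s assms by auto
    have "(INF x\<in>mspace (qspace q). qloc q s x) \<le> qloc q s x0"
      by (rule cINF_lower[OF qloc_bdd_below[OF q s'] x0])
    moreover have "qloc q s x0 \<le> B" using B s' x0 by blast
    moreover have "- (\<epsilon> * s) \<le> \<bar>\<epsilon> * s\<bar>" by simp
    moreover have "\<bar>\<epsilon> * s\<bar> \<le> \<bar>\<epsilon>\<bar> * T"
      using s' by (simp add: abs_mult mult_left_mono)
    ultimately show ?thesis by linarith
  qed
  then show ?thesis by (intro bdd_aboveI2) auto
qed

lemma le_excess:
  assumes q: "q \<in> quads T" and ab: "0 \<le> a" "b \<le> T" and s: "s \<in> {a..b}"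
    and le: "\<And>x. x \<in> mspace (qspace q) \<Longrightarrow> v + \<epsilon> * s \<le> qloc q s x"
  shows "v \<le> excess a b \<epsilon> q"
proof -
  have "v + \<epsilon> * s \<le> (INF x\<in>mspace (qspace q). qloc q s x)"
    by (rule cINF_greatest[OF quads_nonempty[OF q] le])
  moreover have "(INF x\<in>mspace (qspace q). qloc q s x) - \<epsilon> * s \<le> excess a b \<epsilon> q"
    unfolding excess_def by (rule cSUP_upper[OF s excess_bdd_above[OF q ab]])
  ultimately show ?thesis by linarith
qed

lemma less_excess:
  assumes q: "q \<in> quads T" and ab: "0 \<le> a" "a \<le> b" "b \<le> T" and lt: "v < excess a b \<epsilon> q"
  obtains s where "s \<in> {a..b}" "\<And>x. x \<in> mspace (qspace q) \<Longrightarrow> v + \<epsilon> * s < qloc q s x"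
proof -
  have "{a..b} \<noteq> {}" using ab by simp
  from less_cSUP_iff[OF this excess_bdd_above[OF q ab(1,3)], THEN iffD1, OF lt[unfolded excess_def]]
  obtain s where s: "s \<in> {a..b}" "v < (INF x\<in>mspace (qspace q). qloc q s x) - \<epsilon> * s" by blast
  have s': "s \<in> {0..T}" using s ab by auto
  show thesis
  proof
    show "s \<in> {a..b}" by fact
    fix x assume "x \<in> mspace (qspace q)"
    then have "(INF x\<in>mspace (qspace q). qloc q s x) \<le> qloc q s x"
      by (intro cINF_lower qloc_bdd_below[OF q s'])
    then show "v + \<epsilon> * s < qloc q s x" using s by linarith
  qed
qed

lemma quads_qloc_continuous_time:
  assumes q: "q \<in> quads T" and x: "x \<in> mspace (qspace q)"
  shows "continuous_on {0..T} (\<lambda>t. qloc q t x)"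
proof -
  have "continuous_map (top_of_set {0..T}) (prod_topology (top_of_set {0..T}) (mtopology_of (qspace q))) (\<lambda>t. (t, x))"
    using x by (intro continuous_map_pairedI) auto
  moreover have "continuous_map (prod_topology (top_of_set {0..T}) (mtopology_of (qspace q))) euclideanreal
       (\<lambda>(t, x). qloc q t x)" using q by (simp add: quads_def)
  ultimately have "continuous_map (top_of_set {0..T}) euclideanreal ((\<lambda>(t, x). qloc q t x) \<circ> (\<lambda>t. (t, x)))"
    by (rule continuous_map_compose)
  then show ?thesis by (simp add: comp_def)
qed

text \<open>The times that almost achieve the supremum accumulate at some time \<open>l\<close>, and continuity of the local
  time in \<open>t\<close> at each point separately is enough to pass to the limit.\<close>

lemma excess_nonneg_attained:
  assumes q: "q \<in> quads T" and ab: "0 \<le> a" "a \<le> b" "b \<le> T" and ge: "0 \<le> excess a b \<epsilon> q"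
  obtains s where "s \<in> {a..b}" "\<And>x. x \<in> mspace (qspace q) \<Longrightarrow> \<epsilon> * s \<le> qloc q s x"
proof -
  have "\<exists>s. s \<in> {a..b} \<and> (\<forall>x\<in>mspace (qspace q). - 1 / real (Suc j) + \<epsilon> * s < qloc q s x)" for j
  proof -
    have "- 1 / real (Suc j) < excess a b \<epsilon> q" by (rule less_le_trans[OF _ ge]) simp
    then show ?thesis by (rule less_excess[OF q ab]) blast
  qed
  then obtain s where s: "\<And>j. s j \<in> {a..b}"
    "\<And>j x. x \<in> mspace (qspace q) \<Longrightarrow> - 1 / real (Suc j) + \<epsilon> * s j < qloc q (s j) x" by metis
  have "compact {a..b}" by simp
  then obtain l r where l: "l \<in> {a..b}" "strict_mono r" "(s \<circ> r) \<longlonglongrightarrow> l"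
    using s(1) unfolding compact_def by metis
  show thesis
  proof
    show "l \<in> {a..b}" by fact
    fix x assume x: "x \<in> mspace (qspace q)"
    have "(s \<circ> r) j \<in> {0..T}" "l \<in> {0..T}" for j using s(1)[of "r j"] l(1) ab by auto
    then have "(\<lambda>j. qloc q ((s \<circ> r) j) x) \<longlonglongrightarrow> qloc q l x"
      by (intro continuous_on_tendsto_compose[OF quads_qloc_continuous_time[OF q x] l(3)] always_eventually allI)
    moreover have "(\<lambda>j. - 1 / real (Suc (r j)) + \<epsilon> * (s \<circ> r) j) \<longlonglongrightarrow> 0 + \<epsilon> * l"
    proof (intro tendsto_add tendsto_mult tendsto_const l(3))
      have "(\<lambda>j. - 1 / real (Suc j)) \<longlonglongrightarrow> 0"
        using tendsto_minus[OF LIMSEQ_inverse_real_of_nat] by (simp add: field_simps)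
      from LIMSEQ_subseq_LIMSEQ[OF this l(2)] show "(\<lambda>j. - 1 / real (Suc (r j))) \<longlonglongrightarrow> 0" by (simp add: comp_def)
    qed
    ultimately show "\<epsilon> * l \<le> qloc q l x"
      using s(2)[OF x] by (intro LIMSEQ_le[of _ "\<epsilon> * l"]) (auto intro!: exI[of _ 0] less_imp_le)
  qed
qed

lemma quad_lipschitz_excess:
  assumes ab: "0 \<le> a" "a \<le> b" "b \<le> T"
  shows "quad_lipschitz T (excess a b \<epsilon>)"
proof (rule quad_lipschitzI[where c = 1])
  fix q q' :: "'a quad" and r :: real
  assume q: "q \<in> quads T" "q' \<in> quads T" and r: "0 \<le> r" and near: "quad_near T r q q'"
  let ?K = "mspace (qspace q)" and ?K' = "mspace (qspace q')"
  obtain C where C: "correspondence ?K ?K' C"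
    and L: "\<And>x x' t. (x, x') \<in> C \<Longrightarrow> t \<in> {0..T} \<Longrightarrow> \<bar>qloc q t x - qloc q' t x'\<bar> \<le> r"
    using near unfolding quad_near_def by blast
  have inf: "\<bar>(INF x\<in>?K. qloc q s x) - (INF x\<in>?K'. qloc q' s x)\<bar> \<le> r" if s: "s \<in> {0..T}" for s
  proof (intro abs_INF_diff_le quads_nonempty[OF q(1)] quads_nonempty[OF q(2)] qloc_bdd_below[OF q(1) s] qloc_bdd_below[OF q(2) s])
    fix x assume "x \<in> ?K"
    then obtain y where "(x, y) \<in> C" using C by (force simp: correspondence_def)
    then show "\<exists>y\<in>?K'. \<bar>qloc q s x - qloc q' s y\<bar> \<le> r"
      using L[OF _ s] C by (force simp: correspondence_def)
  next
    fix y assume "y \<in> ?K'"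
    then obtain x where "(x, y) \<in> C" using C by (force simp: correspondence_def)
    then show "\<exists>x\<in>?K. \<bar>qloc q s x - qloc q' s y\<bar> \<le> r"
      using L[OF _ s] C by (force simp: correspondence_def)
  qed
  have "\<bar>excess a b \<epsilon> q - excess a b \<epsilon> q'\<bar> \<le> r"
    unfolding excess_def
  proof (intro abs_SUP_diff_le excess_bdd_above[OF q(1) ab(1,3)] excess_bdd_above[OF q(2) ab(1,3)])
    fix s assume s: "s \<in> {a..b}"
    then have "s \<in> {0..T}" using ab by auto
    from inf[OF this] s show
      "\<exists>y\<in>{a..b}. \<bar>(INF x\<in>?K. qloc q s x) - \<epsilon> * s - ((INF x\<in>?K'. qloc q' y x) - \<epsilon> * y)\<bar> \<le> r"
      "\<exists>x\<in>{a..b}. \<bar>(INF y\<in>?K. qloc q x y) - \<epsilon> * x - ((INF x\<in>?K'. qloc q' s x) - \<epsilon> * s)\<bar> \<le> r"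
      by (auto intro!: bexI[of _ s])
  qed (use ab in auto)
  then show "\<bar>excess a b \<epsilon> q - excess a b \<epsilon> q'\<bar> \<le> 1 * r" by simp
qed

lemma root_local_bdd_above:
  assumes q: "q \<in> quads T" and u: "u \<in> {0..T}"
    and h: "\<And>a b a' b'. \<bar>h a b - h a' b'\<bar> \<le> \<bar>a - a'\<bar> + \<bar>b - b'\<bar>"
  shows "bdd_above ((\<lambda>x. h (mdist (qspace q) (qroot q) x) (qloc q u x)) ` mspace (qspace q))"
proof -
  obtain B where B: "\<And>t x. t \<in> {0..T} \<Longrightarrow> x \<in> mspace (qspace q) \<Longrightarrow> 0 \<le> qloc q t x \<and> qloc q t x \<le> B"
    using quads_qloc_bound[OF q] by metis
  obtain D where D: "\<And>x y. x \<in> mspace (qspace q) \<Longrightarrow> y \<in> mspace (qspace q) \<Longrightarrow> mdist (qspace q) x y \<le> D"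
    using quads_diameter_bound[OF q] by metis
  interpret Metric_space "mspace (qspace q)" "mdist (qspace q)" by simp
  have r: "qroot q \<in> mspace (qspace q)" using q by (simp add: quads_def)
  have "h (mdist (qspace q) (qroot q) x) (qloc q u x) \<le> h 0 0 + D + B" if "x \<in> mspace (qspace q)" for x
    using h[of "mdist (qspace q) (qroot q) x" "qloc q u x" 0 0] B[OF u that] D[OF r that]
      nonneg[of "qroot q" x] by linarith
  then show ?thesis by (intro bdd_aboveI2) auto
qed

lemma quad_lipschitz_root_local:
  assumes u: "u \<in> {0..T}"
    and h: "\<And>a b a' b'. \<bar>h a b - h a' b'\<bar> \<le> \<bar>a - a'\<bar> + \<bar>b - b'\<bar>"
  shows "quad_lipschitz T (root_local h u)"
proof (rule quad_lipschitzI[where c = 3])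
  fix q q' :: "'a quad" and r :: real
  assume q: "q \<in> quads T" "q' \<in> quads T" and r: "0 \<le> r" and near: "quad_near T r q q'"
  let ?K = "mspace (qspace q)" and ?K' = "mspace (qspace q')"
  let ?f = "\<lambda>x. h (mdist (qspace q) (qroot q) x) (qloc q u x)"
  let ?g = "\<lambda>x. h (mdist (qspace q') (qroot q') x) (qloc q' u x)"
  obtain C where C: "correspondence ?K ?K' C"
    and L: "\<And>x x'. (x, x') \<in> C \<Longrightarrow> \<bar>mdist (qspace q) (qroot q) x - mdist (qspace q') (qroot q') x'\<bar> \<le> 2 * r
      \<and> \<bar>qloc q u x - qloc q' u x'\<bar> \<le> r"
    using near u unfolding quad_near_def by blast
  have d: "\<bar>?f x - ?g y\<bar> \<le> 3 * r" if "(x, y) \<in> C" for x y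
    using L[OF that] h[of "mdist (qspace q) (qroot q) x" "qloc q u x" "mdist (qspace q') (qroot q') y" "qloc q' u y"]
    by linarith
  show "\<bar>root_local h u q - root_local h u q'\<bar> \<le> 3 * r"
    unfolding root_local_def
  proof (intro abs_SUP_diff_le quads_nonempty[OF q(1)] quads_nonempty[OF q(2)]
      root_local_bdd_above[OF q(1) u h] root_local_bdd_above[OF q(2) u h])
    fix x assume "x \<in> ?K"
    then obtain y where "(x, y) \<in> C" using C by (force simp: correspondence_def)
    then show "\<exists>y\<in>?K'. \<bar>?f x - ?g y\<bar> \<le> 3 * r" using d[of x y] C by (force simp: correspondence_def)
  next
    fix y assume "y \<in> ?K'"
    then obtain x where "(x, y) \<in> C" using C by (force simp: correspondence_def)
    then show "\<exists>x\<in>?K. \<bar>?f x - ?g y\<bar> \<le> 3 * r" using d[of x y] C by (force simp: correspondence_def)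
  qed
qed

lemma wander_bdd_above:
  assumes q: "q \<in> quads T" and c: "0 \<le> c"
  shows "bdd_above ((\<lambda>s. mdist (qspace q) (qroot q) (qpath q s) - c * s) ` {0..T})"
proof -
  obtain D where D: "\<And>x y. x \<in> mspace (qspace q) \<Longrightarrow> y \<in> mspace (qspace q) \<Longrightarrow> mdist (qspace q) x y \<le> D"
    using quads_diameter_bound[OF q] by metis
  have r: "qroot q \<in> mspace (qspace q)" "\<And>s. s \<in> {0..T} \<Longrightarrow> qpath q s \<in> mspace (qspace q)"
    using q by (auto simp: quads_def cadlag_on_def)
  have "mdist (qspace q) (qroot q) (qpath q s) - c * s \<le> D" if "s \<in> {0..T}" for s
  proof -
    have "0 \<le> c * s" using c that by simp
    then show ?thesis using D[OF r(1) r(2)[OF that]] by linarith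
  qed
  then show ?thesis by (intro bdd_aboveI2) auto
qed

lemma quad_lipschitz_wander:
  assumes T: "0 < T" and c: "0 \<le> c"
  shows "quad_lipschitz T (wander T c)"
proof (rule quad_lipschitzI[where c = "2 + c"])
  fix q q' :: "'a quad" and r :: real
  assume q: "q \<in> quads T" "q' \<in> quads T" and r: "0 \<le> r" and near: "quad_near T r q q'"
  let ?f = "\<lambda>s. mdist (qspace q) (qroot q) (qpath q s) - c * s"
  let ?g = "\<lambda>s. mdist (qspace q') (qroot q') (qpath q' s) - c * s"
  obtain \<kappa> where \<kappa>: "increasing_homeo T \<kappa>" and d: "\<And>t. t \<in> {0..T} \<Longrightarrow> \<bar>\<kappa> t - t\<bar> \<le> r"
      "\<And>t. t \<in> {0..T} \<Longrightarrow> \<bar>mdist (qspace q) (qroot q) (qpath q (\<kappa> t)) - mdist (qspace q') (qroot q') (qpath q' t)\<bar> \<le> 2 * r"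
    using near unfolding quad_near_def by blast
  note bij = increasing_homeo_bij[OF \<kappa>]
  have e: "\<bar>?f (\<kappa> t) - ?g t\<bar> \<le> (2 + c) * r" if "t \<in> {0..T}" for t
  proof -
    have "\<bar>c * \<kappa> t - c * t\<bar> = c * \<bar>\<kappa> t - t\<bar>" using c by (simp add: abs_mult flip: right_diff_distrib)
    also have "\<dots> \<le> c * r" by (rule mult_left_mono[OF d(1)[OF that] c])
    finally show ?thesis using d(2)[OF that] by (simp add: distrib_right)
  qed
  show "\<bar>wander T c q - wander T c q'\<bar> \<le> (2 + c) * r"
    unfolding wander_def
  proof (intro abs_SUP_diff_le wander_bdd_above q c)
    fix s assume "s \<in> {0..T}"
    then obtain t where "t \<in> {0..T}" "s = \<kappa> t" using bij by blast
    then show "\<exists>t\<in>{0..T}. \<bar>?f s - ?g t\<bar> \<le> (2 + c) * r" using e by blast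
  next
    fix t assume "t \<in> {0..T}"
    then show "\<exists>s\<in>{0..T}. \<bar>?f s - ?g t\<bar> \<le> (2 + c) * r" using e[of t] bij by blast
  qed (use T in auto)
qed


section \<open>Local times and blanket times of random walks\<close>

lemma walk_in_verts:
  assumes "random_walk G r M Y" "\<omega> \<in> space M"
  shows "Y i \<omega> \<in> verts G"
proof -
  have "Y i \<in> M \<rightarrow>\<^sub>M count_space (verts G)" using assms(1) by (simp add: random_walk_def)
  from measurable_space[OF this assms(2)] show ?thesis by simp
qed

text \<open>Connectedness provides an edge at \<open>x\<close> as soon as there is a second vertex.\<close>

lemma vwt_pos:
  assumes G: "weighted_graph G" and c: "2 \<le> card (verts G)" and x: "x \<in> verts G"
  shows "0 < vwt G x"
proof -
  have fin: "finite (verts G)" using G by (simp add: weighted_graph_def)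
  have "verts G \<noteq> {x}" using c by auto
  then obtain y where y: "y \<in> verts G" "y \<noteq> x" using x by blast
  then have "(x, y) \<in> {(u, v). {u, v} \<in> edges G}\<^sup>*" using G x by (auto simp: weighted_graph_def)
  then obtain z where z: "{x, z} \<in> edges G" using y(2) by (cases rule: converse_rtranclE) auto
  have "edges G \<subseteq> {{x, y} | x y. x \<in> verts G \<and> y \<in> verts G}" using G by (simp add: weighted_graph_def)
  then have zv: "z \<in> verts G" using z by (auto simp: doubleton_eq_iff)
  have "0 < wt G x z" using G x zv z by (auto simp: weighted_graph_def)
  also have "wt G x z \<le> vwt G x"
    unfolding vwt_def using G x zv by (intro member_le_sum fin) (auto simp: weighted_graph_def)
  finally show ?thesis .
qed

lemma vwt_nonneg: "weighted_graph G \<Longrightarrow> x \<in> verts G \<Longrightarrow> 0 \<le> vwt G x"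
  unfolding vwt_def by (intro sum_nonneg) (auto simp: weighted_graph_def)

lemma walk_local_time_Suc_le:
  assumes "weighted_graph G" "x \<in> verts G"
  shows "walk_local_time G Y k x \<omega> \<le> walk_local_time G Y (Suc k) x \<omega>"
  unfolding walk_local_time_def using vwt_nonneg[OF assms]
  by (intro divide_right_mono) auto

lemma walk_local_time_lin_nat: "walk_local_time_lin G Y (real k) x \<omega> = walk_local_time G Y k x \<omega>"
  by (simp add: walk_local_time_lin_def)

text \<open>Rounding a time up to an integer only increases the local times.\<close>

lemma walk_local_time_lin_le_ceiling:
  assumes G: "weighted_graph G" "x \<in> verts G" and t: "0 \<le> t"
  shows "walk_local_time_lin G Y t x \<omega> \<le> walk_local_time G Y (nat \<lceil>t\<rceil>) x \<omega>"
proof -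
  define k where "k = nat \<lfloor>t\<rfloor>"
  have k: "real k \<le> t" "t < real k + 1" using t by (auto simp: k_def; linarith)+
  let ?L = "\<lambda>k. walk_local_time G Y k x \<omega>"
  have e: "walk_local_time_lin G Y t x \<omega> = ?L k + (t - real k) * (?L (Suc k) - ?L k)"
    by (simp add: walk_local_time_lin_def k_def Let_def)
  show ?thesis
  proof (cases "t = real k")
    case True then show ?thesis by (simp add: walk_local_time_lin_nat)
  next
    case False
    then have "\<lceil>t\<rceil> = int k + 1" using k by (intro ceiling_unique) auto
    then have c: "nat \<lceil>t\<rceil> = Suc k" by simp
    have "(t - real k) * (?L (Suc k) - ?L k) \<le> 1 * (?L (Suc k) - ?L k)"
      using walk_local_time_Suc_le[OF G] k by (intro mult_right_mono) (auto simp: diff_le_eq)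
    then show ?thesis unfolding e c by simp
  qed
qed

lemma sum_walk_local_time:
  assumes G: "weighted_graph G" "2 \<le> card (verts G)" and Y: "random_walk G r M Y" and \<omega>: "\<omega> \<in> space M"
  shows "(\<Sum>x\<in>verts G. vwt G x * walk_local_time G Y k x \<omega>) = real k"
proof -
  have fin: "finite (verts G)" using G by (simp add: weighted_graph_def)
  have "(\<Sum>x\<in>verts G. vwt G x * walk_local_time G Y k x \<omega>) = (\<Sum>x\<in>verts G. \<Sum>i<k. indicator {x} (Y i \<omega>))"
    using vwt_pos[OF G] by (intro sum.cong) (force simp: walk_local_time_def)+
  also have "\<dots> = (\<Sum>i<k. \<Sum>x\<in>verts G. indicator {x} (Y i \<omega>))" by (rule sum.swap)
  also have "\<dots> = (\<Sum>i<k. 1)"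
  proof (rule sum.cong[OF refl])
    fix i
    have "(\<Sum>x\<in>verts G. indicator {x} (Y i \<omega>) :: real) = (\<Sum>x\<in>verts G. if Y i \<omega> = x then 1 else 0)"
      by (intro sum.cong) (auto simp: indicator_def)
    also have "\<dots> = 1" using walk_in_verts[OF Y \<omega>] fin by simp
    finally show "(\<Sum>x\<in>verts G. indicator {x} (Y i \<omega>) :: real) = 1" .
  qed
  finally show ?thesis by simp
qed

lemma sum_walk_local_time_lin:
  assumes G: "weighted_graph G" "2 \<le> card (verts G)" and Y: "random_walk G r M Y" and \<omega>: "\<omega> \<in> space M" and t: "0 \<le> t"
  shows "(\<Sum>x\<in>verts G. vwt G x * walk_local_time_lin G Y t x \<omega>) = t"
proof -
  let ?S = "\<lambda>k. \<Sum>x\<in>verts G. vwt G x * walk_local_time G Y k x \<omega>"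
  define k where "k = nat \<lfloor>t\<rfloor>"
  have "(\<Sum>x\<in>verts G. vwt G x * walk_local_time_lin G Y t x \<omega>) = ?S k + (t - real k) * (?S (Suc k) - ?S k)"
    by (simp add: walk_local_time_lin_def k_def[symmetric] Let_def algebra_simps sum.distrib sum_subtractf sum_distrib_left)
  then show ?thesis unfolding sum_walk_local_time[OF G Y \<omega>] by simp
qed

lemma walk_local_time_pos_iff:
  assumes "0 < vwt G x"
  shows "0 < walk_local_time G Y k x \<omega> \<longleftrightarrow> (\<exists>i<k. Y i \<omega> = x)"
proof -
  have "0 < walk_local_time G Y k x \<omega> \<longleftrightarrow> 0 < (\<Sum>i<k. indicator {x} (Y i \<omega>) :: real)"
    using assms by (simp add: walk_local_time_def zero_less_divide_iff)
  also have "\<dots> \<longleftrightarrow> (\<exists>i<k. Y i \<omega> = x)"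
  proof
    assume "0 < (\<Sum>i<k. indicator {x} (Y i \<omega>) :: real)"
    then have "\<not> (\<forall>i<k. indicator {x} (Y i \<omega>) = (0::real))" using sum.neutral by force
    then show "\<exists>i<k. Y i \<omega> = x" by (auto simp: indicator_def)
  next
    assume "\<exists>i<k. Y i \<omega> = x"
    then obtain i where i: "i < k" "Y i \<omega> = x" by blast
    then have "(1::real) \<le> indicator {x} (Y i \<omega>)" by simp
    also have "\<dots> \<le> (\<Sum>i<k. indicator {x} (Y i \<omega>))" using i by (intro member_le_sum) auto
    finally show "0 < (\<Sum>i<k. indicator {x} (Y i \<omega>) :: real)" by simp
  qed
  finally show ?thesis .
qed

lemma walk_blanket_time_measurable:
  assumes G: "weighted_graph G" and Y: "random_walk G r M Y"
  shows "walk_blanket_time G Y \<epsilon> \<in> borel_measurable M"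
proof -
  have fin: "finite (verts G)" using G by (simp add: weighted_graph_def)
  have Yi: "Y i \<in> M \<rightarrow>\<^sub>M count_space (verts G)" for i using Y by (simp add: random_walk_def)
  have L [measurable]: "(\<lambda>\<omega>. walk_local_time G Y t x \<omega>) \<in> borel_measurable M" if "x \<in> verts G" for t x
    unfolding walk_local_time_def
  proof (intro borel_measurable_divide borel_measurable_sum borel_measurable_const)
    fix i
    have "(\<lambda>y. indicator {x} y :: real) \<in> borel_measurable (count_space (verts G))" by simp
    from measurable_compose[OF Yi this] show "(\<lambda>\<omega>. indicator {x} (Y i \<omega>) :: real) \<in> borel_measurable M" .
  qed
  define A where "A t = {\<omega>\<in>space M. \<forall>x\<in>verts G. \<epsilon> * real t \<le> mass G * walk_local_time G Y t x \<omega>}" for t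
  have [measurable]: "A t \<in> sets M" for t
    unfolding A_def using fin by measurable
  show ?thesis
  proof (rule borel_measurableI_less)
    fix a :: ereal
    have "{\<omega>\<in>space M. walk_blanket_time G Y \<epsilon> \<omega> < a} = (\<Union>t\<in>{t. 1 \<le> t \<and> ereal (real t) < a}. A t)"
      by (auto simp: walk_blanket_time_def Inf_less_iff A_def)
    also have "\<dots> \<in> sets M" by auto
    finally show "{\<omega>\<in>space M. walk_blanket_time G Y \<epsilon> \<omega> < a} \<in> sets M" .
  qed
qed

lemma walk_blanket_time_nonneg: "0 \<le> walk_blanket_time G Y \<epsilon> \<omega>"
  unfolding walk_blanket_time_def by (intro Inf_greatest) auto

text \<open>The infimum over a set of natural numbers is attained if it is finite.\<close>

lemma walk_blanket_time_attained:
  assumes "walk_blanket_time G Y \<epsilon> \<omega> \<le> ereal t"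
  obtains k where "1 \<le> k" "real k \<le> t" "\<And>x. x \<in> verts G \<Longrightarrow> \<epsilon> * real k \<le> mass G * walk_local_time G Y k x \<omega>"
proof -
  define A where "A k \<longleftrightarrow> 1 \<le> k \<and> (\<forall>x\<in>verts G. mass G * walk_local_time G Y k x \<omega> \<ge> \<epsilon> * real k)" for k
  have bt: "walk_blanket_time G Y \<epsilon> \<omega> = Inf {ereal (real k) | k. A k}"
    by (simp only: walk_blanket_time_def A_def)
  have ex: "\<exists>k. A k"
  proof (rule ccontr)
    assume "\<nexists>k. A k"
    then have "walk_blanket_time G Y \<epsilon> \<omega> = Inf {}" unfolding bt by simp
    then show False using assms by (simp add: top_ereal_def)
  qed
  define k where "k = (LEAST k. A k)"
  have k: "A k" unfolding k_def by (rule LeastI_ex[OF ex])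
  have "ereal (real k) \<le> walk_blanket_time G Y \<epsilon> \<omega>"
    unfolding bt
  proof (rule Inf_greatest)
    fix v assume "v \<in> {ereal (real k) | k. A k}"
    then obtain j where "A j" "v = ereal (real j)" by blast
    then show "ereal (real k) \<le> v" unfolding k_def by (simp add: Least_le)
  qed
  then have "ereal (real k) \<le> ereal t" using assms order_trans by blast
  then have "real k \<le> t" by simp
  then show thesis using k that unfolding A_def by blast
qed

lemma walk_blanket_time_le:
  assumes "1 \<le> k" "\<And>x. x \<in> verts G \<Longrightarrow> \<epsilon> * real k \<le> mass G * walk_local_time G Y k x \<omega>"
  shows "walk_blanket_time G Y \<epsilon> \<omega> \<le> ereal (real k)"
  unfolding walk_blanket_time_def using assms by (intro Inf_lower) blast


section \<open>The rescaled random walk\<close>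

context
  fixes G :: "'a wgraph" and d :: "'a metric" and r :: 'a and M :: "'v measure" and Y :: "nat \<Rightarrow> 'v \<Rightarrow> 'a"
    and \<alpha> \<beta> :: real
  assumes G: "weighted_graph G" and card: "2 \<le> card (verts G)" and d: "mspace d = verts G"
    and r: "r \<in> verts G" and Y: "random_walk G r M Y"
    and \<alpha>: "0 < \<alpha>" and \<beta>: "0 < \<beta>" and \<alpha>\<beta>: "\<alpha> * \<beta> = mass G"
begin

lemma walk_quad_simps [simp]:
  "mspace (qspace (walk_quad G d r Y \<alpha> \<beta> \<omega>)) = verts G"
  "mdist (qspace (walk_quad G d r Y \<alpha> \<beta> \<omega>)) = (\<lambda>x y. \<alpha> * mdist d x y)"
  "qroot (walk_quad G d r Y \<alpha> \<beta> \<omega>) = r"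
  "qpath (walk_quad G d r Y \<alpha> \<beta> \<omega>) t = Y (nat \<lfloor>\<beta> * t\<rfloor>) \<omega>"
  "qloc (walk_quad G d r Y \<alpha> \<beta> \<omega>) t x = \<alpha> * walk_local_time_lin G Y (\<beta> * t) x \<omega>"
  using mspace_mdist_scale_metric[OF \<alpha>, of d] by (simp_all add: walk_quad_def d)

lemma mass_pos: "0 < mass G" using \<alpha>\<beta> \<alpha> \<beta> by (metis mult_pos_pos)

lemma rescaled_le_iff:
  "walk_blanket_time G Y \<epsilon> \<omega> / ereal \<beta> \<le> ereal t \<longleftrightarrow> walk_blanket_time G Y \<epsilon> \<omega> \<le> ereal (\<beta> * t)"
  using \<beta> by (cases "walk_blanket_time G Y \<epsilon> \<omega>") (auto simp: pos_divide_le_eq mult.commute)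

text \<open>If the rescaled blanket time is below \<open>\<delta>\<close>, the walk reaches every vertex \<open>x\<close> at some time
  \<open>s < \<delta>\<close>, so that \<open>wander\<close> is at least the distance of \<open>x\<close> from the root minus \<open>c * \<delta>\<close>.\<close>

lemma blanket_early_or_excess:
  assumes q: "walk_quad G d r Y \<alpha> \<beta> \<omega> \<in> quads T" and \<delta>: "0 < \<delta>" "\<delta> \<le> t" "t \<le> T" and c: "0 \<le> c" and \<epsilon>: "0 < \<epsilon>"
    and le: "walk_blanket_time G Y \<epsilon> \<omega> / ereal \<beta> \<le> ereal t"
  shows "0 \<le> excess \<delta> t \<epsilon> (walk_quad G d r Y \<alpha> \<beta> \<omega>) \<or>
    0 \<le> wander T c (walk_quad G d r Y \<alpha> \<beta> \<omega>) - (root_local (\<lambda>a b. a) 0 (walk_quad G d r Y \<alpha> \<beta> \<omega>) - c * \<delta>)"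
proof -
  let ?q = "walk_quad G d r Y \<alpha> \<beta> \<omega>"
  obtain k where k: "1 \<le> k" "real k \<le> \<beta> * t"
    and L: "\<And>x. x \<in> verts G \<Longrightarrow> \<epsilon> * real k \<le> mass G * walk_local_time G Y k x \<omega>"
    using le walk_blanket_time_attained unfolding rescaled_le_iff by metis
  show ?thesis
  proof (cases "\<delta> \<le> real k / \<beta>")
    case True
    have "0 \<le> excess \<delta> t \<epsilon> ?q"
    proof (rule le_excess[OF q, where s = "real k / \<beta>"])
      show "real k / \<beta> \<in> {\<delta>..t}" using True k(2) \<beta> by (simp add: pos_divide_le_eq mult.commute)
      fix x assume "x \<in> mspace (qspace ?q)"
      then have "\<epsilon> * real k \<le> mass G * walk_local_time G Y k x \<omega>" using L by simp
      then show "0 + \<epsilon> * (real k / \<beta>) \<le> qloc ?q (real k / \<beta>) x"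
        using \<beta> by (simp add: walk_local_time_lin_nat \<alpha>\<beta>[symmetric] pos_divide_le_eq mult_ac)
    qed (use \<delta> in auto)
    then show ?thesis ..
  next
    case False
    have "root_local (\<lambda>a b. a) 0 ?q \<le> wander T c ?q + c * \<delta>"
      unfolding root_local_def
    proof (rule cSUP_least[OF quads_nonempty[OF q]])
      fix x assume "x \<in> mspace (qspace ?q)"
      then have x: "x \<in> verts G" by simp
      have "0 < mass G * walk_local_time G Y k x \<omega>"
        by (rule less_le_trans[OF _ L[OF x]]) (use \<epsilon> k in simp)
      then have "0 < walk_local_time G Y k x \<omega>" using mass_pos by (simp add: zero_less_mult_iff)
      then have "\<exists>i<k. Y i \<omega> = x"
        unfolding walk_local_time_pos_iff[OF vwt_pos[OF G card x]] .
      then obtain i where i: "i < k" "Y i \<omega> = x" by blast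
      define s where "s = real i / \<beta>"
      have \<beta>s: "\<beta> * s = real i" using \<beta> by (simp add: s_def)
      have "real i / \<beta> < real k / \<beta>" using i \<beta> by (simp add: divide_strict_right_mono)
      then have s: "0 \<le> s" "s < \<delta>" using False \<beta> by (auto simp: s_def)
      have sT: "s \<in> {0..T}" using s \<delta> by simp
      have "mdist (qspace ?q) (qroot ?q) (qpath ?q s) - c * s \<le> wander T c ?q"
        unfolding wander_def by (rule cSUP_upper[OF sT wander_bdd_above[OF q c]])
      moreover have "qpath ?q s = x" using i by (simp add: \<beta>s)
      moreover have "c * s \<le> c * \<delta>" using c s by (simp add: mult_left_mono)
      ultimately show "mdist (qspace ?q) (qroot ?q) x \<le> wander T c ?q + c * \<delta>" by simp
    qed
    then show ?thesis by simp
  qed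
qed

text \<open>A time \<open>s\<close> at which the blanket condition holds with margin \<open>\<delta>\<close> may be rounded up to the next
  multiple of \<open>1 / \<beta>\<close>, which is smaller than \<open>\<delta>\<close>: local times are increasing in time.\<close>

lemma blanket_of_excess:
  assumes q: "walk_quad G d r Y \<alpha> \<beta> \<omega> \<in> quads T" and \<epsilon>: "0 < \<epsilon>" "\<epsilon> < 1" and \<delta>: "0 < \<delta>" "\<delta> < t" "t \<le> T"
    and \<beta>1: "1 / \<beta> < \<delta>" and ex: "\<delta> < excess 0 (t - \<delta>) \<epsilon> (walk_quad G d r Y \<alpha> \<beta> \<omega>)"
  shows "walk_blanket_time G Y \<epsilon> \<omega> / ereal \<beta> < ereal t"
proof -
  let ?q = "walk_quad G d r Y \<alpha> \<beta> \<omega>"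
  have "0 \<le> t - \<delta>" "t - \<delta> \<le> T" using \<delta> by auto
  from less_excess[OF q order_refl this ex] obtain s where s: "s \<in> {0..t - \<delta>}"
    and L: "\<And>x. x \<in> verts G \<Longrightarrow> \<delta> + \<epsilon> * s < \<alpha> * walk_local_time_lin G Y (\<beta> * s) x \<omega>" by auto
  have "s \<noteq> 0"
  proof
    assume "s = 0"
    with L[OF r] have "\<delta> < \<alpha> * walk_local_time_lin G Y (real 0) r \<omega>" by simp
    then show False unfolding walk_local_time_lin_nat using \<delta> by (simp add: walk_local_time_def)
  qed
  then have s0: "0 < s" using s by simp
  then have bs: "0 < \<beta> * s" using \<beta> by simp
  define k where "k = nat \<lceil>\<beta> * s\<rceil>"
  have k: "1 \<le> k" "\<beta> * s \<le> real k" "real k < \<beta> * s + 1" using bs unfolding k_def by linarith+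
  have b\<delta>: "1 < \<beta> * \<delta>" using \<beta>1 \<beta> by (simp add: pos_divide_less_eq mult.commute)
  have "walk_blanket_time G Y \<epsilon> \<omega> \<le> ereal (real k)"
  proof (rule walk_blanket_time_le[OF k(1)])
    fix x assume x: "x \<in> verts G"
    have "\<epsilon> * real k \<le> \<epsilon> * (\<beta> * s + 1)" using k \<epsilon> by (intro mult_left_mono) auto
    also have "\<dots> \<le> \<epsilon> * \<beta> * s + \<beta> * \<delta>" using \<epsilon> b\<delta> by (simp add: distrib_left mult.assoc)
    also have "\<dots> = \<beta> * (\<delta> + \<epsilon> * s)" by (simp add: algebra_simps)
    also have "\<dots> \<le> \<beta> * (\<alpha> * walk_local_time_lin G Y (\<beta> * s) x \<omega>)"
      using L[OF x] \<beta> by (intro mult_left_mono) auto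
    also have "\<dots> = mass G * walk_local_time_lin G Y (\<beta> * s) x \<omega>" by (simp add: \<alpha>\<beta>[symmetric])
    also have "\<dots> \<le> mass G * walk_local_time G Y k x \<omega>"
      unfolding k_def using mass_pos bs by (intro mult_left_mono walk_local_time_lin_le_ceiling[OF G x]) auto
    finally show "\<epsilon> * real k \<le> mass G * walk_local_time G Y k x \<omega>" .
  qed
  then have "walk_blanket_time G Y \<epsilon> \<omega> / ereal \<beta> \<le> ereal (real k / \<beta>)"
    using \<beta> by (subst rescaled_le_iff) simp
  also have "real k / \<beta> < t"
  proof -
    have "real k < \<beta> * s + \<beta> * \<delta>" using k b\<delta> by simp
    also have "\<dots> = \<beta> * (s + \<delta>)" by (simp add: distrib_left)
    also have "\<dots> \<le> \<beta> * t" using s \<beta> by (intro mult_left_mono) auto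
    finally show ?thesis using \<beta> by (simp add: pos_divide_less_eq mult.commute)
  qed
  then have "ereal (real k / \<beta>) < ereal t" by simp
  finally show ?thesis .
qed

text \<open>The mean of the rescaled local times with respect to the stationary law is \<open>t\<close>, so their maximum is
  at least \<open>t\<close>.\<close>

lemma walk_max_local_time:
  assumes q: "walk_quad G d r Y \<alpha> \<beta> \<omega> \<in> quads T" and \<omega>: "\<omega> \<in> space M" and t: "t \<in> {0..T}"
  shows "t \<le> root_local (\<lambda>a b. b) t (walk_quad G d r Y \<alpha> \<beta> \<omega>)"
proof -
  let ?q = "walk_quad G d r Y \<alpha> \<beta> \<omega>"
  let ?S = "root_local (\<lambda>a b. b) t ?q"
  have up: "\<alpha> * walk_local_time_lin G Y (\<beta> * t) x \<omega> \<le> ?S" if "x \<in> verts G" for x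
  proof -
    have "qloc ?q t x \<le> ?S"
      unfolding root_local_def using root_local_bdd_above[OF q t, of "\<lambda>a b. b"] that
      by (intro cSUP_upper) auto
    then show ?thesis by simp
  qed
  have "mass G * t = \<alpha> * (\<beta> * t)" by (simp add: \<alpha>\<beta>[symmetric])
  also have "\<dots> = (\<Sum>x\<in>verts G. vwt G x * (\<alpha> * walk_local_time_lin G Y (\<beta> * t) x \<omega>))"
    using \<beta> t by (subst (1) sum_walk_local_time_lin[OF G card Y \<omega>, of "\<beta> * t", symmetric])
      (auto simp: sum_distrib_left mult_ac)
  also have "\<dots> \<le> (\<Sum>x\<in>verts G. vwt G x * ?S)"
    using up vwt_pos[OF G card] by (intro sum_mono mult_left_mono) (auto simp: less_imp_le)
  also have "\<dots> = mass G * ?S" by (simp add: mass_def sum_distrib_right)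
  finally show ?thesis using mass_pos by simp
qed

text \<open>Before its first step the walk has spent no time away from the root.\<close>

lemma walk_local_time_before_first_step:
  assumes u: "0 \<le> u" "\<beta> * u < 1" and Y0: "Y 0 \<omega> = r" and x: "x \<noteq> r"
  shows "walk_local_time_lin G Y (\<beta> * u) x \<omega> = 0"
proof -
  have "\<lfloor>\<beta> * u\<rfloor> = 0" using u \<beta> by (intro floor_unique) auto
  then show ?thesis using Y0 x by (simp add: walk_local_time_lin_def walk_local_time_def Let_def)
qed

lemma walk_root_local_zero:
  assumes q: "walk_quad G d r Y \<alpha> \<beta> \<omega> \<in> quads T" and u: "0 \<le> u" "\<beta> * u < 1" "u \<le> T" and Y0: "Y 0 \<omega> = r"
  shows "root_local min u (walk_quad G d r Y \<alpha> \<beta> \<omega>) \<le> 0"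
  unfolding root_local_def
proof (rule cSUP_least[OF quads_nonempty[OF q]])
  fix x
  interpret Metric_space "mspace d" "mdist d" by simp
  show "min (mdist (qspace (walk_quad G d r Y \<alpha> \<beta> \<omega>)) (qroot (walk_quad G d r Y \<alpha> \<beta> \<omega>)) x)
      (qloc (walk_quad G d r Y \<alpha> \<beta> \<omega>) u x) \<le> 0"
    using walk_local_time_before_first_step[OF u(1,2) Y0, of x] r d by (cases "x = r") auto
qed

text \<open>Some vertex other than the root has not been visited before the first step.\<close>

lemma walk_excess_zero:
  assumes q: "walk_quad G d r Y \<alpha> \<beta> \<omega> \<in> quads T" and u: "0 \<le> u" "\<beta> * u < 1" "u \<le> T" and Y0: "Y 0 \<omega> = r"
  shows "excess u u 0 (walk_quad G d r Y \<alpha> \<beta> \<omega>) \<le> 0"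
proof (rule ccontr)
  let ?q = "walk_quad G d r Y \<alpha> \<beta> \<omega>"
  assume "\<not> excess u u 0 ?q \<le> 0"
  then have "0 < excess u u 0 ?q" by simp
  from less_excess[OF q u(1) order_refl u(3) this] obtain s where "s \<in> {u..u}"
    and L: "\<And>x. x \<in> mspace (qspace ?q) \<Longrightarrow> 0 + 0 * s < qloc ?q s x" by metis
  then have s: "s = u" by simp
  have "verts G \<noteq> {r}" using card by auto
  then obtain x where x: "x \<in> verts G" "x \<noteq> r" using r by blast
  then show False using L[of x] walk_local_time_before_first_step[OF u(1,2) Y0 x(2)] by (simp add: s)
qed

end


section \<open>Hunt processes without local time off the root\<close>

lemma openin_in_sets_mborel: "openin (mtopology_of m) U \<Longrightarrow> U \<in> sets (mborel m)"
  unfolding mborel_def by (subst sets_measure_of) (auto dest!: openin_subset)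

lemma openin_compl_singleton: "openin (mtopology_of m) (mspace m - {x})"
proof (cases "x \<in> mspace m")
  case True
  interpret Metric_space "mspace m" "mdist m" by simp
  have "closedin mtopology {x}"
    using Hausdorff_space_mtopology True by (simp add: closedin_Hausdorff_sing_eq)
  then show ?thesis by (simp add: mtopology_of_def closedin_def)
next
  case False
  then show ?thesis by (metis Diff_empty Diff_insert0 openin_topspace topspace_mtopology_of)
qed

lemma singleton_in_sets_mborel: "x \<in> mspace m \<Longrightarrow> {x} \<in> sets (mborel m)"
  using sets.compl_sets[OF openin_in_sets_mborel[OF openin_compl_singleton[of m x]]]
  by (simp add: double_diff)

lemma hunt_process_prob_space:
  assumes "hunt_process K \<Omega> X P" "x \<in> mspace K"
  shows "prob_space (P x)" "sets (P x) = sets \<Omega>" "space (P x) = space \<Omega>"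
proof -
  have "P x \<in> space (prob_algebra \<Omega>)"
    using assms by (auto simp: hunt_process_def intro: measurable_space)
  then show "prob_space (P x)" "sets (P x) = sets \<Omega>" by (auto simp: space_prob_algebra)
  then show "space (P x) = space \<Omega>" by (metis sets_eq_imp_space_eq)
qed

text \<open>By right-continuity, a path that is away from \<open>y\<close> at time \<open>s\<close> stays away for some time.\<close>

lemma cadlag_leaves_slowly:
  assumes c: "cadlag_on K T x" and s: "s \<in> {0..<T}" and ne: "x s \<noteq> y"
  obtains h where "0 < h" "\<And>r. s \<le> r \<Longrightarrow> r < s + h \<Longrightarrow> x r \<noteq> y"
proof -
  have lim: "limitin (mtopology_of K) x (x s) (at_right s)" using c s by (auto simp: cadlag_on_def)
  have in_compl: "x s \<in> mspace K - {y}" using c s ne by (auto simp: cadlag_on_def)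
  have "\<forall>\<^sub>F r in at_right s. x r \<in> mspace K - {y}"
    by (rule lim[unfolded limitin_def, THEN conjunct2, rule_format, OF conjI[OF openin_compl_singleton in_compl]])
  then obtain b where b: "b > s" "\<And>r. s < r \<Longrightarrow> r < b \<Longrightarrow> x r \<in> mspace K - {y}"
    unfolding eventually_at_right_field by blast
  show thesis
  proof (rule that[of "b - s"])
    show "0 < b - s" using b by simp
    show "x r \<noteq> y" if "s \<le> r" "r < s + (b - s)" for r
      using b(2)[of r] that ne by (cases "r = s") auto
  qed
qed

text \<open>If a Hunt process started from \<open>\<rho>\<close> does not leave \<open>\<rho>\<close> during a fixed initial time interval,
  it never does, by the Markov property.\<close>

lemma hunt_process_trapped:
  assumes H: "hunt_process K \<Omega> X P" and \<rho>: "\<rho> \<in> mspace K" and u: "0 < u"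
    and stay: "\<And>s. 0 \<le> s \<Longrightarrow> s < u \<Longrightarrow> AE \<omega> in P \<rho>. X s \<omega> = \<rho>"
  shows "AE \<omega> in P \<rho>. \<forall>s\<ge>0. X s \<omega> = \<rho>"
proof -
  note P = hunt_process_prob_space[OF H \<rho>]
  interpret prob_space "P \<rho>" by (rule P)
  define v where "v = u / 2"
  have v: "0 < v" "v < u" using u by (auto simp: v_def)
  obtain \<F> :: "ennreal \<Rightarrow> 'b measure" where F: "filtration (space \<Omega>) \<F>" and SM: "strong_markov K \<F> X P"
    using H by (auto simp: hunt_process_def)
  interpret F: filtration "space \<Omega>" \<F> by (rule F)
  have Xm: "X s \<in> P \<rho> \<rightarrow>\<^sub>M mborel K" if "0 \<le> s" for s
    using H that P(2) by (simp add: hunt_process_def cong: measurable_cong_sets)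
  have ev: "{\<omega>\<in>space (P \<rho>). X s \<omega> = \<rho>} \<in> events" if "0 \<le> s" for s
    using measurable_sets[OF Xm[OF that] singleton_in_sets_mborel[OF \<rho>]]
    by (simp add: vimage_def Int_def conj_commute)
  define p where "p s = emeasure (P \<rho>) {\<omega>\<in>space (P \<rho>). X s \<omega> = \<rho>}" for s
  have p1: "p s = 1 \<longleftrightarrow> (AE \<omega> in P \<rho>. X s \<omega> = \<rho>)" if "0 \<le> s" for s
    unfolding p_def emeasure_eq_measure prob_Collect_eq_1[OF ev[OF that], symmetric] by simp
  \<comment> \<open>Markov property at the fixed time \<open>v\<close>, at which the process is at \<open>\<rho>\<close>.\<close>
  have step: "p (v + s) = p s" if s: "0 \<le> s" for s
  proof -
    have st: "stopping_time \<F> (\<lambda>_. ennreal v)" by (rule stopping_time_const)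
    have A: "space \<Omega> \<in> sets (F.pre_sigma (\<lambda>_. ennreal v))"
      using sets.top[of "F.pre_sigma (\<lambda>_. ennreal v)"] by (simp add: F.space_pre_sigma)
    have eq: "emeasure (P \<rho>) {\<omega>\<in>space \<Omega>. ennreal v < \<infinity> \<and> X (enn2real (ennreal v) + s) \<omega> \<in> {\<rho>}} =
          (\<integral>\<^sup>+\<omega>. indicator {\<omega>\<in>space \<Omega>. ennreal v < \<infinity>} \<omega> *
             (let y = X (enn2real (ennreal v)) \<omega> in emeasure (P y) {\<omega>'\<in>space (P y). X s \<omega>' \<in> {\<rho>}}) \<partial>P \<rho>)"
      using SM[unfolded strong_markov_def, rule_format, OF st \<rho> s singleton_in_sets_mborel[OF \<rho>]] A
      by (simp only: F.space_F)
    have "p (v + s) = emeasure (P \<rho>) {\<omega>\<in>space \<Omega>. ennreal v < \<infinity> \<and> X (enn2real (ennreal v) + s) \<omega> \<in> {\<rho>}}"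
      using v by (simp add: p_def P(3))
    also have "\<dots> = (\<integral>\<^sup>+\<omega>. p s \<partial>P \<rho>)"
      unfolding eq
    proof (rule nn_integral_cong_AE)
      show "AE \<omega> in P \<rho>. indicator {\<omega>\<in>space \<Omega>. ennreal v < \<infinity>} \<omega> *
             (let y = X (enn2real (ennreal v)) \<omega> in emeasure (P y) {\<omega>'\<in>space (P y). X s \<omega>' \<in> {\<rho>}}) = p s"
        using stay[OF less_imp_le[OF v(1)] v(2)] AE_space
      proof eventually_elim
        case (elim \<omega>)
        then show ?case using v by (simp add: p_def P(3))
      qed
    qed
    also have "\<dots> = p s" by (simp add: emeasure_space_1)
    finally show ?thesis .
  qed
  have p: "p s = 1" if "0 \<le> s" "s < real k * v" for k s
    using that
  proof (induction k arbitrary: s)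
    case (Suc k)
    show ?case
    proof (cases "s < u")
      case True
      then show ?thesis using p1[OF Suc.prems(1)] stay[OF Suc.prems(1)] by simp
    next
      case False
      then have s: "0 \<le> s - v" using v by simp
      have "s - v < real k * v" using Suc.prems by (simp add: distrib_right)
      from Suc.IH[OF s this] step[OF s] show ?thesis by simp
    qed
  qed simp
  have fixed: "AE \<omega> in P \<rho>. X s \<omega> = \<rho>" if s: "0 \<le> s" for s
  proof -
    obtain k where "s < real k * v" using reals_Archimedean3[OF v(1)] by blast
    then show ?thesis using p[OF s] p1[OF s] by blast
  qed
  \<comment> \<open>Countably many times, and then all times by right-continuity.\<close>
  have "AE \<omega> in P \<rho>. \<forall>a\<in>\<rat> \<inter> {0..}. X a \<omega> = \<rho>"
    by (subst AE_ball_countable) (auto intro: fixed countable_rat countable_Int1)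
  then show ?thesis
    using AE_space
  proof eventually_elim
    case (elim \<omega>)
    show ?case
    proof (intro allI impI, rule ccontr)
      fix s :: real assume s: "0 \<le> s" "X s \<omega> \<noteq> \<rho>"
      have "cadlag_on K (s + 1) (\<lambda>t. X t \<omega>)" using H elim s P(3) by (simp add: hunt_process_def)
      then obtain h where h: "0 < h" "\<And>r. s \<le> r \<Longrightarrow> r < s + h \<Longrightarrow> X r \<omega> \<noteq> \<rho>"
        by (rule cadlag_leaves_slowly[where s = s]) (use s in auto)
      obtain a where a: "a \<in> \<rat>" "s < a" "a < s + h" using Rats_dense_in_real[of s "s + h"] h by auto
      then show False using elim(1) h(2)[of a] s by auto
    qed
  qed
qed

text \<open>The occupation density formula for a single path \<open>x\<close> and its local times \<open>l\<close> (time first, then space).\<close>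

definition occupation_density :: "'a measure \<Rightarrow> 'a metric \<Rightarrow> (real \<Rightarrow> 'a) \<Rightarrow> (real \<Rightarrow> 'a \<Rightarrow> real) \<Rightarrow> bool" where
  "occupation_density \<pi> K x l \<longleftrightarrow> (\<forall>t\<ge>0. \<forall>f :: 'a \<Rightarrow> ennreal. f \<in> borel_measurable (mborel K) \<longrightarrow>
     (\<integral>\<^sup>+s\<in>{0..t}. f (x s) \<partial>lborel) = (\<integral>\<^sup>+y. f y * ennreal (l t y) \<partial>\<pi>))"

lemma occupation_density_open:
  assumes "occupation_density \<pi> K x l" "0 \<le> t" "openin (mtopology_of K) U"
  shows "(\<integral>\<^sup>+s\<in>{0..t}. indicator U (x s) \<partial>lborel) = (\<integral>\<^sup>+y. indicator U y * ennreal (l t y) \<partial>\<pi>)"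
  using assms openin_in_sets_mborel[OF assms(3)] unfolding occupation_density_def by auto

text \<open>Without local time off \<open>\<rho>\<close>, almost all times before \<open>u\<close> are spent at \<open>\<rho>\<close>, hence all of them by
  right-continuity.\<close>

lemma trapped_of_local_time_zero:
  assumes occ: "occupation_density \<pi> K x l" and c: "cadlag_on K u x"
    and zero: "\<And>y. y \<in> mspace K \<Longrightarrow> y \<noteq> \<rho> \<Longrightarrow> l u y = 0" and s: "0 \<le> s" "s < u"
  shows "x s = \<rho>"
proof (rule ccontr)
  assume "x s \<noteq> \<rho>"
  with c s obtain h where h: "0 < h" "\<And>r. s \<le> r \<Longrightarrow> r < s + h \<Longrightarrow> x r \<noteq> \<rho>"
    by (auto elim: cadlag_leaves_slowly[where s = s])
  define b where "b = min (s + h) u"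
  have b: "s < b" "b \<le> s + h" "b \<le> u" using h s by (auto simp: b_def)
  let ?U = "mspace K - {\<rho>}"
  have "(\<integral>\<^sup>+r. indicator {s..<b} r \<partial>lborel) \<le> (\<integral>\<^sup>+r\<in>{0..u}. indicator ?U (x r) \<partial>lborel)"
  proof (rule nn_integral_mono)
    fix r
    show "indicator {s..<b} r \<le> (indicator ?U (x r) :: ennreal) * indicator {0..u} r"
    proof (cases "r \<in> {s..<b}")
      case True
      then have "x r \<noteq> \<rho>" "r \<in> {0..u}" using h(2)[of r] b s by auto
      moreover have "x r \<in> mspace K" using c \<open>r \<in> {0..u}\<close> by (auto simp: cadlag_on_def)
      ultimately show ?thesis using True by simp
    qed simp
  qed
  also have "\<dots> = (\<integral>\<^sup>+y. indicator ?U y * ennreal (l u y) \<partial>\<pi>)"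
    by (rule occupation_density_open[OF occ _ openin_compl_singleton]) (use s in simp)
  also have "\<dots> = (\<integral>\<^sup>+y. 0 \<partial>\<pi>)"
  proof (rule nn_integral_cong)
    fix y
    show "indicator ?U y * ennreal (l u y) = 0"
      by (cases "y \<in> ?U") (simp_all add: zero)
  qed
  finally have "ennreal (b - s) \<le> 0" using b by simp
  then show False using b by (simp add: ennreal_le_iff2)
qed

text \<open>A positive local time at \<open>y\<close> would persist on a neighbourhood of \<open>y\<close>, which has positive measure by full
  support, although no time is spent there.\<close>

lemma local_time_zero_of_trapped:
  assumes occ: "occupation_density \<pi> K x l" and stay: "\<And>s. 0 \<le> s \<Longrightarrow> x s = \<rho>"
    and \<pi>: "sets \<pi> = sets (mborel K)"
    and supp: "\<And>U. openin (mtopology_of K) U \<Longrightarrow> U \<noteq> {} \<Longrightarrow> 0 < emeasure \<pi> U"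
    and t: "0 \<le> t" and nn: "\<And>y. y \<in> mspace K \<Longrightarrow> 0 \<le> l t y"
    and cont: "\<And>y e. y \<in> mspace K \<Longrightarrow> 0 < e \<Longrightarrow> \<exists>\<delta>>0. \<forall>z\<in>mspace K. mdist K y z < \<delta> \<longrightarrow> \<bar>l t z - l t y\<bar> < e"
    and y: "y \<in> mspace K" "y \<noteq> \<rho>"
  shows "l t y = 0"
proof (rule ccontr)
  interpret Metric_space "mspace K" "mdist K" by simp
  assume "l t y \<noteq> 0"
  then have pos: "0 < l t y" using nn[OF y(1)] by simp
  define a where "a = l t y / 2"
  have a: "0 < a" using pos by (simp add: a_def)
  obtain \<delta> where \<delta>: "0 < \<delta>" "\<And>z. z \<in> mspace K \<Longrightarrow> mdist K y z < \<delta> \<Longrightarrow> \<bar>l t z - l t y\<bar> < a"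
    using cont[OF y(1) a] by blast
  define U where "U = mball y \<delta> \<inter> (mspace K - {\<rho>})"
  have U: "openin (mtopology_of K) U"
    unfolding U_def using openin_compl_singleton[of K \<rho>] by (simp add: mtopology_of_def openin_Int)
  have Une: "U \<noteq> {}" using y \<delta> by (auto simp: U_def)
  have Us: "U \<in> sets \<pi>" using openin_in_sets_mborel[OF U] \<pi> by simp
  have "ennreal a * emeasure \<pi> U = (\<integral>\<^sup>+z. ennreal a * indicator U z \<partial>\<pi>)"
    using Us by (simp add: nn_integral_cmult_indicator)
  also have "\<dots> \<le> (\<integral>\<^sup>+z. indicator U z * ennreal (l t z) \<partial>\<pi>)"
  proof (rule nn_integral_mono)
    fix z
    show "ennreal a * indicator U z \<le> indicator U z * ennreal (l t z)"
    proof (cases "z \<in> U")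
      case True
      then have "\<bar>l t z - l t y\<bar> < a" by (intro \<delta>(2)) (auto simp: U_def)
      then have "a \<le> l t z" unfolding a_def by linarith
      then show ?thesis using True by (simp add: ennreal_leI)
    qed simp
  qed
  also have "\<dots> = (\<integral>\<^sup>+s\<in>{0..t}. indicator U (x s) \<partial>lborel)"
    by (rule occupation_density_open[OF occ t U, symmetric])
  also have "\<dots> = (\<integral>\<^sup>+(s::real). (0::ennreal) \<partial>lborel)"
    by (rule nn_integral_cong) (auto simp: indicator_def stay U_def)
  finally have "ennreal a * emeasure \<pi> U \<le> 0" by simp
  then show False using supp[OF U Une] a by simp
qed

text \<open>If there is no local time off the root at one positive time \<open>u\<close>, there never is any.\<close>

lemma local_times_zero:
  assumes H: "hunt_process K \<Omega> X P" and LT: "local_times K \<pi> X P L" and \<rho>: "\<rho> \<in> mspace K"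
    and \<pi>: "sets \<pi> = sets (mborel K)"
    and supp: "\<And>U. openin (mtopology_of K) U \<Longrightarrow> U \<noteq> {} \<Longrightarrow> 0 < emeasure \<pi> U"
    and u: "0 < u" and zero: "AE \<omega> in P \<rho>. \<forall>y\<in>mspace K. y \<noteq> \<rho> \<longrightarrow> L u y \<omega> = 0"
  shows "AE \<omega> in P \<rho>. \<forall>t\<ge>0. \<forall>y\<in>mspace K. y \<noteq> \<rho> \<longrightarrow> L t y \<omega> = 0"
proof -
  note P = hunt_process_prob_space[OF H \<rho>]
  have LTae: "AE \<omega> in P \<rho>. (\<forall>t\<ge>0. \<forall>y\<in>mspace K. 0 \<le> L t y \<omega>) \<and>
     occupation_density \<pi> K (\<lambda>s. X s \<omega>) (\<lambda>t y. L t y \<omega>) \<and>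
     (\<forall>T>0. \<forall>y\<in>mspace K. \<forall>e>0. \<exists>\<delta>>0. \<forall>z\<in>mspace K. mdist K y z < \<delta> \<longrightarrow>
            (\<forall>t\<in>{0..T}. \<bar>L t z \<omega> - L t y \<omega>\<bar> < e))"
    using LT \<rho> unfolding local_times_def occupation_density_def by blast
  have "AE \<omega> in P \<rho>. \<forall>s\<ge>0. X s \<omega> = \<rho>"
  proof (rule hunt_process_trapped[OF H \<rho> u])
    fix s assume s: "0 \<le> s" "s < u"
    show "AE \<omega> in P \<rho>. X s \<omega> = \<rho>"
      using LTae zero AE_space
    proof eventually_elim
      case (elim \<omega>)
      have "cadlag_on K u (\<lambda>t. X t \<omega>)" using H elim u P(3) by (simp add: hunt_process_def)
      with elim show ?case
        using trapped_of_local_time_zero[of \<pi> K "\<lambda>s. X s \<omega>" "\<lambda>t y. L t y \<omega>" u \<rho> s] s by blast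
    qed
  qed
  then show ?thesis
    using LTae
  proof eventually_elim
    case (elim \<omega>)
    show ?case
    proof (intro allI ballI impI)
      fix t :: real and y assume t: "0 \<le> t" and y: "y \<in> mspace K" "y \<noteq> \<rho>"
      show "L t y \<omega> = 0"
      proof (rule local_time_zero_of_trapped[of \<pi> K "\<lambda>s. X s \<omega>" "\<lambda>t y. L t y \<omega>" \<rho> t y, OF _ _ \<pi> supp t _ _ y])
        show "occupation_density \<pi> K (\<lambda>s. X s \<omega>) (\<lambda>t y. L t y \<omega>)" using elim by blast
        show "0 \<le> L t z \<omega>" if "z \<in> mspace K" for z using elim t that by blast
        fix z and e :: real assume ze: "z \<in> mspace K" "0 < e"
        have "0 < t + 1" using t by simp
        then obtain \<delta> where "\<delta> > 0" "\<forall>w\<in>mspace K. mdist K z w < \<delta> \<longrightarrow> (\<forall>s\<in>{0..t + 1}. \<bar>L s w \<omega> - L s z \<omega>\<bar> < e)"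
          using elim(2) ze by blast
        then show "\<exists>\<delta>>0. \<forall>w\<in>mspace K. mdist K z w < \<delta> \<longrightarrow> \<bar>L t w \<omega> - L t z \<omega>\<bar> < e"
          using t by (intro exI[of _ \<delta>]) auto
      qed (use elim in auto)
    qed
  qed
qed


section \<open>The blanket time of the limit process\<close>

lemma process_quad_simps [simp]:
  "qspace (process_quad K \<rho> \<pi> X L \<omega>) = K" "qroot (process_quad K \<rho> \<pi> X L \<omega>) = \<rho>"
  "qpath (process_quad K \<rho> \<pi> X L \<omega>) t = X t \<omega>" "qloc (process_quad K \<rho> \<pi> X L \<omega>) t x = L t x \<omega>"
  by (simp_all add: process_quad_def)

lemma blanket_time_nonneg: "0 \<le> blanket_time K L \<epsilon> \<omega>"
  unfolding blanket_time_def by (intro Inf_greatest) auto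

lemma blanket_time_le:
  assumes "0 < t" "\<And>x. x \<in> mspace K \<Longrightarrow> \<epsilon> * t \<le> L t x \<omega>"
  shows "blanket_time K L \<epsilon> \<omega> \<le> ereal t"
  unfolding blanket_time_def using assms by (intro Inf_lower) blast

lemma blanket_time_less:
  assumes "blanket_time K L \<epsilon> \<omega> < a"
  obtains t where "0 < t" "ereal t < a" "\<And>x. x \<in> mspace K \<Longrightarrow> \<epsilon> * t \<le> L t x \<omega>"
  using assms unfolding blanket_time_def Inf_less_iff by blast

lemma blanket_time_le_of_excess:
  assumes q: "process_quad K \<rho> \<pi> X L \<omega> \<in> quads T" and \<delta>: "0 < \<delta>" "\<delta> \<le> t" "t \<le> T"
    and ex: "0 \<le> excess \<delta> t \<epsilon> (process_quad K \<rho> \<pi> X L \<omega>)"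
  shows "blanket_time K L \<epsilon> \<omega> \<le> ereal t"
proof -
  obtain s where s: "s \<in> {\<delta>..t}" "\<And>x. x \<in> mspace K \<Longrightarrow> \<epsilon> * s \<le> L s x \<omega>"
    using excess_nonneg_attained[OF q less_imp_le[OF \<delta>(1)] \<delta>(2,3) ex] by auto
  have "blanket_time K L \<epsilon> \<omega> \<le> ereal s" using s \<delta> by (intro blanket_time_le) auto
  also have "\<dots> \<le> ereal t" using s by simp
  finally show ?thesis .
qed

lemma blanket_time_less_iff_excess:
  assumes q: "process_quad K \<rho> \<pi> X L \<omega> \<in> quads t" and t: "0 < t"
  shows "blanket_time K L \<epsilon> \<omega> < ereal t \<longleftrightarrow>
    (\<exists>j. 1 / real (Suc j) \<le> t - 1 / real (Suc j) \<and>
       0 \<le> excess (1 / real (Suc j)) (t - 1 / real (Suc j)) \<epsilon> (process_quad K \<rho> \<pi> X L \<omega>))"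
proof
  assume "blanket_time K L \<epsilon> \<omega> < ereal t"
  then obtain s where s: "0 < s" "s < t" "\<And>x. x \<in> mspace K \<Longrightarrow> \<epsilon> * s \<le> L s x \<omega>"
    by (auto elim: blanket_time_less)
  obtain j where "1 / real (Suc j) < min s (t - s)"
    using reals_Archimedean[of "min s (t - s)"] s by (auto simp: inverse_eq_divide)
  then have j: "1 / real (Suc j) \<le> s" "s \<le> t - 1 / real (Suc j)" by auto
  have "0 \<le> excess (1 / real (Suc j)) (t - 1 / real (Suc j)) \<epsilon> (process_quad K \<rho> \<pi> X L \<omega>)"
    by (rule le_excess[OF q, where s = s]) (use j s in auto)
  then show "\<exists>j. 1 / real (Suc j) \<le> t - 1 / real (Suc j) \<and>
       0 \<le> excess (1 / real (Suc j)) (t - 1 / real (Suc j)) \<epsilon> (process_quad K \<rho> \<pi> X L \<omega>)"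
    using j by (intro exI[of _ j]) linarith
next
  assume "\<exists>j. 1 / real (Suc j) \<le> t - 1 / real (Suc j) \<and>
       0 \<le> excess (1 / real (Suc j)) (t - 1 / real (Suc j)) \<epsilon> (process_quad K \<rho> \<pi> X L \<omega>)"
  then obtain j where j: "1 / real (Suc j) \<le> t - 1 / real (Suc j)"
       "0 \<le> excess (1 / real (Suc j)) (t - 1 / real (Suc j)) \<epsilon> (process_quad K \<rho> \<pi> X L \<omega>)" by blast
  have "blanket_time K L \<epsilon> \<omega> \<le> ereal (t - 1 / real (Suc j))"
    by (rule blanket_time_le_of_excess[OF q _ j(1) _ j(2)]) auto
  also have "\<dots> < ereal t" by simp
  finally show "blanket_time K L \<epsilon> \<omega> < ereal t" .
qed

text \<open>Continuity in \<open>\<epsilon>\<close> turns the weak inequality that defines the blanket time into a strict one.\<close>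

lemma blanket_time_less_strict_excess:
  assumes q: "process_quad K \<rho> \<pi> X L \<omega> \<in> quads t"
    and cont: "isCont (\<lambda>\<epsilon>'. blanket_time K L \<epsilon>' \<omega>) \<epsilon>" and lt: "blanket_time K L \<epsilon> \<omega> < ereal t"
  shows "\<forall>\<^sub>F j in sequentially.
    1 / real (Suc j) < excess 0 (t - 1 / real (Suc j)) \<epsilon> (process_quad K \<rho> \<pi> X L \<omega>)"
proof -
  have "\<forall>\<^sub>F \<epsilon>' in at \<epsilon>. blanket_time K L \<epsilon>' \<omega> < ereal t"
    using cont lt unfolding isCont_def by (rule order_tendstoD)
  then obtain d where d: "d > 0" "\<And>\<epsilon>'. \<epsilon>' \<noteq> \<epsilon> \<Longrightarrow> dist \<epsilon>' \<epsilon> < d \<Longrightarrow> blanket_time K L \<epsilon>' \<omega> < ereal t"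
    unfolding eventually_at by blast
  define \<epsilon>' where "\<epsilon>' = \<epsilon> + d / 2"
  have \<epsilon>': "\<epsilon> < \<epsilon>'" using d by (simp add: \<epsilon>'_def)
  have "blanket_time K L \<epsilon>' \<omega> < ereal t" by (rule d(2)) (use d in \<open>auto simp: \<epsilon>'_def dist_real_def\<close>)
  then obtain s where s: "0 < s" "s < t" "\<And>x. x \<in> mspace K \<Longrightarrow> \<epsilon>' * s \<le> L s x \<omega>"
    by (auto elim: blanket_time_less)
  have lim: "(\<lambda>j. 1 / real (Suc j)) \<longlonglongrightarrow> 0"
    using LIMSEQ_inverse_real_of_nat by (simp add: inverse_eq_divide)
  have "0 < min (t - s) ((\<epsilon>' - \<epsilon>) * s)" using s \<epsilon>' by simp
  from order_tendstoD(2)[OF lim this] show ?thesis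
  proof eventually_elim
    case (elim j)
    have "(\<epsilon>' - \<epsilon>) * s \<le> excess 0 (t - 1 / real (Suc j)) \<epsilon> (process_quad K \<rho> \<pi> X L \<omega>)"
      by (rule le_excess[OF q, where s = s]) (use elim s in \<open>auto simp: algebra_simps\<close>)
    then show ?case using elim by linarith
  qed
qed

text \<open>Until some time \<open>s0\<close> the path stays within half of the radius \<open>R\<close> of the space around the root, and
  after \<open>s0\<close> the penalty \<open>c * s0\<close> is larger than \<open>1 / c\<close>. Here \<open>c = Suc j\<close> is the weight of the penalty
  and \<open>1 / c^2\<close> the time \<open>\<delta>\<close> of \<open>blanket_early_or_excess\<close>, so that \<open>c * \<delta>\<close> tends to \<open>0\<close> as well.\<close>

lemma wander_eventually_small:
  assumes q: "q \<in> quads T" and T: "0 < T" and start: "qpath q 0 = qroot q"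
    and ne: "mspace (qspace q) \<noteq> {qroot q}"
  shows "\<forall>\<^sub>F j in sequentially.
    wander T (real (Suc j)) q - (root_local (\<lambda>a b. a) 0 q - real (Suc j) * (1 / real (Suc j)^2)) < 0"
proof -
  let ?R = "root_local (\<lambda>a b. a) 0 q"
  let ?K = "mspace (qspace q)" and ?d = "mdist (qspace q) (qroot q)"
  interpret Metric_space ?K "mdist (qspace q)" by simp
  have root: "qroot q \<in> ?K" using q by (simp add: quads_def)
  have up: "?d x \<le> ?R" if "x \<in> ?K" for x
    unfolding root_local_def using root_local_bdd_above[OF q, of 0 "\<lambda>a b. a"] T that
    by (intro cSUP_upper) auto
  obtain x where x: "x \<in> ?K" "x \<noteq> qroot q" using ne root by blast
  then have "0 < ?d x" using root by (metis mdist_pos_eq)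
  then have R: "0 < ?R" using up[OF x(1)] by linarith
  have path: "qpath q s \<in> ?K" if "s \<in> {0..T}" for s using q that by (auto simp: quads_def cadlag_on_def)
  have "limitin mtopology (qpath q) (qpath q 0) (at_right 0)"
    using q T by (auto simp: quads_def cadlag_on_def mtopology_of_def)
  then have "\<forall>\<^sub>F s in at_right 0. mdist (qspace q) (qpath q s) (qroot q) < ?R / 2"
    using R unfolding limitin_metric start by (auto elim!: allE[of _ "?R / 2"] eventually_mono)
  then obtain s0 where s0: "s0 > 0" "\<And>s. 0 < s \<Longrightarrow> s < s0 \<Longrightarrow> ?d (qpath q s) < ?R / 2"
    unfolding eventually_at_right_field commute[of _ "qroot q"] by blast
  have lim: "(\<lambda>j. 1 / real (Suc j)) \<longlonglongrightarrow> 0"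
    using LIMSEQ_inverse_real_of_nat by (simp add: inverse_eq_divide)
  have "\<forall>\<^sub>F j in sequentially. 1 / real (Suc j) < min (?R / 2) s0"
    using R s0 by (intro order_tendstoD(2)[OF lim]) auto
  moreover have "\<forall>\<^sub>F j in sequentially. 1 < real (Suc j) * s0"
    using s0(1) by real_asymp
  ultimately show ?thesis
    using eventually_gt_at_top[of 0]
  proof eventually_elim
    case (elim j)
    let ?c = "real (Suc j)"
    have "wander T ?c q \<le> max (?R / 2) (?R - ?c * s0)"
      unfolding wander_def
    proof (rule cSUP_least)
      show "{0..T} \<noteq> {}" using T by simp
      fix s assume s: "s \<in> {0..T}"
      then have cs: "0 \<le> ?c * s" by simp
      consider "s = 0" | "0 < s" "s < s0" | "s0 \<le> s" using s by fastforce
      then show "?d (qpath q s) - ?c * s \<le> max (?R / 2) (?R - ?c * s0)"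
      proof cases
        case 1
        then show ?thesis using R start root by simp
      next
        case 2
        then show ?thesis using s0(2)[OF 2] cs by linarith
      next
        case 3
        then have "?c * s0 \<le> ?c * s" by (intro mult_left_mono) auto
        then show ?thesis using up[OF path[OF s]] by linarith
      qed
    qed
    moreover have "?c * (1 / ?c^2) = 1 / ?c" by (simp add: power2_eq_square)
    moreover have "1 / ?c < ?c * s0"
    proof -
      have "1 / ?c \<le> 1" by simp
      then show ?thesis using elim by linarith
    qed
    ultimately show ?case using elim by (simp add: max_def split: if_splits)
  qed
qed

text \<open>Up to a null set, the event that the blanket time is below \<open>t\<close> is a countable union of closed conditions
  on the quadruple, by \<open>blanket_time_less_iff_excess\<close>.\<close>

lemma blanket_time_borel:
  fixes K :: "'a metric"
  assumes re: "\<And>T. 0 < T \<Longrightarrow> random_element M (KK_topology T) (\<lambda>\<omega>. KK_class T (process_quad K \<rho> \<pi> X L \<omega>))"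
  shows "blanket_time K L \<epsilon> \<in> borel_measurable (completion M)"
proof -
  let ?q = "process_quad K \<rho> \<pi> X L"
  have less: "{\<omega>\<in>space (completion M). blanket_time K L \<epsilon> \<omega> < ereal t} \<in> sets (completion M)" if t: "0 < t" for t
  proof (rule completion.in_sets_AE)
    define J where "J = {j. 1 / real (Suc j) \<le> t - 1 / real (Suc j)}"
    define A where "A j = {\<omega>\<in>space (completion M).
      0 \<le> excess (1 / real (Suc j)) (t - 1 / real (Suc j)) \<epsilon> (?q \<omega>)}" for j
    have "A j \<in> sets (completion M)" if j: "j \<in> J" for j
    proof -
      have "quad_lipschitz t (excess (1 / real (Suc j)) (t - 1 / real (Suc j)) \<epsilon> :: 'a quad \<Rightarrow> real)"
        using j by (intro quad_lipschitz_excess) (auto simp: J_def)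
      from random_quad_borel[OF re[OF t] this t] show ?thesis unfolding A_def by measurable
    qed
    then show "(\<Union>j\<in>J. A j) \<in> sets (completion M)" by auto
    show "AE \<omega> in completion M. (\<omega> \<in> (\<Union>j\<in>J. A j)) =
        (\<omega> \<in> {\<omega>\<in>space (completion M). blanket_time K L \<epsilon> \<omega> < ereal t})"
      using AE_completion[OF random_quad_AE[OF re[OF t]]] AE_space
    proof eventually_elim
      case (elim \<omega>)
      show ?case
        using blanket_time_less_iff_excess[OF elim(1) t, of \<epsilon>] elim(2) by (auto simp: A_def J_def)
    qed
  qed auto
  show ?thesis
  proof (rule borel_measurableI_less)
    fix a :: ereal
    consider "a \<le> 0" | t where "a = ereal t" "0 < t" | "a = \<infinity>" by (cases a) force+
    then show "{\<omega>\<in>space (completion M). blanket_time K L \<epsilon> \<omega> < a} \<in> sets (completion M)"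
    proof cases
      case 1
      then have "\<not> blanket_time K L \<epsilon> \<omega> < a" for \<omega>
        using blanket_time_nonneg[of K L \<epsilon> \<omega>] by (simp add: not_less order_trans)
      then show ?thesis by simp
    next
      case 2
      then show ?thesis using less by simp
    next
      case 3
      have "blanket_time K L \<epsilon> \<omega> < a \<longleftrightarrow> (\<exists>n. blanket_time K L \<epsilon> \<omega> < ereal (real (Suc n)))" for \<omega>
      proof
        assume "blanket_time K L \<epsilon> \<omega> < a"
        then obtain r where r: "blanket_time K L \<epsilon> \<omega> = ereal r"
          using blanket_time_nonneg[of K L \<epsilon> \<omega>] 3 by (cases "blanket_time K L \<epsilon> \<omega>") auto
        obtain n where "r < real n" using reals_Archimedean2 by blast
        then have "r < real (Suc n)" by simp
        then show "\<exists>n. blanket_time K L \<epsilon> \<omega> < ereal (real (Suc n))" unfolding r less_ereal.simps by blast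
      next
        assume "\<exists>n. blanket_time K L \<epsilon> \<omega> < ereal (real (Suc n))"
        then show "blanket_time K L \<epsilon> \<omega> < a" unfolding 3 by auto
      qed
      then have "{\<omega>\<in>space (completion M). blanket_time K L \<epsilon> \<omega> < a} =
          (\<Union>n. {\<omega>\<in>space (completion M). blanket_time K L \<epsilon> \<omega> < ereal (real (Suc n))})" by auto
      also have "\<dots> \<in> sets (completion M)" by (intro sets.countable_UN image_subsetI less) simp
      finally show ?thesis .
    qed
  qed
qed


section \<open>Convergence of blanket times\<close>

theorem corollary1p2:
  fixes G :: "nat \<Rightarrow> 'a wgraph" and dG :: "nat \<Rightarrow> 'a metric" and \<rho>n :: "nat \<Rightarrow> 'a"
    and Pn :: "nat \<Rightarrow> 'v measure" and Xn :: "nat \<Rightarrow> nat \<Rightarrow> 'v \<Rightarrow> 'a"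
    and K :: "'a metric" and \<rho> :: 'a and \<pi> :: "'a measure"
    and \<Omega> :: "'w measure" and X :: "real \<Rightarrow> 'w \<Rightarrow> 'a" and P :: "'a \<Rightarrow> 'w measure"
    and L :: "real \<Rightarrow> 'a \<Rightarrow> 'w \<Rightarrow> real"
    and \<alpha> \<beta> :: "nat \<Rightarrow> real" and \<epsilon> :: real
  assumes "\<And>n. weighted_graph (G n)"
    and "\<And>n. 2 \<le> card (verts (G n))"
    and "\<And>n. mspace (dG n) = verts (G n)"
    and "\<And>n. \<rho>n n \<in> verts (G n)"
    and "\<And>n. random_walk (G n) (\<rho>n n) (Pn n) (Xn n)"
    and "compact_space (mtopology_of K)"
    and "\<rho> \<in> mspace K"
    and "sets \<pi> = sets (mborel K)"
    and "\<And>U. openin (mtopology_of K) U \<Longrightarrow> U \<noteq> {} \<Longrightarrow> 0 < emeasure \<pi> U"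
    and "hunt_process K \<Omega> X P"
    and "symmetric_process K \<pi> X P"
    and "local_times K \<pi> X P L"
    and "\<And>n. 0 < \<alpha> n" and "\<And>n. 0 < \<beta> n"
    and "\<And>n. \<alpha> n * \<beta> n = mass (G n)"
    and "\<And>T. 0 < T \<Longrightarrow>
       converges_in_distribution (KK_topology T)
         Pn (\<lambda>n \<omega>. KK_class T (walk_quad (G n) (dG n) (\<rho>n n) (Xn n) (\<alpha> n) (\<beta> n) \<omega>))
         (P \<rho>) (\<lambda>\<omega>. KK_class T (process_quad K \<rho> \<pi> X L \<omega>))"
    and "0 < \<epsilon>" and "\<epsilon> < 1"
    and "AE \<omega> in P \<rho>. isCont (\<lambda>\<epsilon>'. blanket_time K L \<epsilon>' \<omega>) \<epsilon>"
  shows "converges_in_distribution euclidean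
           Pn (\<lambda>n \<omega>. walk_blanket_time (G n) (Xn n) \<epsilon> \<omega> / ereal (\<beta> n))
           (P \<rho>) (blanket_time K L \<epsilon>)"
proof -
  \<comment> \<open>\<open>walk\<close> lists the hypotheses on the walks in the order required by the lemmas on the rescaled walk.\<close>
  note walk = assms(1-5,13,14,15) and \<rho> = assms(7) and hunt = assms(10) and conv = assms(16)
    and \<epsilon> = assms(17,18) and cont = assms(19)
  let ?qn = "\<lambda>n. walk_quad (G n) (dG n) (\<rho>n n) (Xn n) (\<alpha> n) (\<beta> n)"
  let ?q = "process_quad K \<rho> \<pi> X L"
  let ?Yn = "\<lambda>n \<omega>. walk_blanket_time (G n) (Xn n) \<epsilon> \<omega> / ereal (\<beta> n)"
  let ?Y = "blanket_time K L \<epsilon>"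
  have Pn: "prob_space (Pn n)" for n using walk(5) by (simp add: random_walk_def)
  have P: "prob_space (P \<rho>)" by (rule hunt_process_prob_space[OF hunt \<rho>])
  have re: "random_element (Pn n) (KK_topology T) (\<lambda>\<omega>. KK_class T (?qn n \<omega>))"
    "random_element (P \<rho>) (KK_topology T) (\<lambda>\<omega>. KK_class T (?q \<omega>))" if "0 < T" for T n
    using conv[OF that] by (simp_all add: converges_in_distribution_def)
  have qn: "AE \<omega> in Pn n. ?qn n \<omega> \<in> quads T" and q: "AE \<omega> in P \<rho>. ?q \<omega> \<in> quads T" if "0 < T" for T n
    using random_quad_AE[OF re(1)[OF that]] random_quad_AE[OF re(2)[OF that]] by auto
  define Mn where "Mn n = completion (Pn n)" for n
  define M where "M = completion (P \<rho>)"
  have sp [simp]: "space (Mn n) = space (Pn n)" "space M = space (P \<rho>)" for n by (simp_all add: Mn_def M_def)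
  have AEn: "AE \<omega> in Mn n. Q \<omega>" if "AE \<omega> in Pn n. Q \<omega>" for n Q using that unfolding Mn_def by (rule AE_completion)
  have AE: "AE \<omega> in M. Q \<omega>" if "AE \<omega> in P \<rho>. Q \<omega>" for Q using that unfolding M_def by (rule AE_completion)
  interpret Mn: prob_space "Mn n" for n unfolding Mn_def by (rule prob_space.prob_space_completion[OF Pn])
  interpret M: prob_space M unfolding M_def by (rule prob_space.prob_space_completion[OF P])
  have Ynm: "?Yn n \<in> borel_measurable (Pn n)" for n
    using walk_blanket_time_measurable[OF walk(1,5)] by measurable
  have [measurable]: "?Yn n \<in> borel_measurable (Mn n)" for n
    unfolding Mn_def by (rule measurable_completion[OF Ynm])
  have [measurable]: "?Y \<in> borel_measurable M"
    unfolding M_def by (rule blanket_time_borel[OF re(2)])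
  have Ym: "{\<omega>\<in>space M. ?Y \<omega> < a} \<in> M.events" "{\<omega>\<in>space M. ?Y \<omega> \<le> a} \<in> M.events" for a by measurable
  have Yme: "{\<omega>\<in>space (Mn n). ?Yn n \<omega> < a} \<in> Mn.events n" "{\<omega>\<in>space (Mn n). ?Yn n \<omega> \<le> a} \<in> Mn.events n" for n a
    by measurable
  have fm: "{\<omega>\<in>space M. 0 \<le> f (?q \<omega>)} \<in> M.events" "{\<omega>\<in>space M. v < f (?q \<omega>)} \<in> M.events"
    and fnm: "{\<omega>\<in>space (Mn n). 0 \<le> f (?qn n \<omega>)} \<in> Mn.events n" "{\<omega>\<in>space (Mn n). v < f (?qn n \<omega>)} \<in> Mn.events n"
    if "quad_lipschitz T f" "0 < T" for f T v n
  proof -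
    have [measurable]: "(\<lambda>\<omega>. f (?q \<omega>)) \<in> borel_measurable M"
      unfolding M_def by (rule random_quad_borel[OF re(2)[OF that(2)] that])
    have [measurable]: "(\<lambda>\<omega>. f (?qn n \<omega>)) \<in> borel_measurable (Mn n)" for n
      unfolding Mn_def by (rule random_quad_borel[OF re(1)[OF that(2)] that])
    show "{\<omega>\<in>space M. 0 \<le> f (?q \<omega>)} \<in> M.events" "{\<omega>\<in>space M. v < f (?q \<omega>)} \<in> M.events"
      "{\<omega>\<in>space (Mn n). 0 \<le> f (?qn n \<omega>)} \<in> Mn.events n" "{\<omega>\<in>space (Mn n). v < f (?qn n \<omega>)} \<in> Mn.events n"
      by measurable
  qed
  have port: "\<forall>\<^sub>F n in sequentially. Mn.prob n {\<omega>\<in>space (Mn n). 0 \<le> f (?qn n \<omega>)}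
      < M.prob {\<omega>\<in>space M. 0 \<le> f (?q \<omega>)} + e" if "quad_lipschitz T f" "0 < T" "0 < e" for f T e
    using portmanteau_quad[OF conv[OF that(2)] Pn P that] by (simp add: Mn_def M_def)
  have port_open: "\<forall>\<^sub>F n in sequentially. M.prob {\<omega>\<in>space M. v < f (?q \<omega>)} - e
      < Mn.prob n {\<omega>\<in>space (Mn n). v < f (?qn n \<omega>)}" if "quad_lipschitz T f" "0 < T" "0 < e" for f T e v
    using port[OF quad_lipschitz_diff[OF quad_lipschitz_const[of T v] that(1)] that(2,3)]
  proof eventually_elim
    case (elim n)
    have "Mn.prob n {\<omega>\<in>space (Mn n). 0 \<le> v - f (?qn n \<omega>)} = 1 - Mn.prob n {\<omega>\<in>space (Mn n). v < f (?qn n \<omega>)}"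
      by (subst Mn.prob_compl[OF fnm(2)[OF that(1,2)], symmetric]) (auto intro!: arg_cong[where f = "Mn.prob n"])
    moreover have "M.prob {\<omega>\<in>space M. 0 \<le> v - f (?q \<omega>)} = 1 - M.prob {\<omega>\<in>space M. v < f (?q \<omega>)}"
      by (subst M.prob_compl[OF fm(2)[OF that(1,2)], symmetric]) (auto intro!: arg_cong[where f = M.prob])
    ultimately show ?case using elim by simp
  qed
  note lim_AE = frequently_AE_limit[OF conv Pn P]
  have Xn0: "AE \<omega> in Pn n. Xn n 0 \<omega> = \<rho>n n" for n using walk(5) by (simp add: random_walk_def)
  have X0: "AE \<omega> in P \<rho>. X 0 \<omega> = \<rho>" using hunt \<rho> by (simp add: hunt_process_def)
  \<comment> \<open>In a one-point limit space the local time at the root is at least \<open>t\<close>.\<close>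
  have one_point: "AE \<omega> in P \<rho>. t \<le> L t \<rho> \<omega>" if K: "mspace K = {\<rho>}" and t: "0 < t" for t
  proof -
    have "quad_lipschitz t (\<lambda>q :: 'a quad. root_local (\<lambda>a b. b) t q - t)"
      using t by (intro quad_lipschitz_diff quad_lipschitz_const quad_lipschitz_root_local) auto
    then have "AE \<omega> in P \<rho>. 0 \<le> root_local (\<lambda>a b. b) t (?q \<omega>) - t"
    proof (rule lim_AE[OF t _ t])
      have ge: "AE \<omega> in Pn n. ?qn n \<omega> \<in> quads t \<longrightarrow> 0 \<le> root_local (\<lambda>a b. b) t (?qn n \<omega>) - t" for n
        using AE_space
      proof eventually_elim
        case (elim \<omega>)
        show ?case
        proof
          assume qn: "?qn n \<omega> \<in> quads t"
          have "t \<in> {0..t}" using t by simp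
          from walk_max_local_time[OF walk qn elim this]
          show "0 \<le> root_local (\<lambda>a b. b) t (?qn n \<omega>) - t" by simp
        qed
      qed
      show "\<exists>\<^sub>F n in sequentially. AE \<omega> in Pn n. ?qn n \<omega> \<in> quads t \<longrightarrow>
          0 \<le> root_local (\<lambda>a b. b) t (?qn n \<omega>) - t"
        by (intro eventually_frequently[OF sequentially_bot] always_eventually allI ge)
    qed
    then show ?thesis by eventually_elim (simp add: root_local_def K)
  qed
  show ?thesis
  proof (rule converges_in_distribution_times[OF Pn P measurable_completion[OF Ynm] blanket_time_borel[OF re(2)]])
    show "0 \<le> ?Yn n \<omega>" for n \<omega>
      using walk_blanket_time_nonneg[of "G n" "Xn n" \<epsilon> \<omega>] walk(7)[of n]
      by (cases "walk_blanket_time (G n) (Xn n) \<epsilon> \<omega>") auto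
    show "0 \<le> ?Y \<omega>" for \<omega> by (rule blanket_time_nonneg)
  next
    fix t e :: real assume t: "0 < t" and e: "0 < e"
    have "\<forall>\<^sub>F n in sequentially. Mn.prob n {\<omega>\<in>space (Mn n). ?Yn n \<omega> \<le> ereal t}
        < M.prob {\<omega>\<in>space M. ?Y \<omega> \<le> ereal t} + e"
    proof (cases "mspace K = {\<rho>}")
      case True
      have "AE \<omega> in M. ?Y \<omega> \<le> ereal t"
        using AE[OF one_point[OF True t]]
      proof eventually_elim
        case (elim \<omega>)
        have "\<epsilon> * t \<le> 1 * t" using \<epsilon> t by (intro mult_right_mono) auto
        also have "1 * t \<le> L t \<rho> \<omega>" using elim by simp
        finally show ?case using True t by (intro blanket_time_le) auto
      qed
      then have "M.prob {\<omega>\<in>space M. ?Y \<omega> \<le> ereal t} = 1" using M.prob_Collect_eq_1[OF Ym(2)] by simp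
      then show ?thesis
        using e by (intro always_eventually allI le_less_trans[OF Mn.prob_le_1]) simp
    next
      case False
      \<comment> \<open>\<open>0 \<le> ?W j\<close> holds when the whole space has been reached before time \<open>1 / Suc j ^ 2\<close>.\<close>
      let ?W = "\<lambda>j q :: 'a quad. wander t (real (Suc j)) q - (root_local (\<lambda>a b. a) 0 q - real (Suc j) * (1 / real (Suc j)^2))"
      have W: "quad_lipschitz t (?W j)" for j
        using t by (intro quad_lipschitz_diff quad_lipschitz_const quad_lipschitz_wander quad_lipschitz_root_local) auto
      have "(\<lambda>j. M.prob {\<omega>\<in>space M. 0 \<le> ?W j (?q \<omega>)}) \<longlonglongrightarrow> 0"
      proof (rule M.prob_eventually_null[OF fm(1)[OF W t]])
        show "AE \<omega> in M. \<forall>\<^sub>F j in sequentially. \<omega> \<notin> {\<omega>\<in>space M. 0 \<le> ?W j (?q \<omega>)}"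
          using AE[OF q[OF t]] AE[OF X0]
        proof eventually_elim
          case (elim \<omega>)
          have "\<forall>\<^sub>F j in sequentially. ?W j (?q \<omega>) < 0"
            by (rule wander_eventually_small[OF elim(1) t]) (use elim(2) False in auto)
          then show ?case by eventually_elim simp
        qed
      qed
      moreover have "(\<lambda>j. 1 / real (Suc j)^2) \<longlonglongrightarrow> 0" by real_asymp
      ultimately have "\<forall>\<^sub>F j in sequentially. M.prob {\<omega>\<in>space M. 0 \<le> ?W j (?q \<omega>)} < e / 3 \<and> 1 / real (Suc j)^2 < t"
        using e t by (intro eventually_conj order_tendstoD) auto
      then obtain j where j: "M.prob {\<omega>\<in>space M. 0 \<le> ?W j (?q \<omega>)} < e / 3" "1 / real (Suc j)^2 < t"
        by (auto simp: eventually_sequentially)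
      let ?\<delta> = "1 / real (Suc j)^2"
      have \<delta>: "0 < ?\<delta>" by simp
      have E: "quad_lipschitz t (excess ?\<delta> t \<epsilon> :: 'a quad \<Rightarrow> real)"
        using j by (intro quad_lipschitz_excess) auto
      have EY: "M.prob {\<omega>\<in>space M. 0 \<le> excess ?\<delta> t \<epsilon> (?q \<omega>)} \<le> M.prob {\<omega>\<in>space M. ?Y \<omega> \<le> ereal t}"
      proof (rule M.finite_measure_mono_AE[OF _ Ym(2)])
        show "AE \<omega> in M. \<omega> \<in> {\<omega>\<in>space M. 0 \<le> excess ?\<delta> t \<epsilon> (?q \<omega>)} \<longrightarrow> \<omega> \<in> {\<omega>\<in>space M. ?Y \<omega> \<le> ereal t}"
          using AE[OF q[OF t]]
        proof eventually_elim
          case (elim \<omega>)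
          then show ?case using blanket_time_le_of_excess[OF elim \<delta> less_imp_le[OF j(2)] order_refl] by blast
        qed
      qed
      have e3: "0 < e / 3" using e by simp
      show ?thesis
        using port[OF W t e3, of j] port[OF E t e3]
      proof eventually_elim
        case (elim n)
        let ?A = "{\<omega>\<in>space (Mn n). 0 \<le> excess ?\<delta> t \<epsilon> (?qn n \<omega>)}" and ?B = "{\<omega>\<in>space (Mn n). 0 \<le> ?W j (?qn n \<omega>)}"
        note A = fnm(1)[OF E t, of n] and B = fnm(1)[OF W t, of n j]
        have "Mn.prob n {\<omega>\<in>space (Mn n). ?Yn n \<omega> \<le> ereal t} \<le> Mn.prob n (?A \<union> ?B)"
        proof (rule Mn.finite_measure_mono_AE[OF _ sets.Un[OF A B]])
          show "AE \<omega> in Mn n. \<omega> \<in> {\<omega>\<in>space (Mn n). ?Yn n \<omega> \<le> ereal t} \<longrightarrow> \<omega> \<in> ?A \<union> ?B"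
            using AEn[OF qn[OF t]]
          proof eventually_elim
            case (elim \<omega>)
            then show ?case
              using blanket_early_or_excess[OF walk elim \<delta> less_imp_le[OF j(2)] order_refl _ \<epsilon>(1), of "real (Suc j)"]
              by auto
          qed
        qed
        also have "\<dots> \<le> Mn.prob n ?A + Mn.prob n ?B" by (rule measure_Un_le[OF A B])
        finally show ?case using elim j(1) EY by linarith
      qed
    qed
    then show "\<forall>\<^sub>F n in sequentially. measure (completion (Pn n)) {\<omega>\<in>space (Pn n). ?Yn n \<omega> \<le> ereal t}
        < measure (completion (P \<rho>)) {\<omega>\<in>space (P \<rho>). ?Y \<omega> \<le> ereal t} + e"
      by (simp add: Mn_def M_def)
  next
    fix t e :: real assume t: "0 < t" and e: "0 < e"
    have "\<forall>\<^sub>F n in sequentially. M.prob {\<omega>\<in>space M. ?Y \<omega> < ereal t} - e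
        < Mn.prob n {\<omega>\<in>space (Mn n). ?Yn n \<omega> < ereal t}"
    proof (cases "filterlim \<beta> at_top sequentially")
      case True
      \<comment> \<open>The index is shifted by \<open>N\<close> below so that the time interval is nonempty.\<close>
      let ?E = "\<lambda>j. excess 0 (t - 1 / real (Suc j)) \<epsilon> :: 'a quad \<Rightarrow> real"
      have "\<forall>\<^sub>F j in sequentially. 1 / real (Suc j) < t" using t by real_asymp
      then obtain N where N: "\<And>j. N \<le> j \<Longrightarrow> 1 / real (Suc j) < t" unfolding eventually_sequentially by blast
      have E: "quad_lipschitz t (?E (j + N))" for j
        using N[of "j + N"] by (intro quad_lipschitz_excess) auto
      let ?S = "\<lambda>j. {\<omega>\<in>space M. 1 / real (Suc (j + N)) < ?E (j + N) (?q \<omega>)}"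
      have "\<forall>\<^sub>F j in sequentially. M.prob {\<omega>\<in>space M. ?Y \<omega> < ereal t} - e / 2 < M.prob (?S j)"
      proof (rule M.prob_eventually_covers[OF fm(2)[OF E t] Ym(1)])
        show "AE \<omega> in M. \<omega> \<in> {\<omega>\<in>space M. ?Y \<omega> < ereal t} \<longrightarrow> (\<forall>\<^sub>F j in sequentially. \<omega> \<in> ?S j)"
          using AE[OF q[OF t]] AE[OF cont]
        proof eventually_elim
          case (elim \<omega>)
          show ?case
          proof
            assume \<omega>: "\<omega> \<in> {\<omega>\<in>space M. ?Y \<omega> < ereal t}"
            then have "\<forall>\<^sub>F j in sequentially. 1 / real (Suc j) < ?E j (?q \<omega>)"
              by (intro blanket_time_less_strict_excess[OF elim]) auto
            then have "\<forall>\<^sub>F j in sequentially. 1 / real (Suc (j + N)) < ?E (j + N) (?q \<omega>)"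
              by (subst eventually_sequentially_seg)
            then show "\<forall>\<^sub>F j in sequentially. \<omega> \<in> ?S j" by eventually_elim (use \<omega> in simp)
          qed
        qed
      qed (use e in simp)
      then obtain j where j: "M.prob {\<omega>\<in>space M. ?Y \<omega> < ereal t} - e / 2 < M.prob (?S j)"
        by (auto simp: eventually_sequentially)
      let ?\<delta> = "1 / real (Suc (j + N))"
      have \<delta>: "0 < ?\<delta>" "?\<delta> < t" using N[of "j + N"] by auto
      have e2: "0 < e / 2" using e by simp
      have "\<forall>\<^sub>F n in sequentially. real (Suc (j + N)) < \<beta> n"
        using True unfolding filterlim_at_top_dense by blast
      then show ?thesis
        using port_open[OF E t e2, of "?\<delta>" j]
      proof eventually_elim
        case (elim n)
        have \<beta>: "1 / \<beta> n < ?\<delta>" using elim(1) walk(7)[of n] by (intro divide_strict_left_mono) auto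
        have "Mn.prob n {\<omega>\<in>space (Mn n). ?\<delta> < ?E (j + N) (?qn n \<omega>)} \<le> Mn.prob n {\<omega>\<in>space (Mn n). ?Yn n \<omega> < ereal t}"
        proof (rule Mn.finite_measure_mono_AE[OF _ Yme(1)])
          show "AE \<omega> in Mn n. \<omega> \<in> {\<omega>\<in>space (Mn n). ?\<delta> < ?E (j + N) (?qn n \<omega>)} \<longrightarrow>
              \<omega> \<in> {\<omega>\<in>space (Mn n). ?Yn n \<omega> < ereal t}"
            using AEn[OF qn[OF t]]
          proof eventually_elim
            case (elim \<omega>)
            then show ?case using blanket_of_excess[OF walk elim \<epsilon> \<delta> order_refl \<beta>] by blast
          qed
        qed
        then show ?case using elim(2) j by linarith
      qed
    next
      case False
      \<comment> \<open>For infinitely many \<open>n\<close> the rescaled walk has not moved by a fixed time \<open>u\<close>; this forces the limit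
        process to stay at \<open>\<rho>\<close>.\<close>
      then obtain c where c: "\<not> (\<forall>\<^sub>F n in sequentially. c < \<beta> n)" unfolding filterlim_at_top_dense by blast
      define u where "u = 1 / (\<bar>c\<bar> + 1)"
      have u: "0 < u" by (simp add: u_def)
      have fr: "\<exists>\<^sub>F n in sequentially. \<beta> n * u < 1"
        using c unfolding not_eventually
      proof (rule frequently_elim1)
        fix n assume "\<not> c < \<beta> n"
        then have "\<beta> n < \<bar>c\<bar> + 1" by linarith
        then show "\<beta> n * u < 1" by (simp add: u_def)
      qed
      have zero: "AE \<omega> in P \<rho>. 0 \<le> - root_local min u (?q \<omega>)" "AE \<omega> in P \<rho>. 0 \<le> - excess u u 0 (?q \<omega>)"
      proof -
        have "quad_lipschitz u (root_local min u :: 'a quad \<Rightarrow> real)"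
          using u by (intro quad_lipschitz_root_local) (auto simp: min_def)
        then have "quad_lipschitz u (\<lambda>q :: 'a quad. - root_local min u q)" by (rule quad_lipschitz_minus)
        then show "AE \<omega> in P \<rho>. 0 \<le> - root_local min u (?q \<omega>)"
        proof (rule lim_AE[OF u _ u])
          show "\<exists>\<^sub>F n in sequentially. AE \<omega> in Pn n. ?qn n \<omega> \<in> quads u \<longrightarrow> 0 \<le> - root_local min u (?qn n \<omega>)"
            using fr
          proof (rule frequently_elim1)
            fix n assume n: "\<beta> n * u < 1"
            show "AE \<omega> in Pn n. ?qn n \<omega> \<in> quads u \<longrightarrow> 0 \<le> - root_local min u (?qn n \<omega>)"
              using Xn0[of n] by eventually_elim
                (use walk_root_local_zero[OF walk _ less_imp_le[OF u] n order_refl] in auto)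
          qed
        qed
        have "quad_lipschitz u (excess u u 0 :: 'a quad \<Rightarrow> real)"
          using u by (intro quad_lipschitz_excess) auto
        then have "quad_lipschitz u (\<lambda>q :: 'a quad. - excess u u 0 q)" by (rule quad_lipschitz_minus)
        then show "AE \<omega> in P \<rho>. 0 \<le> - excess u u 0 (?q \<omega>)"
        proof (rule lim_AE[OF u _ u])
          show "\<exists>\<^sub>F n in sequentially. AE \<omega> in Pn n. ?qn n \<omega> \<in> quads u \<longrightarrow> 0 \<le> - excess u u 0 (?qn n \<omega>)"
            using fr
          proof (rule frequently_elim1)
            fix n assume n: "\<beta> n * u < 1"
            show "AE \<omega> in Pn n. ?qn n \<omega> \<in> quads u \<longrightarrow> 0 \<le> - excess u u 0 (?qn n \<omega>)"
              using Xn0[of n] by eventually_elim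
                (use walk_excess_zero[OF walk _ less_imp_le[OF u] n order_refl] in auto)
          qed
        qed
      qed
      have K: "mspace K \<noteq> {\<rho>}"
      proof
        assume K: "mspace K = {\<rho>}"
        have "AE \<omega> in P \<rho>. False"
          using one_point[OF K u] zero(2)
        proof eventually_elim
          case (elim \<omega>)
          then show False using u by (simp add: excess_def K)
        qed
        then show False using prob_space.AE_False[OF P] by simp
      qed
      then obtain y where y: "y \<in> mspace K" "y \<noteq> \<rho>" using \<rho> by blast
      have "AE \<omega> in P \<rho>. \<forall>y\<in>mspace K. y \<noteq> \<rho> \<longrightarrow> L u y \<omega> = 0"
        using zero(1) q[OF u]
      proof eventually_elim
        case (elim \<omega>)
        show ?case
        proof (intro ballI impI)
          interpret Metric_space "mspace K" "mdist K" by simp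
          fix y assume y: "y \<in> mspace K" "y \<noteq> \<rho>"
          have "bdd_above ((\<lambda>x. min (mdist (qspace (?q \<omega>)) (qroot (?q \<omega>)) x) (qloc (?q \<omega>) u x)) ` mspace (qspace (?q \<omega>)))"
            using u by (intro root_local_bdd_above[OF elim(2)]) (auto simp: min_def)
          from cSUP_upper[OF _ this, of y] y(1)
          have "min (mdist K \<rho> y) (L u y \<omega>) \<le> root_local min u (?q \<omega>)" by (simp add: root_local_def)
          moreover have "0 < mdist K \<rho> y" using y \<rho> by (metis mdist_pos_eq)
          moreover have "0 \<le> L u y \<omega>" using elim(2) y(1) u by (auto simp: quads_def)
          ultimately show "L u y \<omega> = 0" using elim(1) by (auto simp: min_def split: if_splits)
        qed
      qed
      then have trapped: "AE \<omega> in P \<rho>. \<forall>t\<ge>0. \<forall>y\<in>mspace K. y \<noteq> \<rho> \<longrightarrow> L t y \<omega> = 0"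
        by (intro local_times_zero[OF hunt assms(12) \<rho> assms(8) _ u] assms(9))
      have "AE \<omega> in M. \<not> ?Y \<omega> < ereal t"
        using AE[OF trapped]
      proof eventually_elim
        case (elim \<omega>)
        show ?case
        proof
          assume "?Y \<omega> < ereal t"
          then obtain s where s: "0 < s" "\<And>x. x \<in> mspace K \<Longrightarrow> \<epsilon> * s \<le> L s x \<omega>" by (auto elim: blanket_time_less)
          have "\<epsilon> * s \<le> 0" using s(2)[OF y(1)] elim y s(1) by simp
          moreover have "0 < \<epsilon> * s" using s(1) \<epsilon> by simp
          ultimately show False by simp
        qed
      qed
      then have "M.prob {\<omega>\<in>space M. ?Y \<omega> < ereal t} = 0" using M.prob_Collect_eq_0[OF Ym(1)] by simp
      then show ?thesis
        using e by (intro always_eventually allI less_le_trans[OF _ measure_nonneg]) simp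
    qed
    then show "\<forall>\<^sub>F n in sequentially. measure (completion (P \<rho>)) {\<omega>\<in>space (P \<rho>). ?Y \<omega> < ereal t} - e
        < measure (completion (Pn n)) {\<omega>\<in>space (Pn n). ?Yn n \<omega> < ereal t}"
      by (simp add: Mn_def M_def)
  qed
qed

end
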